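(* For every $n\geq 2$, the entropy of the rotationally symmetric convex translating soliton (bowl soliton) $\Gamma^n\subset\mathbf{R}^{n+1}$ is equal to the entropy of the sphere $\mathbf{S}^{n-1}$, i.e. $$\lambda(\Gamma^n)=\lambda(\mathbf{S}^{n-1})=n\alpha(n)\Big(\frac{n-1}{2\pi e}\Big)^{\frac{n-1}{2}},$$ where $\alpha(n)$ is the volume of the unit ball in $\mathbf{R}^n$.
   Context: For $n\ge2$, the bowl soliton is the entire graph $\Gamma^n=\{(x,f(x)):x\in\mathbf{R}^n\}\subset\mathbf{R}^{n+1}$, where $f$ is the (unique) rotationally symmetric convex function on $\mathbf{R}^n$ with $\mathrm{div}\big(\nabla f/\sqrt{1+|\nabla f|^2}\big)=1/\sqrt{1+|\nabla f|^2}$ and $f(0)=0$, $\nabla f(0)=0$. Writing $f=f(r)$, $r=|x|$, this is the ODE $f_{rr}=(1+f_r^2)\big(1-\frac{(n-1)f_r}{r}\big)$ on $r>0$ with $f(0)=\lim_{r\to0}f'(r)=0$. For a hypersurface $\Sigma^m\subset\mathbf{R}^{m+1}$, $z_0\in\mathbf{R}^{m+1}$ and $t_0>0$, the $F$-functional is $F_{z_0,t_0}(\Sigma)=(4\pi t_0)^{-m/2}\int_\Sigma e^{-|x-z_0|^2/(4t_0)}\,d\mu$, where $d\mu$ is the $m$-dimensional area measure of $\Sigma$, and the entropy of $\Sigma$ is $\lambda(\Sigma)=\sup_{z_0,t_0}F_{z_0,t_0}(\Sigma)$, the supremum being over all $z_0\in\mathbf{R}^{m+1}$ and $t_0>0$.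 Here $\mathbf{S}^{n-1}\subset\mathbf{R}^n$ is the round sphere (the entropy does not depend on its radius or center). *)

theory Defs
  imports "HOL-Analysis.Analysis"
begin

text \<open>
  The area measure of an embedded \<open>m\<close>-dimensional \<open>C\<^sup>1\<close> submanifold is defined through its local
  \<open>C\<^sup>1\<close> parametrizations.  The parameter space is \<open>real ^ 'm\<close>, so the dimension \<open>m = CARD('m)\<close>
  enters as a type argument; a hypersurface is the case \<open>DIM('a) = CARD('m) + 1\<close>.
\<close>

definition local_parametrization ::
  "'a::euclidean_space set \<Rightarrow> (real ^ 'm::finite) set \<Rightarrow> (real ^ 'm \<Rightarrow> 'a) \<Rightarrow> bool" where
  "local_parametrization S U \<phi> \<longleftrightarrow>
     open U \<and>
     \<phi> differentiable_on U \<and>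
     (\<forall>v. continuous_on U (\<lambda>x. frechet_derivative \<phi> (at x) v)) \<and>
     (\<forall>x\<in>U. inj (frechet_derivative \<phi> (at x))) \<and>
     (\<exists>\<psi>. homeomorphism U (\<phi> ` U) \<phi> \<psi>) \<and>
     openin (top_of_set S) (\<phi> ` U)"

definition area_element :: "(real ^ 'm::finite \<Rightarrow> 'a::euclidean_space) \<Rightarrow> real ^ 'm \<Rightarrow> real" where
  "area_element \<phi> x =
     sqrt (det (\<chi> i j. frechet_derivative \<phi> (at x) (axis i 1) \<bullet>
                        frechet_derivative \<phi> (at x) (axis j 1)))"

definition is_area_measure ::
  "'m::finite itself \<Rightarrow> 'a::euclidean_space set \<Rightarrow> 'a measure \<Rightarrow> bool" where
  "is_area_measure T S \<mu> \<longleftrightarrow>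
     sets \<mu> = sets borel \<and>
     emeasure \<mu> (- S) = 0 \<and>
     (\<forall>U (\<phi> :: real ^ 'm \<Rightarrow> 'a). local_parametrization S U \<phi> \<longrightarrow>
        (\<forall>A \<in> sets borel. A \<subseteq> \<phi> ` U \<longrightarrow>
           emeasure \<mu> A = (\<integral>\<^sup>+ x \<in> U \<inter> \<phi> -` A. ennreal (area_element \<phi> x) \<partial>lborel)))"

text \<open>
  For an embedded \<open>C\<^sup>1\<close> submanifold such a measure exists (change of variables makes the
  prescriptions of two parametrizations agree on overlaps) and is unique (countably many
  parametrized patches cover \<open>S\<close>).
\<close>

definition area_measure :: "'m::finite itself \<Rightarrow> 'a::euclidean_space set \<Rightarrow> 'a measure" where
  "area_measure T S = (THE \<mu>. is_area_measure T S \<mu>)"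

definition F_functional ::
  "'m::finite itself \<Rightarrow> 'a::euclidean_space \<Rightarrow> real \<Rightarrow> 'a set \<Rightarrow> ennreal" where
  "F_functional T z\<^sub>0 t\<^sub>0 S =
     ennreal ((4 * pi * t\<^sub>0) powr (- (real CARD('m) / 2))) *
     (\<integral>\<^sup>+ x \<in> S. ennreal (exp (- ((norm (x - z\<^sub>0))\<^sup>2 / (4 * t\<^sub>0)))) \<partial>area_measure T S)"

definition entropy :: "'m::finite itself \<Rightarrow> 'a::euclidean_space set \<Rightarrow> ennreal" where
  "entropy T S = (SUP z\<^sub>0 \<in> UNIV. SUP t\<^sub>0 \<in> {0<..}. F_functional T z\<^sub>0 t\<^sub>0 S)"

definition grad :: "(real ^ 'n::finite \<Rightarrow> real) \<Rightarrow> real ^ 'n \<Rightarrow> real ^ 'n" where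
  "grad f x = (\<chi> i. frechet_derivative f (at x) (axis i 1))"

definition divergence :: "(real ^ 'n::finite \<Rightarrow> real ^ 'n) \<Rightarrow> real ^ 'n \<Rightarrow> real" where
  "divergence X x = (\<Sum>i\<in>UNIV. frechet_derivative X (at x) (axis i 1) $ i)"

definition C2_function :: "(real ^ 'n::finite \<Rightarrow> real) \<Rightarrow> bool" where
  "C2_function f \<longleftrightarrow>
     f differentiable_on UNIV \<and>
     grad f differentiable_on UNIV \<and>
     (\<forall>v. continuous_on UNIV (\<lambda>x. frechet_derivative (grad f) (at x) v))"

definition bowl_function :: "(real ^ 'n::finite \<Rightarrow> real) \<Rightarrow> bool" where
  "bowl_function f \<longleftrightarrow>
     C2_function f \<and>
     (\<forall>x y. norm x = norm y \<longrightarrow> f x = f y) \<and>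
     convex_on UNIV f \<and>
     (\<forall>x. divergence (\<lambda>y. grad f y /\<^sub>R sqrt (1 + (norm (grad f y))\<^sup>2)) x =
            1 / sqrt (1 + (norm (grad f x))\<^sup>2)) \<and>
     f 0 = 0 \<and> grad f 0 = 0"

definition graph_of :: "(real ^ 'n::finite \<Rightarrow> real) \<Rightarrow> ((real ^ 'n) \<times> real) set" where
  "graph_of f = {(x, f x) | x. x \<in> UNIV}"

end

theory Submission
  imports Defs "HOL-Probability.Distributions"
begin

text \<open>
  A translator moves by translation under the mean curvature flow, so Huisken's monotonicity formula
  says that \<open>F\<close> evaluated at \<open>((a, b + \<tau>), t + \<tau>)\<close> does not decrease in \<open>\<tau>\<close>. As \<open>\<tau>\<close> grows, the bowl seen
  at scale \<open>sqrt \<tau>\<close> becomes a round cylinder. Quantitatively: after the substitution \<open>y = G r\<close>, where \<open>G\<close> is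
  the profile, the height integral is a one-dimensional Gaussian of mass at most 1, and what remains
  is \<open>r ^ (n - 1) * exp (- r\<^sup>2 / (4 t))\<close>, whose maximum over \<open>r\<close> gives the entropy of the sphere. Only the linear
  bounds \<open>r / n \<le> G' r \<le> r / (n - 1)\<close> on the slope are needed, and centering at height \<open>G R\<close> with
  \<open>t = R\<^sup>2 / (2 (n - 1))\<close>, \<open>R \<rightarrow> \<infinity>\<close>, attains the bound in the limit.

  For the sphere itself, off-centre Gaussians are controlled by the logarithmic derivative \<open>y\<close> of
  \<open>\<rho> \<mapsto> \<integral> exp (\<rho> x\<^sub>1)\<close>: rotation invariance and Cauchy-Schwarz give \<open>(n - 1) y \<le> \<rho> (1 - y\<^sup>2)\<close>, which is the bound
  needed for the centred Gaussian to be optimal.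
\<close>


section \<open>Determinants and permuted coordinates\<close>

text \<open>Two obstacles shape the proof. \<open>area_measure\<close> is a definite description, so
  no integral over a hypersurface can be evaluated before an explicit measure is shown to meet the
  specification on every chart and to be the only one that does. For a graph the explicit measure is
  a density pushed up from the base; for the sphere it is cone volume in the unit ball, which
  reduces rotation invariance to that of Lebesgue measure.

  The second obstacle is that the direct estimate of \<open>F\<close> on the bowl is not sharp at a
  fixed scale. The substitution by height needs a factor \<open>g r\<close>, whereas the area
  density is \<open>sqrt (1 + (g r)\<^sup>2)\<close>, and the Gaussian may be centred off the axis.
  Both defects amount to bounded corrections of the radius, which can be traded against a fraction
  \<delta> of the Gaussian exponent. The price is a factor that tends to 1 only when \<delta> tends
  to 0 and \<open>t * \<delta>\<close> to infinity. Monotonicity is what carries an arbitrary centre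
  and scale to such a large scale without decreasing \<open>F\<close>.\<close>

text \<open>The library proves the change of variables formula only for index types of class \<^class>\<open>wellorder\<close>;
  this copy of a finite type carries such an order.\<close>

typedef ('a::finite) fin_index = "{..<CARD('a)}"
  by (auto intro!: exI[of _ 0])

instance fin_index :: (finite) finite
proof
  have "inj (Rep_fin_index :: 'a fin_index \<Rightarrow> nat)"
    by (simp add: inj_def Rep_fin_index_inject)
  moreover have "range (Rep_fin_index :: 'a fin_index \<Rightarrow> nat) \<subseteq> {..<CARD('a)}"
    using Rep_fin_index by blast
  ultimately show "finite (UNIV :: 'a fin_index set)"
    by (metis finite_lessThan inj_on_finite)
qed

instantiation fin_index :: (finite) wellorder
begin

definition less_eq_fin_index :: "'a fin_index \<Rightarrow> 'a fin_index \<Rightarrow> bool" where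
  "x \<le> y \<longleftrightarrow> Rep_fin_index x \<le> Rep_fin_index y"

definition less_fin_index :: "'a fin_index \<Rightarrow> 'a fin_index \<Rightarrow> bool" where
  "x < y \<longleftrightarrow> Rep_fin_index x < Rep_fin_index y"

instance
proof
  fix P :: "'a fin_index \<Rightarrow> bool" and a :: "'a fin_index"
  assume step: "\<And>x. (\<And>y. y < x \<Longrightarrow> P y) \<Longrightarrow> P x"
  show "P a"
    by (induction a rule: measure_induct_rule[of Rep_fin_index])
      (auto intro: step simp: less_fin_index_def)
qed (auto simp: less_eq_fin_index_def less_fin_index_def Rep_fin_index_inject)

end

lemma card_fin_index: "CARD('a::finite fin_index) = CARD('a)"
  using type_definition.card[OF type_definition_fin_index] by simp

section \<open>Leibniz sums over permutations of a subset of the indices\<close>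

lemma bij_betw_map_permutation:
  fixes b :: "'k \<Rightarrow> 'n"
  assumes "inj b"
  shows "bij_betw (map_permutation UNIV b) {p. p permutes UNIV} {p. p permutes range b}"
proof -
  have b: "bij_betw b UNIV (range b)" using assms by (simp add: bij_betw_def)
  have inv: "bij_betw (inv b) (range b) UNIV"
    using bij_betw_inv_into[OF b] .
  show ?thesis
  proof (rule bij_betw_byWitness[where f' = "map_permutation (range b) (inv b)"])
    show "\<forall>p\<in>{p. p permutes UNIV}. map_permutation (range b) (inv b) (map_permutation UNIV b p) = p"
      using map_permutation_compose_inv[OF b] assms by auto
    show "\<forall>p\<in>{p. p permutes range b}. map_permutation UNIV b (map_permutation (range b) (inv b) p) = p"
      using map_permutation_compose_inv[OF inv] by (auto simp: f_inv_into_f)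
    show "map_permutation UNIV b ` {p. p permutes UNIV} \<subseteq> {p. p permutes range b}"
      using map_permutation_permutes[OF b] by auto
    show "map_permutation (range b) (inv b) ` {p. p permutes range b} \<subseteq> {p. p permutes UNIV}"
      using map_permutation_permutes[OF inv] by auto
  qed
qed

text \<open>Conjugating by \<open>b\<close> preserves signs, so a Leibniz sum over the permutations
  that move only points of \<open>range b\<close> is the determinant of the matrix pulled back along
  \<open>b\<close>. With \<open>b\<close> bijective this is a relabelling of indices; with one index
  left out it is a principal minor.\<close>

lemma sum_permutes_range:
  fixes A :: "real^'n^'n" and b :: "'k::finite \<Rightarrow> 'n::finite"
  assumes "inj b"
  shows "(\<Sum>p | p permutes range b. of_int (sign p) * (\<Prod>i\<in>range b. A $ i $ p i)) = det (\<chi> i j. A $ b i $ b j)"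
proof -
  have "(\<Sum>p | p permutes range b. of_int (sign p) * (\<Prod>i\<in>range b. A $ i $ p i)) =
    (\<Sum>p | p permutes (UNIV::'k set). of_int (sign (map_permutation UNIV b p)) * (\<Prod>i\<in>range b. A $ i $ map_permutation UNIV b p i))"
    by (rule sum.reindex_bij_betw[OF bij_betw_map_permutation[OF assms], symmetric])
  also have "\<dots> = (\<Sum>p | p permutes (UNIV::'k set). of_int (sign p) * (\<Prod>i\<in>UNIV. A $ b i $ b (p i)))"
    using assms by (intro sum.cong refl) (simp add: sign_map_permutation prod.reindex map_permutation_apply)
  finally show ?thesis by (simp add: det_def)
qed

lemma det_reindex:
  fixes A :: "real^'n^'n" and b :: "'k::finite \<Rightarrow> 'n::finite"
  assumes "bij b"
  shows "det (\<chi> i j. A $ b i $ b j) = det A"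
  using sum_permutes_range[of b A] assms by (simp add: det_def bij_def)

text \<open>A permutation that moves \<open>i0\<close> selects an off-diagonal entry of row
  \<open>i0\<close>, which is zero. The surviving permutations fix \<open>i0\<close>, and their sum
  is the corner entry times a principal minor.\<close>

lemma det_block:
  fixes A :: "real^'n^'n" and b :: "'k::finite \<Rightarrow> 'n::finite"
  assumes "inj b" and r: "range b = UNIV - {i0}" and z: "\<And>j. j \<noteq> i0 \<Longrightarrow> A $ i0 $ j = 0"
  shows "det A = A $ i0 $ i0 * det (\<chi> i j. A $ b i $ b j)"
proof -
  have "det A = (\<Sum>p | p permutes range b. of_int (sign p) * (\<Prod>i\<in>UNIV. A $ i $ p i))"
    unfolding det_def
  proof (rule sum.mono_neutral_right)
    show "finite {p. p permutes (UNIV::'n set)}" by simp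
    show "{p. p permutes range b} \<subseteq> {p. p permutes UNIV}"
      using permutes_subset by blast
    show "\<forall>p\<in>{p. p permutes UNIV} - {p. p permutes range b}. of_int (sign p) * (\<Prod>i\<in>UNIV. A $ i $ p i) = 0"
    proof
      fix p assume p: "p \<in> {p. p permutes UNIV} - {p. p permutes range b}"
      have "p i0 \<noteq> i0"
      proof
        assume "p i0 = i0"
        then have "p permutes range b" unfolding r using p
          by (auto simp: permutes_def)
        with p show False by simp
      qed
      then have "(\<Prod>i\<in>UNIV. A $ i $ p i) = 0"
        using z by (intro prod_zero) auto
      then show "of_int (sign p) * (\<Prod>i\<in>UNIV. A $ i $ p i) = 0" by simp
    qed
  qed
  also have "\<dots> = (\<Sum>p | p permutes range b. A $ i0 $ i0 * (of_int (sign p) * (\<Prod>i\<in>range b. A $ i $ p i)))"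
  proof (intro sum.cong refl)
    fix p assume "p \<in> {p. p permutes range b}"
    then have "p i0 = i0" by (simp add: permutes_def r)
    moreover have "(\<Prod>i\<in>UNIV. A $ i $ p i) = A $ i0 $ p i0 * (\<Prod>i\<in>range b. A $ i $ p i)"
      unfolding r by (rule prod.remove) auto
    ultimately show "of_int (sign p) * (\<Prod>i\<in>UNIV. A $ i $ p i) = A $ i0 $ i0 * (of_int (sign p) * (\<Prod>i\<in>range b. A $ i $ p i))"
      by simp
  qed
  also have "\<dots> = A $ i0 $ i0 * det (\<chi> i j. A $ b i $ b j)"
    by (simp add: sum_distrib_left[symmetric] sum_permutes_range[OF assms(1)])
  finally show ?thesis .
qed

text \<open>Preimages of boxes are boxes with the same edge lengths in another order, and Lebesgue
  measure is determined by its values on boxes. The two spaces may be different types, which covers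
  both relabelling coordinates and splitting one coordinate off.\<close>

lemma distr_lborel_Basis_map:
  fixes T :: "'a::euclidean_space \<Rightarrow> 'b::euclidean_space"
  assumes "linear T" and bij: "bij_betw T Basis Basis"
  shows "distr lborel borel T = lborel"
proof (rule lborel_eqI[symmetric])
  interpret linear T by fact
  have [measurable]: "T \<in> borel_measurable borel"
    using assms(1) by (intro borel_measurable_continuous_onI linear_continuous_on) (simp add: linear_conv_bounded_linear)
  have TB: "T b \<in> Basis" if "b \<in> Basis" for b using bij that by (auto simp: bij_betw_def)
  have inj: "T b = T c \<longleftrightarrow> b = c" if "b \<in> Basis" "c \<in> Basis" for b c
    using bij that by (auto simp: bij_betw_def inj_on_def)
  have inner: "T x \<bullet> T b = x \<bullet> b" if b: "b \<in> Basis" for x b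
  proof -
    have "T x = T (\<Sum>c\<in>Basis. (x \<bullet> c) *\<^sub>R c)" by (simp add: euclidean_representation)
    also have "\<dots> = (\<Sum>c\<in>Basis. (x \<bullet> c) *\<^sub>R T c)" by (simp add: sum scale)
    finally have "T x \<bullet> T b = (\<Sum>c\<in>Basis. (x \<bullet> c) * (T c \<bullet> T b))" by (simp add: inner_sum_left)
    also have "\<dots> = (\<Sum>c\<in>Basis. if c = b then x \<bullet> c else 0)"
      using b TB inj by (intro sum.cong refl) (auto simp: inner_Basis)
    also have "\<dots> = x \<bullet> b" using b by simp
    finally show ?thesis .
  qed
  show "sets (distr lborel borel T) = sets borel" by simp
  fix l u :: 'b assume lu: "\<And>b. b \<in> Basis \<Longrightarrow> l \<bullet> b \<le> u \<bullet> b"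
  define l' u' where "l' = (\<Sum>c\<in>Basis. (l \<bullet> T c) *\<^sub>R c)" and "u' = (\<Sum>c\<in>Basis. (u \<bullet> T c) *\<^sub>R c)"
  have l': "l' \<bullet> b = l \<bullet> T b" "u' \<bullet> b = u \<bullet> T b" if "b \<in> Basis" for b
    using that by (simp_all add: l'_def u'_def inner_sum_left inner_Basis if_distrib sum.delta cong: if_cong)
  have vim: "T -` box l u = box l' u'"
  proof -
    have "(\<forall>b\<in>Basis. l \<bullet> b < T x \<bullet> b \<and> T x \<bullet> b < u \<bullet> b) \<longleftrightarrow> (\<forall>b\<in>Basis. l' \<bullet> b < x \<bullet> b \<and> x \<bullet> b < u' \<bullet> b)" for x
    proof -
      have "(\<forall>b\<in>Basis. l \<bullet> b < T x \<bullet> b \<and> T x \<bullet> b < u \<bullet> b)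
          \<longleftrightarrow> (\<forall>c\<in>Basis. l \<bullet> T c < T x \<bullet> T c \<and> T x \<bullet> T c < u \<bullet> T c)"
        unfolding bij_betw_imp_surj_on[OF bij, symmetric] by (simp only: ball_simps image_iff)
      also have "\<dots> \<longleftrightarrow> (\<forall>b\<in>Basis. l' \<bullet> b < x \<bullet> b \<and> x \<bullet> b < u' \<bullet> b)"
        by (simp add: inner l')
      finally show ?thesis .
    qed
    then show ?thesis by (auto simp: mem_box)
  qed
  have "emeasure (distr lborel borel T) (box l u) = emeasure lborel (box l' u')"
    by (simp add: emeasure_distr vim)
  also have "\<dots> = ennreal (\<Prod>b\<in>Basis. (u' - l') \<bullet> b)"
    using lu TB by (intro emeasure_lborel_box) (auto simp: l')
  also have "(\<Prod>b\<in>Basis. (u' - l') \<bullet> b) = (\<Prod>b\<in>Basis. (u - l) \<bullet> T b)"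
    by (intro prod.cong) (auto simp: inner_diff_left l')
  also have "\<dots> = (\<Prod>b\<in>Basis. (u - l) \<bullet> b)"
    by (rule prod.reindex_bij_betw[OF bij])
  finally show "emeasure (distr lborel borel T) (box l u) = ennreal (\<Prod>b\<in>Basis. (u - l) \<bullet> b)" .
qed

section \<open>Change of variables\<close>

text \<open>A bridge between nonnegative integrals with values in \<open>ennreal\<close> and
  absolute integrability, the language of
  \<open>has_absolute_integral_change_of_variables\<close>.\<close>

lemma nonneg_absolutely_integrable_on_iff:
  fixes u :: "'a::euclidean_space \<Rightarrow> real"
  assumes m: "(\<lambda>x. indicator S x * u x) \<in> borel_measurable borel" and nn: "\<And>x. x \<in> S \<Longrightarrow> 0 \<le> u x"
  shows "u absolutely_integrable_on S \<longleftrightarrow> (\<integral>\<^sup>+x\<in>S. ennreal (u x) \<partial>lborel) < \<infinity>"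
    and "u absolutely_integrable_on S \<Longrightarrow> (\<integral>\<^sup>+x\<in>S. ennreal (u x) \<partial>lborel) = ennreal (integral S u)"
proof -
  have eq: "(\<integral>\<^sup>+x. ennreal (norm (indicator S x * u x)) \<partial>lborel) = (\<integral>\<^sup>+x\<in>S. ennreal (u x) \<partial>lborel)"
    using nn by (intro nn_integral_cong) (auto simp: indicator_def)
  show "u absolutely_integrable_on S \<longleftrightarrow> (\<integral>\<^sup>+x\<in>S. ennreal (u x) \<partial>lborel) < \<infinity>"
    unfolding set_integrable_def real_scaleR_def
    using m by (subst integrable_completion) (simp_all add: integrable_iff_bounded eq[symmetric])
  show "(\<integral>\<^sup>+x\<in>S. ennreal (u x) \<partial>lborel) = ennreal (integral S u)" if "u absolutely_integrable_on S"
    using that by (intro nn_integral_has_integral_lebesgue' nn)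
      (auto simp: absolutely_integrable_on_def integrable_integral)
qed

lemma nn_integral_change_of_variables_wellorder:
  fixes g :: "real^'n::{finite,wellorder} \<Rightarrow> real^'n::_" and h :: "real^'n::_ \<Rightarrow> real"
  assumes S: "S \<in> sets borel" and gS: "g ` S \<in> sets borel"
    and der: "\<And>x. x \<in> S \<Longrightarrow> (g has_derivative g' x) (at x within S)" and inj: "inj_on g S"
    and h: "h \<in> borel_measurable borel" and nn: "\<And>x. 0 \<le> h x"
    and J: "(\<lambda>x. indicator S x * (\<bar>det (matrix (g' x))\<bar> * h (g x))) \<in> borel_measurable borel"
  shows "(\<integral>\<^sup>+x\<in>g ` S. ennreal (h x) \<partial>lborel) = (\<integral>\<^sup>+x\<in>S. ennreal (\<bar>det (matrix (g' x))\<bar> * h (g x)) \<partial>lborel)"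
proof -
  have hm: "(\<lambda>x. indicator (g ` S) x * h x) \<in> borel_measurable borel"
    using gS h by measurable
  note 1 = nonneg_absolutely_integrable_on_iff[OF hm nn]
  have nnJ: "0 \<le> \<bar>det (matrix (g' x))\<bar> * h (g x)" for x using nn by simp
  note 2 = nonneg_absolutely_integrable_on_iff[OF J nnJ]
  have S': "S \<in> sets lebesgue" using S by auto
  \<comment> \<open>The theorem speaks of vector-valued integrands, so \<open>h\<close> is wrapped
    into \<open>real^1\<close> and unwrapped afterwards.\<close>
  have "(\<lambda>x. \<bar>det (matrix (g' x))\<bar> *\<^sub>R (vec (h (g x)) :: real^1)) absolutely_integrable_on S \<and>
           integral S (\<lambda>x. \<bar>det (matrix (g' x))\<bar> *\<^sub>R (vec (h (g x)) :: real^1)) = (vec b :: real^1)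
     \<longleftrightarrow> (\<lambda>x. vec (h x) :: real^1) absolutely_integrable_on (g ` S) \<and> integral (g ` S) (\<lambda>x. vec (h x) :: real^1) = (vec b :: real^1)" for b
    by (rule has_absolute_integral_change_of_variables[OF S' der inj]) 
  then have key: "(\<lambda>x. \<bar>det (matrix (g' x))\<bar> * h (g x)) absolutely_integrable_on S \<and>
           integral S (\<lambda>x. \<bar>det (matrix (g' x))\<bar> * h (g x)) = b
     \<longleftrightarrow> h absolutely_integrable_on (g ` S) \<and> integral (g ` S) h = b" for b
    by (auto simp: absolutely_integrable_on_1_iff integral_on_1_eq)
  show ?thesis
  proof (cases "h absolutely_integrable_on (g ` S)")
    case True
    with key[of "integral (g ` S) h"] 1(2) 2(2) show ?thesis by simp
  next
    \<comment> \<open>Without integrability both nonnegative integrals are infinite, hence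
      equal.\<close>
    case False
    then have "\<not> (\<lambda>x. \<bar>det (matrix (g' x))\<bar> * h (g x)) absolutely_integrable_on S"
      using key by blast
    with False show ?thesis
      unfolding 1(1) 2(1) by (simp add: less_top[symmetric])
  qed
qed

lemma linear_reindex: "linear (\<lambda>z::real^'k::finite. \<chi> i::'n::finite. z $ c i)"
  by (auto intro!: linearI simp: vec_eq_iff)

lemma reindex_axis: "bij c \<Longrightarrow> (\<chi> i::'n::finite. axis (c j) (x::real) $ c i) = (axis j x :: real^'n)"
  by (auto simp: vec_eq_iff axis_def bij_def inj_def)

lemma reindex_Basis:
  assumes "bij (c :: 'n::finite \<Rightarrow> 'k::finite)"
  shows "bij_betw (\<lambda>z::real^'k. \<chi> i::'n. z $ c i) Basis Basis"
  unfolding bij_betw_def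
proof
  show "inj_on (\<lambda>z::real^'k. \<chi> i::'n. z $ c i) Basis"
    using assms by (auto simp: inj_on_def vec_eq_iff) (metis bij_def surj_def)
  show "(\<lambda>z::real^'k. \<chi> i::'n. z $ c i) ` Basis = Basis"
  proof (intro equalityI subsetI)
    fix x assume "x \<in> (\<lambda>z::real^'k. \<chi> i::'n. z $ c i) ` Basis"
    then obtain k where "x = (\<chi> i::'n. axis k (1::real) $ c i)"
      by (auto simp: Basis_vec_def)
    moreover obtain j where "k = c j" using assms by (metis bij_def surj_def)
    ultimately show "x \<in> Basis" using assms
      by (auto simp: reindex_axis axis_in_Basis_iff)
  next
    fix x :: "real^'n" assume "x \<in> Basis"
    then obtain j where "x = axis j 1" by (auto simp: Basis_vec_def)
    then have "x = (\<lambda>z::real^'k. \<chi> i::'n. z $ c i) (axis (c j) 1)"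
      using assms by (simp add: reindex_axis)
    then show "x \<in> (\<lambda>z::real^'k. \<chi> i::'n. z $ c i) ` Basis"
      by (metis axis_in_Basis_iff image_eqI Basis_real_def singletonI)
  qed
qed

text \<open>Conjugating \<open>g\<close> by the relabelling \<open>T\<close> moves the problem to a
  well-ordered index type. Relabelling preserves Lebesgue measure, and it permutes rows and columns
  of the Jacobian matrix simultaneously, so the determinant is unchanged.\<close>

lemma nn_integral_change_of_variables:
  fixes g :: "real^'n::finite \<Rightarrow> real^'n" and h :: "real^'n \<Rightarrow> real"
  assumes S: "S \<in> sets borel" and gS: "g ` S \<in> sets borel"
    and der: "\<And>x. x \<in> S \<Longrightarrow> (g has_derivative g' x) (at x within S)" and inj: "inj_on g S"
    and h: "h \<in> borel_measurable borel" and nn: "\<And>x. 0 \<le> h x"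
    and J: "(\<lambda>x. indicator S x * (\<bar>det (matrix (g' x))\<bar> * h (g x))) \<in> borel_measurable borel"
  shows "(\<integral>\<^sup>+x\<in>g ` S. ennreal (h x) \<partial>lborel) = (\<integral>\<^sup>+x\<in>S. ennreal (\<bar>det (matrix (g' x))\<bar> * h (g x)) \<partial>lborel)"
proof -
  obtain b :: "'n fin_index \<Rightarrow> 'n" where b: "bij b"
    using finite_same_card_bij[of "UNIV::'n fin_index set" "UNIV::'n set"] card_fin_index[where 'a='n] by auto
  define c where "c = inv b"
  have bc: "b (c i) = i" "c (b j) = j" for i j
    using b by (simp_all add: c_def bij_is_surj surj_f_inv_f bij_is_inj)
  have "bij c" unfolding c_def using b by (rule bij_imp_bij_inv)
  define T where "T = (\<lambda>z::real^'n fin_index. \<chi> i::'n. z $ c i)"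
  define T' where "T' = (\<lambda>z::real^'n. \<chi> i::'n fin_index. z $ b i)"
  have TT': "T (T' x) = x" "T' (T z) = z" for x z by (simp_all add: T_def T'_def bc)
  have linT: "linear T" and linT': "linear T'" unfolding T_def T'_def by (rule linear_reindex)+
  have blT: "bounded_linear T" "bounded_linear T'" using linT linT' by (simp_all add: linear_conv_bounded_linear)
  have Tm[measurable]: "T \<in> borel_measurable borel" "T' \<in> borel_measurable borel"
    using blT by (auto intro!: borel_measurable_continuous_onI linear_continuous_on)
  have dT: "distr lborel borel T = lborel"
    by (intro distr_lborel_Basis_map linT) (use reindex_Basis[OF \<open>bij c\<close>] in \<open>simp add: T_def\<close>)
  have nnT: "(\<integral>\<^sup>+x. u x \<partial>lborel) = (\<integral>\<^sup>+z. u (T z) \<partial>lborel)" if [measurable]: "u \<in> borel_measurable borel" for u :: "real^'n \<Rightarrow> ennreal"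
    by (subst dT[symmetric], subst nn_integral_distr) auto
  define g2 where "g2 = T' \<circ> g \<circ> T"
  define g2' where "g2' = (\<lambda>z. T' \<circ> g' (T z) \<circ> T)"
  define S2 where "S2 = T -` S"
  have S2T: "S2 = T' ` S" unfolding S2_def by (auto simp: TT') (metis TT'(2) image_eqI)
  have TS2: "T ` S2 = S" unfolding S2T by (auto simp: image_image TT')
  have S2: "S2 \<in> sets borel" unfolding S2_def using measurable_sets_borel[OF Tm(1) S] by simp
  have g2S: "g2 ` S2 = T -` (g ` S)"
    unfolding g2_def S2T by (auto simp: image_iff TT') (metis TT'(2))
  have g2Sb: "g2 ` S2 \<in> sets borel" unfolding g2S using measurable_sets_borel[OF Tm(1) gS] by simp
  have linTz: "linear (g' (T z))" if "z \<in> S2" for z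
    using der[of "T z"] that by (auto simp: S2_def has_derivative_def linear_conv_bounded_linear)
  have det: "det (matrix (g2' z)) = det (matrix (g' (T z)))" if "z \<in> S2" for z
  proof -
    have Ta: "T (axis j 1) = axis (b j) 1" for j
      unfolding T_def using reindex_axis[OF \<open>bij c\<close>, of "b j" 1] by (simp add: bc)
    have "matrix (g2' z) = (\<chi> i j. matrix (g' (T z)) $ b i $ b j)"
      unfolding matrix_def g2'_def by (simp add: Ta T'_def)
    then show ?thesis using det_reindex[OF b] by simp
  qed
  have der2: "(g2 has_derivative g2' z) (at z within S2)" if "z \<in> S2" for z
  proof -
    have "T z \<in> S" using that by (simp add: S2_def)
    have "(T has_derivative T) (at z within S2)" using blT(1) by (rule bounded_linear_imp_has_derivative)
    moreover have "(g has_derivative g' (T z)) (at (T z) within T ` S2)" unfolding TS2 by (rule der) fact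
    ultimately have 1: "(g \<circ> T has_derivative g' (T z) \<circ> T) (at z within S2)"
      by (rule diff_chain_within)
    have "(T' has_derivative T') (at ((g \<circ> T) z) within (g \<circ> T) ` S2)" using blT(2) by (rule bounded_linear_imp_has_derivative)
    from diff_chain_within[OF 1 this] show ?thesis by (simp add: g2_def g2'_def comp_def)
  qed
  have inj2: "inj_on g2 S2"
    unfolding inj_on_def g2_def S2_def o_def using inj by (metis TT' inj_onD vimage_eq)
  have J2: "(\<lambda>z. indicator S2 z * (\<bar>det (matrix (g2' z))\<bar> * h (T (g2 z)))) \<in> borel_measurable borel"
  proof -
    have "(\<lambda>z. indicator S (T z) * (\<bar>det (matrix (g' (T z)))\<bar> * h (g (T z)))) \<in> borel_measurable borel"
      using measurable_compose[OF Tm(1) J] .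
    also have "(\<lambda>z. indicator S (T z) * (\<bar>det (matrix (g' (T z)))\<bar> * h (g (T z)))) =
       (\<lambda>z. indicator S2 z * (\<bar>det (matrix (g2' z))\<bar> * h (T (g2 z))))"
      by (auto simp: fun_eq_iff indicator_def S2_def det g2_def TT')
    finally show ?thesis .
  qed
  have h2: "(\<lambda>z. h (T z)) \<in> borel_measurable borel" using h by measurable
  have "(\<integral>\<^sup>+x\<in>g ` S. ennreal (h x) \<partial>lborel) = (\<integral>\<^sup>+z\<in>g2 ` S2. ennreal (h (T z)) \<partial>lborel)"
  proof (subst nnT)
    show "(\<lambda>x. ennreal (h x) * indicator (g ` S) x) \<in> borel_measurable borel" using h gS by measurable
  qed (auto intro!: nn_integral_cong simp: g2S indicator_def)
  also have "\<dots> = (\<integral>\<^sup>+z\<in>S2. ennreal (\<bar>det (matrix (g2' z))\<bar> * h (T (g2 z))) \<partial>lborel)"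
    by (rule nn_integral_change_of_variables_wellorder[OF S2 g2Sb der2 inj2 h2 nn J2])
  also have "\<dots> = (\<integral>\<^sup>+x\<in>S. ennreal (\<bar>det (matrix (g' x))\<bar> * h (g x)) \<partial>lborel)"
  proof -
    have m: "(\<lambda>x. ennreal (indicator S x * (\<bar>det (matrix (g' x))\<bar> * h (g x)))) \<in> borel_measurable borel"
      using J by measurable
    have "(\<integral>\<^sup>+x\<in>S. ennreal (\<bar>det (matrix (g' x))\<bar> * h (g x)) \<partial>lborel) = 
      (\<integral>\<^sup>+x. ennreal (indicator S x * (\<bar>det (matrix (g' x))\<bar> * h (g x))) \<partial>lborel)"
      by (intro nn_integral_cong) (auto simp: indicator_def)
    also have "\<dots> = (\<integral>\<^sup>+z. ennreal (indicator S (T z) * (\<bar>det (matrix (g' (T z)))\<bar> * h (g (T z)))) \<partial>lborel)"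
      by (rule nnT[OF m])
    also have "\<dots> = (\<integral>\<^sup>+z\<in>S2. ennreal (\<bar>det (matrix (g2' z))\<bar> * h (T (g2 z))) \<partial>lborel)"
      by (intro nn_integral_cong) (auto simp: indicator_def S2_def det g2_def TT')
    finally show ?thesis by simp
  qed
  finally show ?thesis .
qed

section \<open>Area measure of a graph\<close>

text \<open>The Gram matrix of the composition is
  \<open>transpose (matrix B) ** M ** matrix B\<close>, with \<open>M\<close> the Gram matrix of
  \<open>A\<close>. This is why area elements transform by the Jacobian of a change of
  parameters.\<close>

lemma det_gram_compose:
  fixes A :: "real^'m::finite \<Rightarrow> 'a::euclidean_space" and B :: "real^'m \<Rightarrow> real^'m"
  assumes "linear A" "linear B"
  shows "det (\<chi> i j. A (B (axis i 1)) \<bullet> A (B (axis j 1))) =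
    (det (matrix B))\<^sup>2 * det (\<chi> i j. A (axis i 1) \<bullet> A (axis j 1))"
proof -
  interpret A: linear A by fact
  have AB: "A (B (axis i 1)) = (\<Sum>k\<in>UNIV. matrix B $ k $ i *\<^sub>R A (axis k 1))" for i
  proof -
    have "B (axis i 1) = (\<Sum>k\<in>UNIV. (B (axis i 1) $ k) *\<^sub>R axis k 1)"
      by (simp add: vec_eq_iff axis_def if_distrib cong: if_cong)
    then have "A (B (axis i 1)) = A (\<Sum>k\<in>UNIV. (B (axis i 1) $ k) *\<^sub>R axis k 1)" by simp
    then show ?thesis by (simp add: A.sum A.scale matrix_def)
  qed
  have "(\<chi> i j. A (B (axis i 1)) \<bullet> A (B (axis j 1))) =
    transpose (matrix B) ** (\<chi> i j. A (axis i 1) \<bullet> A (axis j 1)) ** matrix B"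
    by (simp add: vec_eq_iff matrix_matrix_mult_def transpose_def AB inner_sum_left inner_sum_right sum_distrib_left sum_distrib_right mult_ac)
  then show ?thesis by (simp add: det_mul det_transpose power2_eq_square)
qed

text \<open>The matrix is the Gram matrix of the graph map sending \<open>x\<close> to
  \<open>(x, v \<bullet> x)\<close>. Precomposing with an orthogonal \<open>Q\<close> that turns an
  axis towards \<open>v\<close> leaves the determinant alone and makes the matrix diagonal, with one
  entry \<open>1 + (norm v)\<^sup>2\<close> and the others 1.\<close>

lemma det_id_plus_outer:
  fixes v :: "real^'n::finite"
  shows "det (\<chi> i j. axis i 1 \<bullet> (axis j 1 :: real^'n) + v $ i * v $ j) = 1 + (norm v)\<^sup>2"
proof -
  obtain k :: 'n where True by simp
  have nk: "norm (norm v *\<^sub>R axis k (1::real)) = norm v" by (simp add: norm_axis_1)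
  obtain Q :: "real^'n \<Rightarrow> real^'n" where Q: "orthogonal_transformation Q" "Q (norm v *\<^sub>R axis k 1) = v"
    using orthogonal_transformation_exists[OF nk] by blast
  have linQ: "linear Q" using Q(1) by (rule orthogonal_transformation_linear)
  define A where "A = (\<lambda>x::real^'n. (x, v \<bullet> x))"
  have linA: "linear A" unfolding A_def by (auto intro!: linearI simp: inner_right_distrib)
  have QQ: "Q x \<bullet> Q y = x \<bullet> y" for x y using Q(1) by (simp add: orthogonal_transformation_def)
  have vQ: "v \<bullet> Q x = norm v * x $ k" for x
    by (subst Q(2)[symmetric]) (simp add: QQ inner_axis' )
  have AQ: "A (Q x) \<bullet> A (Q y) = x \<bullet> y + (norm v)\<^sup>2 * (x $ k * y $ k)" for x y
    unfolding A_def by (simp add: QQ vQ power2_eq_square algebra_simps)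
  have axk: "axis i (1::real) $ k = (if i = k then 1 else 0)" for i by (simp add: axis_def)
  have "(det (matrix Q))\<^sup>2 = 1"
    using orthogonal_transformation_det[OF Q(1)] by (simp add: abs_square_eq_1)
  then have "det (\<chi> i j. A (axis i 1) \<bullet> A (axis j 1)) = det (\<chi> i j. A (Q (axis i 1)) \<bullet> A (Q (axis j 1)))"
    using det_gram_compose[OF linA linQ] by simp
  also have "\<dots> = (\<Prod>i\<in>UNIV. (\<chi> i j. A (Q (axis i 1)) \<bullet> A (Q (axis j 1))) $ i $ i)"
    by (rule det_diagonal) (auto simp: AQ inner_axis_axis axk)
  also have "\<dots> = (\<Prod>i\<in>UNIV. if i = k then 1 + (norm v)\<^sup>2 else 1)"
    by (intro prod.cong) (auto simp: AQ inner_axis_axis axk)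
  also have "\<dots> = 1 + (norm v)\<^sup>2" by simp
  finally show ?thesis by (simp add: A_def inner_axis)
qed

section \<open>Continuity and Borel properties of charts\<close>

lemma continuous_on_det [continuous_intros]:
  assumes "\<And>i j. continuous_on S (\<lambda>x. M x $ i $ j)"
  shows "continuous_on S (\<lambda>x. det (M x :: real^'n::finite^'n))"
  unfolding det_def by (intro continuous_intros assms)

lemma continuous_on_area_element:
  assumes "local_parametrization S U \<phi>"
  shows "continuous_on U (area_element \<phi>)"
  unfolding area_element_def using assms unfolding local_parametrization_def
  by (intro continuous_intros) auto

lemma local_parametrization_has_derivative:
  assumes "local_parametrization S U \<phi>" "x \<in> U"
  shows "(\<phi> has_derivative frechet_derivative \<phi> (at x)) (at x)"
  using assms unfolding local_parametrization_def
  by (metis at_within_open differentiable_on_def frechet_derivative_works)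

lemma borel_vimage_on_open:
  assumes "open U" "continuous_on U \<phi>" "A \<in> sets borel"
  shows "U \<inter> \<phi> -` A \<in> sets borel"
proof -
  have "\<phi> \<in> borel_measurable (restrict_space borel U)"
    by (rule borel_measurable_continuous_on_restrict) fact
  from measurable_sets[OF this assms(3)] have "\<phi> -` A \<inter> U \<in> sets (restrict_space borel U)"
    by (simp add: space_restrict_space)
  then show ?thesis using assms(1)
    by (subst (asm) sets_restrict_space_iff) (auto simp: Int_commute)
qed

lemma local_parametrization_vimage_borel:
  assumes "local_parametrization S U \<phi>" "A \<in> sets borel"
  shows "U \<inter> \<phi> -` A \<in> sets borel"
  using assms by (intro borel_vimage_on_open) (auto simp: local_parametrization_def homeomorphism_def)

lemma local_parametrization_image_borel:
  assumes "local_parametrization S U \<phi>" "S \<in> sets borel"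
  shows "\<phi> ` U \<in> sets borel"
proof -
  obtain T where "open T" "\<phi> ` U = S \<inter> T"
    using assms(1) unfolding local_parametrization_def openin_open by auto
  then show ?thesis using assms(2) by auto
qed

text \<open>Two measures meeting the specification agree on every Borel subset of a chart image.
  Cutting a countable atlas into disjoint Borel pieces extends the agreement to all Borel sets, the
  complement of \<open>S\<close> being null, so the definite description is resolved.\<close>

lemma area_measure_eqI:
  fixes S :: "'a::euclidean_space set" and P :: "((real^'m::finite) set \<times> (real^'m \<Rightarrow> 'a)) set"
  assumes \<mu>: "is_area_measure TYPE('m) S \<mu>" and S: "S \<in> sets borel"
    and P: "countable P" "P \<noteq> {}" "\<And>U \<phi>. (U, \<phi>) \<in> P \<Longrightarrow> local_parametrization S U \<phi>"
    and cover: "S \<subseteq> (\<Union>(U, \<phi>)\<in>P. \<phi> ` U)"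
  shows "area_measure TYPE('m) S = \<mu>"
  unfolding area_measure_def
proof (rule the_equality[where P = "is_area_measure TYPE('m) S", OF \<mu>])
  fix \<nu> assume \<nu>: "is_area_measure TYPE('m) S \<nu>"
  \<comment> \<open>\<open>from_nat_into\<close> enumerates the atlas with repetitions if necessary,
    so finite atlases are covered too.\<close>
  define W where "W i = (case from_nat_into P i of (U, \<phi>) \<Rightarrow> \<phi> ` U)" for i
  have lp: "case from_nat_into P i of (U, \<phi>) \<Rightarrow> local_parametrization S U \<phi>" for i
    using P(3) from_nat_into[OF P(2), of i] by (cases "from_nat_into P i") auto
  have Wb: "W i \<in> sets borel" for i
    using lp[of i] unfolding W_def by (auto split: prod.splits intro: local_parametrization_image_borel[OF _ S])
  have "\<phi> ` U \<subseteq> S" if "local_parametrization S U \<phi>" for U and \<phi> :: "real^'m \<Rightarrow> 'a"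
    using that unfolding local_parametrization_def openin_open by auto
  then have WS: "W i \<subseteq> S" for i using lp[of i] unfolding W_def by (auto split: prod.splits)
  have SW: "S = (\<Union>i. W i)"
  proof (intro equalityI subsetI)
    fix x assume "x \<in> S"
    with cover obtain p where p: "p \<in> P" "x \<in> (case p of (U, \<phi>) \<Rightarrow> \<phi> ` U)" by auto
    then obtain i where "from_nat_into P i = p" using P(1) from_nat_into_surj by metis
    with p have "x \<in> W i" by (simp add: W_def)
    then show "x \<in> (\<Union>i. W i)" by blast
  qed (use WS in auto)
  have dW: "disjointed W i \<in> sets borel" for i
    using Wb sets.range_disjointed_sets[of W borel] by auto
  have dWW: "disjointed W i \<subseteq> W i" for i by (rule disjointed_subset)
  have small: "emeasure \<rho> A = (case from_nat_into P i of (U, \<phi>) \<Rightarrow> \<integral>\<^sup>+ x \<in> U \<inter> \<phi> -` A. ennreal (area_element \<phi> x) \<partial>lborel)"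
    if "is_area_measure TYPE('m) S \<rho>" "A \<in> sets borel" "A \<subseteq> W i" for \<rho> A i
    using that lp[of i] unfolding is_area_measure_def W_def by (auto split: prod.splits)
  have decomp: "emeasure \<rho> A = (\<Sum>i. emeasure \<rho> (A \<inter> disjointed W i))"
    if \<rho>: "is_area_measure TYPE('m) S \<rho>" and A: "A \<in> sets borel" for \<rho> A
  proof -
    have s: "sets \<rho> = sets borel" and z: "emeasure \<rho> (- S) = 0" using \<rho> by (auto simp: is_area_measure_def)
    have "emeasure \<rho> A = emeasure \<rho> (A \<inter> S)"
    proof (rule emeasure_eq_AE)
      have "- S \<in> null_sets \<rho>" using S z s by (auto simp: null_sets_def)
      then show "AE x in \<rho>. (x \<in> A) = (x \<in> A \<inter> S)" by (rule AE_I') auto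
    qed (use A S s in auto)
    also have "A \<inter> S = (\<Union>i. A \<inter> disjointed W i)" using UN_disjointed_eq[of W] SW by auto
    also have "emeasure \<rho> \<dots> = (\<Sum>i. emeasure \<rho> (A \<inter> disjointed W i))"
    proof (rule suminf_emeasure[symmetric])
      show "range (\<lambda>i. A \<inter> disjointed W i) \<subseteq> sets \<rho>" using dW A s by auto
      show "disjoint_family (\<lambda>i. A \<inter> disjointed W i)"
        using disjoint_family_disjointed[of W] by (auto simp: disjoint_family_on_def)
    qed
    finally show ?thesis .
  qed
  show "\<nu> = \<mu>"
  proof (rule measure_eqI)
    show "sets \<nu> = sets \<mu>" using \<mu> \<nu> by (simp add: is_area_measure_def)
    fix A assume "A \<in> sets \<nu>"
    then have A: "A \<in> sets borel" using \<nu> by (simp add: is_area_measure_def)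
    have "emeasure \<nu> (A \<inter> disjointed W i) = emeasure \<mu> (A \<inter> disjointed W i)" for i
      using small[OF \<nu>, of "A \<inter> disjointed W i" i] small[OF \<mu>, of "A \<inter> disjointed W i" i] A dW dWW by fastforce
    then show "emeasure \<nu> A = emeasure \<mu> A" by (simp add: decomp[OF \<nu> A] decomp[OF \<mu> A])
  qed
qed

section \<open>Graphs of differentiable functions\<close>

lemma frechet_derivative_grad:
  assumes "f differentiable (at x)"
  shows "frechet_derivative f (at x) v = grad f x \<bullet> v"
proof -
  interpret linear "frechet_derivative f (at x)" using assms by (rule linear_frechet_derivative)
  have "frechet_derivative f (at x) v = frechet_derivative f (at x) (\<Sum>i\<in>UNIV. v $ i *\<^sub>R axis i 1)"
    by (rule arg_cong) (simp add: vec_eq_iff axis_def if_distrib cong: if_cong)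
  also have "\<dots> = grad f x \<bullet> v"
    by (simp add: sum scale grad_def inner_vec_def mult.commute)
  finally show ?thesis .
qed

lemma has_derivative_grad:
  assumes "f differentiable (at x)"
  shows "(f has_derivative (\<lambda>v. grad f x \<bullet> v)) (at x)"
  using assms frechet_derivative_works[of f "at x"] frechet_derivative_grad[OF assms]
  by (metis (no_types, lifting) ext)

definition graph_measure :: "(real^'n::finite \<Rightarrow> real) \<Rightarrow> ((real^'n) \<times> real) measure" where
  "graph_measure f = distr (density lborel (\<lambda>x. ennreal (sqrt (1 + (norm (grad f x))\<^sup>2)))) borel (\<lambda>x. (x, f x))"

context
  fixes f :: "real^'n::finite \<Rightarrow> real"
  assumes df: "\<And>x. f differentiable (at x)" and cg: "continuous_on UNIV (grad f)"
begin

lemma continuous_on_graph_function: "continuous_on A f"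
  using df differentiable_imp_continuous_within by (metis continuous_at_imp_continuous_on)

lemma graph_borel: "graph_of f \<in> sets borel"
proof -
  have "graph_of f = {z. snd z = f (fst z)}" by (auto simp: graph_of_def)
  also have "closed \<dots>" by (intro closed_Collect_eq continuous_intros continuous_on_compose2[OF continuous_on_graph_function[of UNIV]]) auto
  finally show ?thesis by simp
qed

lemma graph_map_measurable [measurable]: "f \<in> borel_measurable borel" "grad f \<in> borel_measurable borel"
  using continuous_on_graph_function cg by (auto intro: borel_measurable_continuous_onI)

text \<open>Every chart of the graph is its own first component followed by the graph map. Its
  differential is therefore \<open>B\<close> followed by \<open>A\<close>, with \<open>A\<close> the
  differential of the graph map, and \<open>det_gram_compose\<close> separates the two
  factors.\<close>

lemma area_element_graph_compose:
  assumes lp: "local_parametrization (graph_of f) U (\<phi> :: real^'n \<Rightarrow> (real^'n) \<times> real)" and u: "u \<in> U"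
  shows "area_element \<phi> u =
    \<bar>det (matrix (\<lambda>v. fst (frechet_derivative \<phi> (at u) v)))\<bar> * sqrt (1 + (norm (grad f (fst (\<phi> u))))\<^sup>2)"
proof -
  let ?D = "frechet_derivative \<phi> (at u)"
  have opU: "open U" and sub: "\<phi> ` U \<subseteq> graph_of f"
    using lp unfolding local_parametrization_def openin_open by auto
  have \<phi>: "\<phi> w = (fst (\<phi> w), f (fst (\<phi> w)))" if "w \<in> U" for w
    using sub that by (force simp: graph_of_def)
  note D = local_parametrization_has_derivative[OF lp u]
  have D1: "((\<lambda>w. fst (\<phi> w)) has_derivative (\<lambda>v. fst (?D v))) (at u)"
    using D by (rule has_derivative_fst)
  have "((\<lambda>w. f (fst (\<phi> w))) has_derivative (\<lambda>v. grad f (fst (\<phi> u)) \<bullet> fst (?D v))) (at u)"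
    using has_derivative_compose[OF D1 has_derivative_grad[OF df]] .
  from has_derivative_Pair[OF D1 this]
  have "((\<lambda>w. (fst (\<phi> w), f (fst (\<phi> w)))) has_derivative (\<lambda>v. (fst (?D v), grad f (fst (\<phi> u)) \<bullet> fst (?D v)))) (at u)" .
  then have "(\<phi> has_derivative (\<lambda>v. (fst (?D v), grad f (fst (\<phi> u)) \<bullet> fst (?D v)))) (at u)"
    by (rule has_derivative_transform_within_open[OF _ opU u]) (use \<phi> in auto)
  then have eq: "?D = (\<lambda>v. (fst (?D v), grad f (fst (\<phi> u)) \<bullet> fst (?D v)))"
    using D has_derivative_unique by blast
  define A where "A = (\<lambda>x::real^'n. (x, grad f (fst (\<phi> u)) \<bullet> x))"
  define B where "B = (\<lambda>v. fst (?D v))"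
  have linA: "linear A" unfolding A_def by (auto intro!: linearI simp: inner_right_distrib)
  have linB: "linear B" unfolding B_def using D1 by (simp add: has_derivative_linear)
  have DAB: "?D v = A (B v)" for v unfolding A_def B_def using fun_cong[OF eq, of v] .
  have "(\<chi> i j. A (axis i 1) \<bullet> A (axis j 1)) =
     (\<chi> i j. axis i 1 \<bullet> (axis j 1 :: real^'n) + grad f (fst (\<phi> u)) $ i * grad f (fst (\<phi> u)) $ j)"
    by (simp add: A_def inner_axis)
  then have "area_element \<phi> u = sqrt ((det (matrix B))\<^sup>2 * (1 + (norm (grad f (fst (\<phi> u))))\<^sup>2))"
    unfolding area_element_def DAB det_gram_compose[OF linA linB] by (simp add: det_id_plus_outer)
  then show ?thesis by (simp add: real_sqrt_mult B_def)
qed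

text \<open>The first component of a chart is injective because a point of the graph is determined
  by its base point. The change of variables along it converts the density over the base into the
  area element over the chart.\<close>

lemma is_area_measure_graph: "is_area_measure TYPE('n) (graph_of f) (graph_measure f)"
  unfolding is_area_measure_def
proof (intro conjI allI impI ballI)
  show "sets (graph_measure f) = sets borel" by (simp add: graph_measure_def)
  have [measurable]: "(\<lambda>x. (x, f x)) \<in> borel_measurable borel" by measurable
  note cl = graph_borel
  show "emeasure (graph_measure f) (- graph_of f) = 0"
  proof -
    have "(\<lambda>x. (x, f x)) -` (- graph_of f) = {}" by (auto simp: graph_of_def)
    then show ?thesis using cl by (simp add: graph_measure_def emeasure_distr)
  qed
  fix U \<phi> A
  assume lp: "local_parametrization (graph_of f) U (\<phi> :: real^'n \<Rightarrow> (real^'n) \<times> real)"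
    and A: "A \<in> sets borel" and AU: "A \<subseteq> \<phi> ` U"
  define B where "B = U \<inter> \<phi> -` A"
  define \<theta> where "\<theta> = (\<lambda>u. fst (\<phi> u))"
  define h where "h = (\<lambda>x. sqrt (1 + (norm (grad f x))\<^sup>2))"
  have Bb: "B \<in> sets borel" unfolding B_def by (rule local_parametrization_vimage_borel[OF lp A])
  have sub: "\<phi> ` U \<subseteq> graph_of f" and inj\<phi>: "inj_on \<phi> U"
    using lp unfolding local_parametrization_def openin_open homeomorphism_def by (auto intro: inj_on_inverseI)
  have \<phi>: "\<phi> w = (\<theta> w, f (\<theta> w))" if "w \<in> U" for w
    using sub that by (force simp: graph_of_def \<theta>_def)
  have img: "\<theta> ` B = (\<lambda>x. (x, f x)) -` A"
  proof (intro equalityI subsetI)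
    fix x assume "x \<in> (\<lambda>x. (x, f x)) -` A"
    then have xA: "(x, f x) \<in> A" by simp
    then obtain u where "u \<in> U" "\<phi> u = (x, f x)" using AU by auto
    then have "u \<in> B" "\<theta> u = x" using xA by (auto simp: B_def \<theta>_def)
    then show "x \<in> \<theta> ` B" by auto
  next
    fix x assume "x \<in> \<theta> ` B"
    then obtain u where "u \<in> U" "\<phi> u \<in> A" "x = \<theta> u" by (auto simp: B_def)
    then show "x \<in> (\<lambda>x. (x, f x)) -` A" using \<phi>[of u] by simp
  qed
  have imgb: "\<theta> ` B \<in> sets borel" unfolding img using measurable_sets_borel[OF \<open>(\<lambda>x. (x, f x)) \<in> borel_measurable borel\<close> A] by simp
  have inj: "inj_on \<theta> B"
  proof (rule inj_onI)
    fix x y assume xy: "x \<in> B" "y \<in> B" "\<theta> x = \<theta> y"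
    then have "x \<in> U" "y \<in> U" by (auto simp: B_def)
    moreover from this have "\<phi> x = \<phi> y" using \<phi>[of x] \<phi>[of y] xy(3) by simp
    ultimately show "x = y" using inj\<phi> by (simp add: inj_on_eq_iff)
  qed
  define g' where "g' = (\<lambda>u v. fst (frechet_derivative \<phi> (at u) v))"
  have der: "(\<theta> has_derivative g' u) (at u within B)" if "u \<in> B" for u
  proof -
    have "u \<in> U" using that by (simp add: B_def)
    from has_derivative_at_withinI[OF local_parametrization_has_derivative[OF lp this]] show ?thesis
      unfolding \<theta>_def g'_def by (rule has_derivative_fst)
  qed
  have ae: "\<bar>det (matrix (g' u))\<bar> * h (\<theta> u) = area_element \<phi> u" if "u \<in> B" for u
    using area_element_graph_compose[OF lp, of u] that by (simp add: g'_def h_def \<theta>_def B_def)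
  have J: "(\<lambda>u. indicator B u * (\<bar>det (matrix (g' u))\<bar> * h (\<theta> u))) \<in> borel_measurable borel"
  proof -
    have "(\<lambda>u. indicator B u *\<^sub>R area_element \<phi> u) \<in> borel_measurable borel"
      by (rule borel_measurable_continuous_on_indicator[OF Bb])
        (rule continuous_on_subset[OF continuous_on_area_element[OF lp]], simp add: B_def)
    also have "(\<lambda>u. indicator B u *\<^sub>R area_element \<phi> u) = (\<lambda>u. indicator B u * (\<bar>det (matrix (g' u))\<bar> * h (\<theta> u)))"
      by (auto simp: fun_eq_iff indicator_def ae)
    finally show ?thesis .
  qed
  have "emeasure (graph_measure f) A = (\<integral>\<^sup>+x\<in>\<theta> ` B. ennreal (h x) \<partial>lborel)"
    using A imgb by (simp add: graph_measure_def emeasure_distr emeasure_density img h_def)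
  also have "\<dots> = (\<integral>\<^sup>+u\<in>B. ennreal (\<bar>det (matrix (g' u))\<bar> * h (\<theta> u)) \<partial>lborel)"
    by (rule nn_integral_change_of_variables[OF Bb imgb der inj _ _ J]) (auto simp: h_def)
  also have "\<dots> = (\<integral>\<^sup>+u\<in>B. ennreal (area_element \<phi> u) \<partial>lborel)"
    by (intro nn_integral_cong) (auto simp: indicator_def ae)
  finally show "emeasure (graph_measure f) A = (\<integral>\<^sup>+u\<in>U \<inter> \<phi> -` A. ennreal (area_element \<phi> u) \<partial>lborel)"
    by (simp add: B_def)
qed

lemma local_parametrization_graph: "local_parametrization (graph_of f) UNIV (\<lambda>x. (x, f x))"
proof -
  have d: "((\<lambda>x. (x, f x)) has_derivative (\<lambda>v. (v, grad f x \<bullet> v))) (at x)" for x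
    by (intro has_derivative_Pair has_derivative_ident has_derivative_grad df)
  have fd: "frechet_derivative (\<lambda>x. (x, f x)) (at x) = (\<lambda>v. (v, grad f x \<bullet> v))" for x
    using frechet_derivative_at[OF d] by simp
  have "homeomorphism UNIV ((\<lambda>x. (x, f x)) ` UNIV) (\<lambda>x. (x, f x)) fst"
    by (auto simp: homeomorphism_def image_image intro!: continuous_intros continuous_on_graph_function)
  moreover have "(\<lambda>x. (x, f x)) ` UNIV = graph_of f" by (auto simp: graph_of_def)
  moreover have "\<forall>v. continuous_on UNIV (\<lambda>x. (v, grad f x \<bullet> v))" using cg by (auto intro!: continuous_intros)
  ultimately show ?thesis unfolding local_parametrization_def fd
    using d by (auto simp: differentiable_on_def differentiable_def inj_def)
qed

lemma area_measure_graph: "area_measure TYPE('n) (graph_of f) = graph_measure f"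
proof (rule area_measure_eqI[OF is_area_measure_graph graph_borel, where P = "{(UNIV, \<lambda>x. (x, f x))}"])
qed (use local_parametrization_graph in \<open>auto simp: graph_of_def\<close>)

lemma F_functional_graph:
  "F_functional TYPE('n) (a, b) t (graph_of f) =
    ennreal ((4 * pi * t) powr (- (real CARD('n) / 2))) *
    (\<integral>\<^sup>+ x. ennreal (sqrt (1 + (norm (grad f x))\<^sup>2) * exp (- (((norm (x - a))\<^sup>2 + (f x - b)\<^sup>2) / (4 * t)))) \<partial>lborel)"
proof -
  have gr: "(x, f x) \<in> graph_of f" for x by (auto simp: graph_of_def)
  note cl = graph_borel
  have "(\<integral>\<^sup>+ x \<in> graph_of f. ennreal (exp (- ((norm (x - (a, b)))\<^sup>2 / (4 * t)))) \<partial>graph_measure f)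
    = (\<integral>\<^sup>+ x. ennreal (sqrt (1 + (norm (grad f x))\<^sup>2)) * ennreal (exp (- ((norm ((x, f x) - (a, b)))\<^sup>2 / (4 * t)))) \<partial>lborel)"
    unfolding graph_measure_def using cl by (subst nn_integral_distr) (auto simp: nn_integral_density gr)
  also have "\<dots> = (\<integral>\<^sup>+ x. ennreal (sqrt (1 + (norm (grad f x))\<^sup>2) * exp (- (((norm (x - a))\<^sup>2 + (f x - b)\<^sup>2) / (4 * t)))) \<partial>lborel)"
    by (intro nn_integral_cong) (simp add: ennreal_mult norm_Pair)
  finally show ?thesis by (simp add: F_functional_def area_measure_graph)
qed

end

section \<open>Area measure of the sphere\<close>

text \<open>Writes \<open>real^'n\<close> as a line times \<open>real^'k\<close>. The two index
  types are unrelated as types, so the correspondence is an explicit injection that misses one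
  index.\<close>

locale split_coordinates =
  fixes i0 :: "'n::finite" and b :: "'k::finite \<Rightarrow> 'n"
  assumes inj_b: "inj b" and range_b: "range b = UNIV - {i0}"
begin

definition rest :: "real^'n \<Rightarrow> real^'k" where
  "rest z = (\<chi> j. z $ b j)"

definition join :: "real \<Rightarrow> real^'k \<Rightarrow> real^'n" where
  "join r y = (\<chi> i. if i = i0 then r else y $ inv b i)"

lemma b_neq [simp]: "b j \<noteq> i0" "i0 \<noteq> b j"
  using range_b by auto

lemma b_cases: obtains "i = i0" | j where "i = b j"
  using range_b by (metis Diff_iff UNIV_I empty_iff insertE rangeE)

lemma card_n: "CARD('n) = Suc CARD('k)"
proof -
  have "CARD('k) = card (UNIV - {i0} :: 'n set)"
    using card_image[OF inj_b] range_b by simp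
  then show ?thesis by (simp add: card_Suc_Diff1 Suc_diff_1)
qed

lemma rest_nth [simp]: "rest z $ j = z $ b j" by (simp add: rest_def)

lemma join_nth [simp]: "join r y $ i0 = r" "join r y $ b j = y $ j"
  using inj_b by (auto simp: join_def)

lemma rest_join [simp]: "rest (join r y) = y" by (simp add: vec_eq_iff)

lemma vec_eq_split: "z = w \<longleftrightarrow> z $ i0 = w $ i0 \<and> rest z = rest w"
  unfolding vec_eq_iff rest_nth by (metis b_cases)

lemma join_rest: "join (z $ i0) (rest z) = z"
  by (subst vec_eq_split) simp

lemma join_eq_iff: "join r y = join s w \<longleftrightarrow> r = s \<and> y = w"
  by (subst vec_eq_split) simp

lemma linear_rest: "linear rest" by (auto intro!: linearI simp: vec_eq_iff)

lemma bounded_linear_rest: "bounded_linear rest"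
  using linear_rest by (simp add: linear_conv_bounded_linear)

lemma join_add: "join r y + join s w = join (r + s) (y + w)"
  by (subst vec_eq_split) (simp add: vec_eq_iff)

lemma join_scaleR: "c *\<^sub>R join r y = join (c * r) (c *\<^sub>R y)"
  by (subst vec_eq_split) (simp add: vec_eq_iff)

lemma bounded_linear_join: "bounded_linear (\<lambda>p. join (fst p) (snd p))"
  unfolding linear_conv_bounded_linear[symmetric]
  by (intro linearI) (simp_all add: join_add join_scaleR)

lemma inner_split: "z \<bullet> w = z $ i0 * w $ i0 + rest z \<bullet> rest w"
proof -
  have "z \<bullet> w = z $ i0 * w $ i0 + (\<Sum>i\<in>range b. z $ i * w $ i)"
    unfolding inner_vec_def range_b by (subst sum.remove[of _ i0]) auto
  also have "(\<Sum>i\<in>range b. z $ i * w $ i) = rest z \<bullet> rest w"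
    using inj_b by (simp add: sum.reindex inner_vec_def)
  finally show ?thesis .
qed

lemma norm_split: "(norm z)\<^sup>2 = (z $ i0)\<^sup>2 + (norm (rest z))\<^sup>2"
  unfolding power2_norm_eq_inner power2_eq_square[of "z $ i0"] by (rule inner_split)

lemma norm_join: "(norm (join r y))\<^sup>2 = r\<^sup>2 + (norm y)\<^sup>2"
  by (simp add: norm_split)

lemma rest_axis [simp]: "rest (axis i0 x) = 0" "rest (axis (b j) x) = axis j x"
  using inj_b by (auto simp: vec_eq_iff axis_def inj_def)

lemma split_borel [measurable]: "rest \<in> borel_measurable borel" "(\<lambda>z. z $ i0) \<in> borel_measurable borel"
  using bounded_linear_rest
  by (auto intro!: borel_measurable_continuous_onI linear_continuous_on continuous_intros)

lemma distr_split: "distr lborel borel (\<lambda>z. (z $ i0, rest z)) = lborel"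
proof (rule distr_lborel_Basis_map)
  let ?T = "\<lambda>z. (z $ i0, rest z)"
  show "linear ?T" using linear_rest by (auto intro!: linearI simp: linear_add linear_scale)
  have inj: "inj ?T" by (auto simp: inj_def vec_eq_split)
  have R: "(Basis :: (real^'n) set) = range (\<lambda>i. axis i 1)" by (auto simp: Basis_vec_def)
  have BE: "(Basis :: (real^'n) set) = insert (axis i0 1) (range (\<lambda>j. axis (b j) 1))"
    unfolding R using range_b by (auto simp: image_iff) (metis b_cases)
  have axb: "axis (b j) (1::real) $ i0 = 0" "axis i0 (1::real) $ i0 = 1" for j by (simp_all add: axis_def)
  have "?T ` Basis = insert (1, 0) (range (\<lambda>j. (0, axis j 1)))"
    unfolding BE by (simp add: image_image axb)
  also have "\<dots> = Basis" by (auto simp: Basis_prod_def Basis_vec_def)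
  finally show "bij_betw ?T Basis Basis" using inj by (auto simp: bij_betw_def inj_on_def)
qed

lemma nn_integral_split:
  assumes [measurable]: "u \<in> borel_measurable borel" "v \<in> borel_measurable borel"
  shows "(\<integral>\<^sup>+z. u (z $ i0) * v (rest z) \<partial>lborel) = (\<integral>\<^sup>+r. u r \<partial>lborel) * (\<integral>\<^sup>+y. v y \<partial>lborel)"
proof -
  have "(\<integral>\<^sup>+z. u (z $ i0) * v (rest z) \<partial>lborel) = (\<integral>\<^sup>+p. u (fst p) * v (snd p) \<partial>distr lborel borel (\<lambda>z. (z $ i0, rest z)))"
    by (subst nn_integral_distr) (auto simp: borel_prod[symmetric])
  also have "\<dots> = (\<integral>\<^sup>+p. u (fst p) * v (snd p) \<partial>(lborel \<Otimes>\<^sub>M lborel))"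
    by (simp add: distr_split lborel_prod)
  also have "\<dots> = (\<integral>\<^sup>+r. \<integral>\<^sup>+y. u r * v y \<partial>lborel \<partial>lborel)"
    by (subst lborel.nn_integral_fst[symmetric]) auto
  also have "\<dots> = (\<integral>\<^sup>+r. u r \<partial>lborel) * (\<integral>\<^sup>+y. v y \<partial>lborel)"
    by (simp add: nn_integral_cmult nn_integral_multc)
  finally show ?thesis .
qed

end

text \<open>The area of \<open>A\<close> as \<open>CARD('n)\<close> times the volume of the cone
  over \<open>A\<close> in the unit ball. The factor compensates the integral of
  \<open>r ^ (CARD('n) - 1)\<close> over the unit interval; the origin is removed because it has no
  direction.\<close>

definition sphere_measure :: "(real^'n::finite) measure" where
  "sphere_measure = distr (density lborel (\<lambda>x. ennreal (real CARD('n)) * indicator (ball 0 1 - {0}) x)) borel (\<lambda>x. x /\<^sub>R norm x)"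

lemma normalize_measurable [measurable]: "(\<lambda>x::real^'n::finite. x /\<^sub>R norm x) \<in> borel_measurable borel"
  by measurable

lemma emeasure_sphere_measure:
  assumes "A \<in> sets borel"
  shows "emeasure (sphere_measure :: (real^'n::finite) measure) A =
    ennreal (real CARD('n)) * (\<integral>\<^sup>+x\<in>{x. x /\<^sub>R norm x \<in> A} \<inter> (ball 0 1 - {0}). 1 \<partial>lborel)"
proof -
  have [measurable]: "{x::real^'n. x /\<^sub>R norm x \<in> A} \<in> sets borel"
    using measurable_sets_borel[OF normalize_measurable assms] by (simp add: vimage_def)
  have C: "(\<lambda>x::real^'n. ennreal (real CARD('n)) * indicator (ball 0 1 - {0}) x) \<in> borel_measurable borel"
    by (intro borel_measurable_times_ennreal borel_measurable_const borel_measurable_indicator) auto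
  have "emeasure (sphere_measure :: (real^'n) measure) A =
    (\<integral>\<^sup>+x. ennreal (real CARD('n)) * indicator (ball 0 1 - {0}) x * indicator {x. x /\<^sub>R norm x \<in> A} x \<partial>lborel)"
    unfolding sphere_measure_def using assms C
    by (simp add: emeasure_distr emeasure_density vimage_def)
  also have "\<dots> = (\<integral>\<^sup>+x. ennreal (real CARD('n)) * indicator ({x. x /\<^sub>R norm x \<in> A} \<inter> (ball 0 1 - {0})) x \<partial>lborel)"
    by (intro nn_integral_cong) (auto split: split_indicator)
  also have "\<dots> = ennreal (real CARD('n)) * (\<integral>\<^sup>+x. indicator ({x. x /\<^sub>R norm x \<in> A} \<inter> (ball 0 1 - {0})) x \<partial>lborel)"
  proof (rule nn_integral_cmult)
    have "{x::real^'n. x /\<^sub>R norm x \<in> A} \<inter> (ball 0 1 - {0}) \<in> sets borel"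
      using measurable_sets_borel[OF normalize_measurable assms] by (auto simp: vimage_def)
    then show "indicator ({x::real^'n. x /\<^sub>R norm x \<in> A} \<inter> (ball 0 1 - {0})) \<in> borel_measurable lborel"
      by (intro borel_measurable_indicator) simp
  qed
  finally show ?thesis by simp
qed

lemma nn_integral_power_unit_interval: "(\<integral>\<^sup>+r\<in>{0<..<1}. ennreal (r ^ k) \<partial>lborel) = ennreal (1 / real (Suc k))"
proof -
  have "((\<lambda>r. r ^ k) has_integral (1 / real (Suc k))) {0..1::real}"
  proof -
    have "((\<lambda>r. r ^ k) has_integral (1 ^ Suc k / real (Suc k) - 0 ^ Suc k / real (Suc k))) {0..1::real}"
      by (rule fundamental_theorem_of_calculus)
        (auto intro!: derivative_eq_intros simp: has_real_derivative_iff_has_vector_derivative[symmetric] simp del: power_Suc of_nat_Suc)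
    then show ?thesis by simp
  qed
  then have "((\<lambda>r. r ^ k) has_integral (1 / real (Suc k))) {0<..<1::real}"
    by (simp add: has_integral_Icc_iff_Ioo)
  then show ?thesis
    by (intro nn_integral_has_integral_lebesgue') auto
qed

context split_coordinates
begin

text \<open>This is the Jacobian of a cone map, \<open>u\<close> being a point of the sphere and
  \<open>A\<close> the differential of a chart there. The radial image \<open>u\<close> is a unit
  vector orthogonal to all tangential images, so the Gram matrix splits into blocks, and each of the
  \<open>CARD('k)\<close> tangential directions contributes a factor \<open>r\<close>.\<close>

lemma det_cone_map:
  assumes A: "linear (A :: real^'k \<Rightarrow> real^'n)" and u: "norm u = 1" and orth: "\<And>v. u \<bullet> A v = 0"
  shows "\<bar>det (matrix (\<lambda>h. h $ i0 *\<^sub>R u + r *\<^sub>R A (rest h)))\<bar> =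
    \<bar>r\<bar> ^ CARD('k) * sqrt (det (\<chi> i j. A (axis i 1) \<bullet> A (axis j 1)))"
proof -
  define B where "B = (\<lambda>h. h $ i0 *\<^sub>R u + r *\<^sub>R A (rest h))"
  have linB: "linear B" unfolding B_def
    using A linear_rest by (auto intro!: linearI simp: linear_add linear_scale algebra_simps)
  define N where "N = (\<chi> i j. B (axis i 1) \<bullet> B (axis j 1))"
  have I: "(\<chi> i j. axis i 1 \<bullet> (axis j 1 :: real^'n)) = mat 1"
    by (simp add: vec_eq_iff mat_def inner_axis_axis)
  \<comment> \<open>\<open>det_gram_compose\<close> with the identity in the outer place: the
    squared determinant is the Gram determinant of the columns.\<close>
  have "(det (matrix B))\<^sup>2 = det N"
    using det_gram_compose[OF linear_ident linB] by (simp add: I N_def)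
  also have "det N = N $ i0 $ i0 * det (\<chi> i j. N $ b i $ b j)"
  proof (rule det_block[OF inj_b range_b])
    fix j assume "j \<noteq> i0"
    then obtain j' where "j = b j'" using b_cases by metis
    then show "N $ i0 $ j = 0" using A
      by (simp add: N_def B_def orth linear_0) (simp add: axis_def orth)
  qed
  also have "N $ i0 $ i0 = 1" using A u by (simp add: N_def B_def linear_0 power2_norm_eq_inner[symmetric])
  also have "(\<chi> i j. N $ b i $ b j) = (\<chi> i j. A (r *\<^sub>R axis i 1) \<bullet> A (r *\<^sub>R axis j 1))"
  proof -
    have "B (axis (b j) 1) = A (r *\<^sub>R axis j 1)" for j
      using A by (simp add: B_def linear_scale) (simp add: axis_def)
    then show ?thesis by (simp add: N_def)
  qed
  also have "det \<dots> = (det (matrix ((*\<^sub>R) r :: real^'k \<Rightarrow> _)))\<^sup>2 * det (\<chi> i j. A (axis i 1) \<bullet> A (axis j 1))"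
    by (rule det_gram_compose[OF A]) (auto intro!: linearI simp: algebra_simps)
  also have "det (matrix ((*\<^sub>R) r :: real^'k \<Rightarrow> _)) = r ^ CARD('k)" by simp
  finally have "(det (matrix B))\<^sup>2 = (r ^ CARD('k))\<^sup>2 * det (\<chi> i j. A (axis i 1) \<bullet> A (axis j 1))" by simp
  then have "sqrt ((det (matrix B))\<^sup>2) = sqrt ((r ^ CARD('k))\<^sup>2 * det (\<chi> i j. A (axis i 1) \<bullet> A (axis j 1)))" by simp
  then show ?thesis by (simp add: real_sqrt_mult B_def power_abs)
qed

text \<open>The cone over a patch is the injective image of the set of pairs of a radius in the open
  unit interval and a parameter in the patch. The Jacobian is a product, so the integral factors
  into that of the area element and \<open>1 / CARD('n)\<close>, which the constant in
  \<open>sphere_measure\<close> removes.\<close>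

lemma is_area_measure_sphere: "is_area_measure TYPE('k) (sphere (0::real^'n) 1) sphere_measure"
  unfolding is_area_measure_def
proof (intro conjI allI impI ballI)
  show "sets (sphere_measure :: (real^'n) measure) = sets borel" by (simp add: sphere_measure_def)
  have "{x. x /\<^sub>R norm x \<in> - sphere (0::real^'n) 1} \<inter> (ball 0 1 - {0}) = {}"
  proof -
    have "norm (x /\<^sub>R norm x) = 1" if "x \<noteq> 0" for x :: "real^'n" using that by simp
    then show ?thesis by fastforce
  qed
  then show "emeasure sphere_measure (- sphere (0::real^'n) 1) = 0"
    by (simp add: emeasure_sphere_measure)
  fix U and \<phi> :: "real^'k \<Rightarrow> real^'n" and A
  assume lp: "local_parametrization (sphere 0 1) U \<phi>" and A: "A \<in> sets borel" and AU: "A \<subseteq> \<phi> ` U"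
  have opU: "open U" and sub: "\<phi> ` U \<subseteq> sphere 0 1" and inj\<phi>: "inj_on \<phi> U"
    using lp unfolding local_parametrization_def openin_open homeomorphism_def by (auto intro: inj_on_inverseI)
  have n1: "norm (\<phi> u) = 1" if "u \<in> U" for u using sub that by auto
  define B where "B = U \<inter> \<phi> -` A"
  have Bb: "B \<in> sets borel" unfolding B_def by (rule local_parametrization_vimage_borel[OF lp A])
  have BU: "u \<in> U" "\<phi> u \<in> A" if "u \<in> B" for u using that by (auto simp: B_def)
  define Z where "Z = {z. z $ i0 \<in> {0<..<1} \<and> rest z \<in> B}"
  define C where "C = {x. x /\<^sub>R norm x \<in> A} \<inter> (ball 0 1 - {0})"
  define g where "g = (\<lambda>z. z $ i0 *\<^sub>R \<phi> (rest z))"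
  define \<phi>' where "\<phi>' = (\<lambda>u. frechet_derivative \<phi> (at u))"
  define g' where "g' = (\<lambda>z h. h $ i0 *\<^sub>R \<phi> (rest z) + z $ i0 *\<^sub>R \<phi>' (rest z) (rest h))"
  have d\<phi>: "(\<phi> has_derivative \<phi>' u) (at u)" if "u \<in> U" for u
    unfolding \<phi>'_def by (rule local_parametrization_has_derivative[OF lp that])
  \<comment> \<open>Obtained by differentiating \<open>\<phi> w \<bullet> \<phi> w\<close>, which is
    constantly 1 on \<open>U\<close>.\<close>
  have orth: "\<phi> u \<bullet> \<phi>' u v = 0" if "u \<in> U" for u v
  proof -
    have "((\<lambda>w. \<phi> w \<bullet> \<phi> w) has_derivative (\<lambda>v. \<phi> u \<bullet> \<phi>' u v + \<phi>' u v \<bullet> \<phi> u)) (at u)"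
      by (intro has_derivative_inner d\<phi> that)
    moreover have "((\<lambda>w. \<phi> w \<bullet> \<phi> w) has_derivative (\<lambda>v. 0)) (at u)"
    proof (rule has_derivative_transform_within_open[OF _ opU that])
      show "((\<lambda>_. 1) has_derivative (\<lambda>v. 0::real)) (at u)" by (rule has_derivative_const)
      show "1 = \<phi> w \<bullet> \<phi> w" if "w \<in> U" for w using n1[OF that] by (simp add: norm_eq_1)
    qed
    ultimately have "(\<lambda>v. \<phi> u \<bullet> \<phi>' u v + \<phi>' u v \<bullet> \<phi> u) = (\<lambda>v. 0)" by (rule has_derivative_unique)
    from fun_cong[OF this, of v] show ?thesis by (simp add: inner_commute)
  qed
  have Zb: "Z \<in> sets borel"
  proof -
    have "Z = (\<lambda>z. z $ i0) -` {0<..<1} \<inter> rest -` B" by (auto simp: Z_def)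
    then show ?thesis using measurable_sets_borel[OF split_borel(1) Bb] measurable_sets_borel[OF split_borel(2), of "{0<..<1}"] by auto
  qed
  have Cb: "C \<in> sets borel"
    unfolding C_def using measurable_sets_borel[OF normalize_measurable A] by (auto simp: vimage_def)
  have normg: "norm (g z) = z $ i0" "g z /\<^sub>R norm (g z) = \<phi> (rest z)" if "z \<in> Z" for z
    using that n1[of "rest z"] BU[of "rest z"] by (auto simp: g_def Z_def)
  have img: "g ` Z = C"
  proof (intro equalityI subsetI)
    fix x assume "x \<in> g ` Z"
    then obtain z where z: "z \<in> Z" "x = g z" by auto
    then show "x \<in> C" using normg[OF z(1)] BU[of "rest z"] by (auto simp: C_def Z_def)
  next
    fix x assume x: "x \<in> C"
    then obtain u where u: "u \<in> U" "x /\<^sub>R norm x = \<phi> u" "\<phi> u \<in> A" using AU by (auto simp: C_def)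
    then have "x = g (join (norm x) u)" using x
      by (simp add: g_def C_def flip: u(2))
    moreover have "join (norm x) u \<in> Z" using x u by (auto simp: Z_def B_def C_def)
    ultimately show "x \<in> g ` Z" by blast
  qed
  have inj: "inj_on g Z"
  proof (rule inj_onI)
    fix z w assume zw: "z \<in> Z" "w \<in> Z" "g z = g w"
    then have "z $ i0 = w $ i0" "\<phi> (rest z) = \<phi> (rest w)" using normg by metis+
    moreover have "rest z \<in> U" "rest w \<in> U" using zw BU by (auto simp: Z_def)
    ultimately have "rest z = rest w" using inj\<phi> by (auto dest: inj_onD)
    with \<open>z $ i0 = w $ i0\<close> show "z = w" by (subst vec_eq_split) simp
  qed
  have der: "(g has_derivative g' z) (at z within Z)" if "z \<in> Z" for z
  proof -
    have u: "rest z \<in> U" using that BU by (auto simp: Z_def)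
    have 1: "((\<lambda>z. z $ i0) has_derivative (\<lambda>h. h $ i0)) (at z within Z)"
      by (rule bounded_linear_imp_has_derivative[OF bounded_linear_vec_nth])
    have 2: "((\<lambda>z. \<phi> (rest z)) has_derivative (\<lambda>h. \<phi>' (rest z) (rest h))) (at z within Z)"
      by (rule has_derivative_compose[OF bounded_linear_imp_has_derivative[OF bounded_linear_rest] d\<phi>[OF u]])
    show ?thesis unfolding g_def g'_def
      by (rule has_derivative_eq_rhs[OF has_derivative_scaleR[OF 1 2]]) (simp add: add.commute)
  qed
  have det: "\<bar>det (matrix (g' z))\<bar> = (z $ i0) ^ CARD('k) * area_element \<phi> (rest z)" if "z \<in> Z" for z
  proof -
    have u: "rest z \<in> U" "0 < z $ i0" using that BU by (auto simp: Z_def)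
    have "linear (\<phi>' (rest z))" using d\<phi>[OF u(1)] by (rule has_derivative_linear)
    from det_cone_map[OF this n1[OF u(1)] orth[OF u(1)], of "z $ i0"] show ?thesis
      using u(2) by (simp add: g'_def area_element_def \<phi>'_def)
  qed
  have aem: "(\<lambda>u. indicator B u *\<^sub>R area_element \<phi> u) \<in> borel_measurable borel"
    by (rule borel_measurable_continuous_on_indicator[OF Bb])
      (rule continuous_on_subset[OF continuous_on_area_element[OF lp]], simp add: B_def)
  have J: "(\<lambda>z. indicator Z z * (\<bar>det (matrix (g' z))\<bar> * 1)) \<in> borel_measurable borel"
  proof -
    have "(\<lambda>z. indicator {0<..<1} (z $ i0) * (z $ i0) ^ CARD('k) * (indicator B (rest z) *\<^sub>R area_element \<phi> (rest z))) \<in> borel_measurable borel"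
      using measurable_compose[OF split_borel(1) aem] by measurable
    also have "(\<lambda>z. indicator {0<..<1} (z $ i0) * (z $ i0) ^ CARD('k) * (indicator B (rest z) *\<^sub>R area_element \<phi> (rest z))) =
      (\<lambda>z. indicator Z z * (\<bar>det (matrix (g' z))\<bar> * 1))"
    proof
      fix z show "indicator {0<..<1} (z $ i0) * (z $ i0) ^ CARD('k) * (indicator B (rest z) *\<^sub>R area_element \<phi> (rest z)) =
        indicator Z z * (\<bar>det (matrix (g' z))\<bar> * 1)"
        using det[of z] by (cases "z \<in> Z") (auto simp: Z_def indicator_def)
    qed
    finally show ?thesis .
  qed
  have "(\<integral>\<^sup>+x\<in>C. 1 \<partial>lborel) = (\<integral>\<^sup>+x\<in>g ` Z. ennreal 1 \<partial>lborel)" by (simp add: img)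
  also have "\<dots> = (\<integral>\<^sup>+z\<in>Z. ennreal (\<bar>det (matrix (g' z))\<bar> * 1) \<partial>lborel)"
    by (rule nn_integral_change_of_variables[OF Zb _ der inj _ _ J]) (auto simp: img Cb)
  also have "\<dots> = (\<integral>\<^sup>+z. (ennreal ((z $ i0) ^ CARD('k)) * indicator {0<..<1} (z $ i0)) *
      (ennreal (indicator B (rest z) *\<^sub>R area_element \<phi> (rest z))) \<partial>lborel)"
  proof (intro nn_integral_cong)
    fix z show "ennreal (\<bar>det (matrix (g' z))\<bar> * 1) * indicator Z z = (ennreal ((z $ i0) ^ CARD('k)) * indicator {0<..<1} (z $ i0)) *
      (ennreal (indicator B (rest z) *\<^sub>R area_element \<phi> (rest z)))"
    proof (cases "z \<in> Z")
      case True
      then show ?thesis using det[OF True] by (auto simp: Z_def ennreal_mult')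
    qed (auto simp: Z_def indicator_def)
  qed
  also have "\<dots> = (\<integral>\<^sup>+r. ennreal (r ^ CARD('k)) * indicator {0<..<1} r \<partial>lborel) *
     (\<integral>\<^sup>+u. ennreal (indicator B u *\<^sub>R area_element \<phi> u) \<partial>lborel)"
    by (rule nn_integral_split) (use aem in measurable)
  also have "(\<integral>\<^sup>+u. ennreal (indicator B u *\<^sub>R area_element \<phi> u) \<partial>lborel) = (\<integral>\<^sup>+u\<in>B. ennreal (area_element \<phi> u) \<partial>lborel)"
    by (intro nn_integral_cong) (auto simp: indicator_def)
  finally have C: "(\<integral>\<^sup>+x\<in>C. 1 \<partial>lborel) = ennreal (1 / real CARD('n)) * (\<integral>\<^sup>+u\<in>B. ennreal (area_element \<phi> u) \<partial>lborel)"
    by (simp add: nn_integral_power_unit_interval card_n)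
  have "emeasure sphere_measure A = ennreal (real CARD('n)) * (\<integral>\<^sup>+x\<in>C. 1 \<partial>lborel)"
    unfolding C_def by (rule emeasure_sphere_measure[OF A])
  also have "\<dots> = (\<integral>\<^sup>+u\<in>B. ennreal (area_element \<phi> u) \<partial>lborel)"
    unfolding C by (simp add: mult.assoc[symmetric] ennreal_mult[symmetric])
  finally show "emeasure sphere_measure A = (\<integral>\<^sup>+u\<in>U \<inter> \<phi> -` A. ennreal (area_element \<phi> u) \<partial>lborel)"
    by (simp add: B_def)
qed

text \<open>Chart of the open hemisphere around \<open>Q (axis i0 1)\<close>, as the rotated graph
  of a function on the unit ball.\<close>

definition cap :: "(real^'n \<Rightarrow> real^'n) \<Rightarrow> real^'k \<Rightarrow> real^'n" where
  "cap Q y = Q (join (sqrt (1 - (norm y)\<^sup>2)) y)"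

lemma local_parametrization_cap:
  assumes Q: "orthogonal_transformation Q"
  shows "cap Q ` ball 0 1 = sphere 0 1 \<inter> {x. 0 < Q (axis i0 1) \<bullet> x}"
    and "local_parametrization (sphere 0 1) (ball 0 1) (cap Q)"
proof -
  have linQ: "linear Q" and QQ: "Q x \<bullet> Q y = x \<bullet> y" and normQ: "norm (Q x) = norm x" for x y
    using Q by (auto simp: orthogonal_transformation_def orthogonal_transformation_norm)
  have blQ: "bounded_linear Q" using linQ by (simp add: linear_conv_bounded_linear)
  have bij: "bij Q" using Q by (rule orthogonal_transformation_bij)
  define Q' where "Q' = inv Q"
  have Q': "orthogonal_transformation Q'" unfolding Q'_def using Q by (rule orthogonal_transformation_inv)
  have QQ': "Q (Q' x) = x" "Q' (Q x) = x" for x using bij by (simp_all add: Q'_def bij_is_surj surj_f_inv_f bij_is_inj)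
  have normQ': "norm (Q' x) = norm x" for x using Q' by (simp add: orthogonal_transformation_norm)
  have blQ': "bounded_linear Q'" using Q' by (simp add: orthogonal_transformation_linear linear_conv_bounded_linear[symmetric])
  have pos: "0 < 1 - (norm y)\<^sup>2" if "y \<in> ball 0 1" for y :: "real^'k"
    using that by (simp add: power_less_one_iff abs_square_less_1)
  show img: "cap Q ` ball 0 1 = sphere 0 1 \<inter> {x. 0 < Q (axis i0 1) \<bullet> x}"
  proof (intro equalityI subsetI)
    fix x assume "x \<in> cap Q ` ball 0 1"
    then obtain y where y: "y \<in> ball 0 1" "x = cap Q y" by auto
    have "(norm x)\<^sup>2 = 1" using pos[OF y(1)] by (simp add: y(2) cap_def normQ norm_join)
    then have "norm x = 1" by (simp add: power2_eq_1_iff) (smt (verit) norm_ge_zero)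
    then show "x \<in> sphere 0 1 \<inter> {x. 0 < Q (axis i0 1) \<bullet> x}" using pos[OF y(1)]
      by (simp add: y(2) cap_def QQ inner_axis')
  next
    fix x assume x: "x \<in> sphere 0 1 \<inter> {x. 0 < Q (axis i0 1) \<bullet> x}"
    define w where "w = Q' x"
    have xw: "x = Q w" by (simp add: w_def QQ')
    have w: "norm w = 1" "0 < w $ i0" using x by (simp_all add: xw QQ normQ inner_axis')
    have nr: "(norm (rest w))\<^sup>2 = 1 - (w $ i0)\<^sup>2" using norm_split[of w] w by simp
    have "(norm (rest w))\<^sup>2 < 1" unfolding nr using w(2) by simp
    then have "rest w \<in> ball 0 1" by (simp add: abs_square_less_1)
    moreover have "sqrt (1 - (norm (rest w))\<^sup>2) = w $ i0" unfolding nr using w(2) by simp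
    then have "x = cap Q (rest w)" by (simp add: cap_def join_rest xw)
    ultimately show "x \<in> cap Q ` ball 0 1" by blast
  qed
  \<comment> \<open>Before the rotation, only the \<open>i0\<close> coordinate of a tangent vector
    needs computing. The others are those of \<open>v\<close>, which gives injectivity of the
    differential.\<close>
  define D where "D = (\<lambda>y v. Q (join (- (y \<bullet> v) / sqrt (1 - (norm y)\<^sup>2)) v))"
  have der: "(cap Q has_derivative D y) (at y)" if y: "y \<in> ball 0 1" for y
  proof -
    have "((\<lambda>y. sqrt (1 - y \<bullet> y)) has_derivative (\<lambda>v. - (y \<bullet> v) / sqrt (1 - (norm y)\<^sup>2))) (at y)"
      using pos[OF y] by (auto intro!: derivative_eq_intros simp: power2_norm_eq_inner inner_commute field_simps)
    then have "((\<lambda>y. (sqrt (1 - y \<bullet> y), y)) has_derivative (\<lambda>v. (- (y \<bullet> v) / sqrt (1 - (norm y)\<^sup>2), v))) (at y)"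
      by (intro has_derivative_Pair has_derivative_ident)
    from bounded_linear.has_derivative[OF blQ bounded_linear.has_derivative[OF bounded_linear_join this]]
    show ?thesis by (simp add: cap_def[abs_def] D_def power2_norm_eq_inner)
  qed
  have fd: "frechet_derivative (cap Q) (at y) = D y" if "y \<in> ball 0 1" for y
    using frechet_derivative_at[OF der[OF that]] by simp
  show "local_parametrization (sphere 0 1) (ball 0 1) (cap Q)"
    unfolding local_parametrization_def
  proof (intro conjI allI ballI)
    show "cap Q differentiable_on ball 0 1"
      using der has_derivative_at_withinI by (force simp: differentiable_on_def differentiable_def)
    fix v :: "real^'k"
    have "continuous_on (ball 0 1) (\<lambda>y. (- (y \<bullet> v) / sqrt (1 - (norm y)\<^sup>2), v))"
    proof -
      have "sqrt (1 - (norm y)\<^sup>2) \<noteq> 0" if "y \<in> ball 0 1" for y :: "real^'k" using pos[OF that] by simp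
      then have nz: "\<forall>y\<in>ball 0 1 :: (real^'k) set. sqrt (1 - (norm y)\<^sup>2) \<noteq> 0" by blast
      show ?thesis by (intro continuous_intros nz)
    qed
    then have "continuous_on (ball 0 1) (\<lambda>y. D y v)"
      unfolding D_def
      by (intro bounded_linear.continuous_on[OF blQ])
        (use bounded_linear.continuous_on[OF bounded_linear_join] in fastforce)
    then show "continuous_on (ball 0 1) (\<lambda>y. frechet_derivative (cap Q) (at y) v)"
      by (rule continuous_on_eq) (simp add: fd)
  next
    fix y :: "real^'k" assume y: "y \<in> ball 0 1"
    have "inj Q" using bij by (rule bij_is_inj)
    then show "inj (frechet_derivative (cap Q) (at y))"
      unfolding fd[OF y] D_def by (intro injI) (drule injD, assumption, simp add: join_eq_iff)
  next
    have "homeomorphism (ball 0 1) (cap Q ` ball 0 1) (cap Q) (\<lambda>x. rest (Q' x))"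
    proof (rule homeomorphismI)
      show "continuous_on (ball 0 1) (cap Q)"
        by (rule has_derivative_continuous_on[OF has_derivative_at_withinI[OF der]])
      show "continuous_on (cap Q ` ball 0 1) (\<lambda>x. rest (Q' x))"
        by (intro bounded_linear.continuous_on[OF bounded_linear_rest] bounded_linear.continuous_on[OF blQ'] continuous_on_id)
    qed (auto simp: cap_def QQ')
    then show "\<exists>\<psi>. homeomorphism (ball 0 1) (cap Q ` ball 0 1) (cap Q) \<psi>" by blast
    have "open {x. 0 < Q (axis i0 1) \<bullet> x}" by (intro open_Collect_less continuous_intros)
    then show "openin (top_of_set (sphere 0 1)) (cap Q ` ball 0 1)"
      unfolding img by blast
  qed auto
qed

lemma area_measure_sphere: "area_measure TYPE('k) (sphere (0::real^'n) 1) = sphere_measure"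
proof -
  \<comment> \<open>Hemispheres around both signs of every basis vector cover the sphere, since a
    unit vector has a nonzero coordinate.\<close>
  define E :: "(real^'n) set" where "E = Basis \<union> uminus ` Basis"
  have "\<exists>Q :: real^'n \<Rightarrow> real^'n. orthogonal_transformation Q \<and> Q (axis i0 1) = e" if "e \<in> E" for e :: "real^'n"
  proof -
    have "norm (axis i0 (1::real)) = norm e" using that by (auto simp: E_def norm_axis_1)
    from orthogonal_transformation_exists[OF this] show ?thesis by blast
  qed
  then have "\<forall>e\<in>E. \<exists>Q :: real^'n \<Rightarrow> real^'n. orthogonal_transformation Q \<and> Q (axis i0 1) = e" by blast
  from bchoice[OF this] obtain Q
    where "\<forall>e\<in>E. orthogonal_transformation (Q e :: real^'n \<Rightarrow> real^'n) \<and> Q e (axis i0 1) = e" by (elim exE)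
  then have Q: "\<And>e. e \<in> E \<Longrightarrow> orthogonal_transformation (Q e) \<and> Q e (axis i0 1) = e" by blast
  show ?thesis
  proof (rule area_measure_eqI[OF is_area_measure_sphere, where P = "(\<lambda>e. (ball 0 1, cap (Q e))) ` E"])
    show "countable ((\<lambda>e. (ball 0 1 :: (real^'k) set, cap (Q e))) ` E)" by (auto simp: E_def intro: countable_finite)
    show "(\<lambda>e. (ball 0 1 :: (real^'k) set, cap (Q e))) ` E \<noteq> {}" by (simp add: E_def)
    show "local_parametrization (sphere 0 1) U \<phi>" if "(U, \<phi>) \<in> (\<lambda>e. (ball 0 1, cap (Q e))) ` E" for U \<phi>
      using that Q local_parametrization_cap(2) by auto
    show "sphere 0 1 \<subseteq> (\<Union>(U, \<phi>)\<in>(\<lambda>e. (ball 0 1, cap (Q e))) ` E. \<phi> ` U)"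
    proof
      fix x :: "real^'n" assume x: "x \<in> sphere 0 1"
      then have "x \<noteq> 0" by auto
      then obtain i where "i \<in> Basis" "x \<bullet> i \<noteq> 0" using euclidean_all_zero_iff by blast
      then have "\<exists>e\<in>E. 0 < e \<bullet> x"
        by (cases "0 < x \<bullet> i") (auto simp: E_def inner_commute intro: bexI[of _ i] bexI[of _ "- i"])
      then obtain e where e: "e \<in> E" "0 < e \<bullet> x" by blast
      have "x \<in> cap (Q e) ` ball 0 1" using local_parametrization_cap(1)[of "Q e"] Q[OF e(1)] e(2) x by simp
      then show "x \<in> (\<Union>(U, \<phi>)\<in>(\<lambda>e. (ball 0 1, cap (Q e))) ` E. \<phi> ` U)" using e(1) by auto
    qed
  qed simp
qed

end

section \<open>Entropy of the sphere\<close>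

text \<open>Dominated convergence for difference quotients along an arbitrary sequence; the mean
  value inequality turns the bound on \<open>F'\<close> over the whole interval into a bound on the
  quotients. The pointwise hypothesis is almost everywhere, since on the sphere the bounds hold only
  for unit vectors.\<close>

lemma has_real_derivative_integral:
  fixes F F' :: "real \<Rightarrow> 'a \<Rightarrow> real"
  assumes t0: "t0 \<in> {a<..<b}"
    and int: "\<And>t. t \<in> {a<..<b} \<Longrightarrow> integrable M (F t)"
    and meas: "F' t0 \<in> borel_measurable M"
    and g: "integrable M g"
    and der: "AE x in M. \<forall>t\<in>{a<..<b}. ((\<lambda>s. F s x) has_real_derivative F' t x) (at t) \<and> \<bar>F' t x\<bar> \<le> g x"
  shows "((\<lambda>t. \<integral>x. F t x \<partial>M) has_real_derivative (\<integral>x. F' t0 x \<partial>M)) (at t0)"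
  unfolding has_field_derivative_iff tendsto_at_iff_sequentially
proof (intro allI impI)
  fix X :: "nat \<Rightarrow> real"
  assume X: "\<forall>i. X i \<in> UNIV - {t0}" and lim: "X \<longlonglongrightarrow> t0"
  have "eventually (\<lambda>i. X i \<in> {a<..<b}) sequentially"
    using topological_tendstoD[OF lim _ t0] by simp
  then obtain N where N: "\<And>i. i \<ge> N \<Longrightarrow> X i \<in> {a<..<b}" by (auto simp: eventually_sequentially)
  \<comment> \<open>The shift by \<open>N\<close> discards the terms of the sequence that may lie
    outside the interval.\<close>
  define q where "q = (\<lambda>i x. (F (X (i + N)) x - F t0 x) / (X (i + N) - t0))"
  have q_int: "integrable M (q i)" for i
    unfolding q_def using N[of "i + N"] t0 by (intro integrable_divide Bochner_Integration.integrable_diff int) auto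
  have "(\<lambda>i. \<integral>x. q i x \<partial>M) \<longlonglongrightarrow> (\<integral>x. F' t0 x \<partial>M)"
  proof (rule integral_dominated_convergence[OF meas _ g])
    show "q i \<in> borel_measurable M" for i using q_int by auto
    show "AE x in M. (\<lambda>i. q i x) \<longlonglongrightarrow> F' t0 x"
      using der
    proof eventually_elim
      case (elim x)
      then have "((\<lambda>s. F s x) has_real_derivative F' t0 x) (at t0)" using t0 by blast
      then have "((\<lambda>y. (F y x - F t0 x) / (y - t0)) \<longlongrightarrow> F' t0 x) (at t0)"
        by (simp add: has_field_derivative_iff)
      then have "((\<lambda>y. (F y x - F t0 x) / (y - t0)) \<circ> X) \<longlonglongrightarrow> F' t0 x"
        using X lim unfolding tendsto_at_iff_sequentially by blast
      then have "(\<lambda>i. ((\<lambda>y. (F y x - F t0 x) / (y - t0)) \<circ> X) (i + N)) \<longlonglongrightarrow> F' t0 x"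
        by (rule LIMSEQ_ignore_initial_segment)
      then show ?case by (simp add: q_def)
    qed
    show "AE x in M. norm (q i x) \<le> g x" for i
      using der
    proof eventually_elim
      case (elim x)
      have "norm (F (X (i + N)) x - F t0 x) \<le> g x * norm (X (i + N) - t0)"
      proof (rule field_differentiable_bound)
        show "convex {a<..<b}" by simp
        show "((\<lambda>s. F s x) has_field_derivative F' z x) (at z within {a<..<b})" if "z \<in> {a<..<b}" for z
          using elim that by (blast intro: has_field_derivative_at_within)
        show "norm (F' z x) \<le> g x" if "z \<in> {a<..<b}" for z using elim that by simp
        show "X (i + N) \<in> {a<..<b}" using N by simp
      qed (rule t0)
      moreover have "X (i + N) \<noteq> t0" using X by auto
      ultimately show ?case by (simp add: q_def norm_divide divide_simps)
    qed
  qed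
  also have "(\<lambda>i. \<integral>x. q i x \<partial>M) = (\<lambda>i. ((\<lambda>y. ((\<integral>x. F y x \<partial>M) - (\<integral>x. F t0 x \<partial>M)) / (y - t0)) \<circ> X) (i + N))"
  proof
    fix i
    have "integrable M (F (X (i + N)))" "integrable M (F t0)" using N[of "i + N"] t0 int by auto
    then show "(\<integral>x. q i x \<partial>M) = ((\<lambda>y. ((\<integral>x. F y x \<partial>M) - (\<integral>x. F t0 x \<partial>M)) / (y - t0)) \<circ> X) (i + N)"
      by (simp add: q_def)
  qed
  finally show "((\<lambda>y. ((\<integral>x. F y x \<partial>M) - (\<integral>x. F t0 x \<partial>M)) / (y - t0)) \<circ> X) \<longlonglongrightarrow> (\<integral>x. F' t0 x \<partial>M)"
    by (rule LIMSEQ_offset)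
qed

section \<open>Rotation invariance and integrability on the sphere\<close>

lemma emeasure_lborel_orthogonal_image:
  fixes Q :: "real^'n::finite \<Rightarrow> real^'n"
  assumes Q: "orthogonal_transformation Q" and S: "Q ` S \<in> sets borel"
  shows "emeasure lborel (Q ` S) = emeasure lborel S"
proof -
  have bl: "bounded_linear Q" using Q by (simp add: orthogonal_transformation_linear linear_conv_bounded_linear[symmetric])
  have Qm: "Q \<in> borel_measurable borel" using bl by (intro borel_measurable_continuous_onI linear_continuous_on)
  have inj: "inj Q" using Q by (rule orthogonal_transformation_inj)
  have Sb: "S \<in> sets borel" using measurable_sets_borel[OF Qm S] by (simp add: inj_vimage_image_eq[OF inj])
  have "(\<integral>\<^sup>+x\<in>Q ` S. ennreal 1 \<partial>lborel) = (\<integral>\<^sup>+x\<in>S. ennreal (\<bar>det (matrix Q)\<bar> * 1) \<partial>lborel)"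
  proof (rule nn_integral_change_of_variables[OF Sb S])
    show "(Q has_derivative Q) (at x within S)" for x by (rule bounded_linear_imp_has_derivative[OF bl])
    show "inj_on Q S" using inj by (rule inj_on_subset) simp
  qed (use Sb in auto)
  then show ?thesis using S Sb orthogonal_transformation_det[OF Q] by simp
qed

text \<open>The cone over the preimage of \<open>A\<close> is the preimage of the cone over
  \<open>A\<close>, and orthogonal maps preserve volume.\<close>

lemma distr_sphere_measure_orthogonal:
  fixes Q :: "real^'n::finite \<Rightarrow> real^'n"
  assumes Q: "orthogonal_transformation Q"
  shows "distr sphere_measure borel Q = sphere_measure"
proof (rule measure_eqI)
  have bl: "bounded_linear Q" using Q by (simp add: orthogonal_transformation_linear linear_conv_bounded_linear[symmetric])
  have Qm: "Q \<in> borel_measurable borel" using bl by (intro borel_measurable_continuous_onI linear_continuous_on)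
  have sets_s: "sets (sphere_measure :: (real^'n) measure) = sets borel" by (simp add: sphere_measure_def)
  show "sets (distr sphere_measure borel Q) = sets (sphere_measure :: (real^'n) measure)" by (simp add: sets_s)
  fix A assume "A \<in> sets (distr sphere_measure borel Q)"
  then have A: "A \<in> sets borel" by simp
  have sp: "space (sphere_measure :: (real^'n) measure) = UNIV" by (simp add: sphere_measure_def)
  have QA: "Q -` A \<in> sets borel" using measurable_sets_borel[OF Qm A] by simp
  define C where "C = {x. x /\<^sub>R norm x \<in> A} \<inter> (ball 0 1 - {0})"
  define C' where "C' = {x. x /\<^sub>R norm x \<in> Q -` A} \<inter> (ball 0 1 - {0})"
  have Cb: "C \<in> sets borel" "C' \<in> sets borel"
    unfolding C_def C'_def using measurable_sets_borel[OF normalize_measurable A] measurable_sets_borel[OF normalize_measurable QA]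
    by (auto simp: vimage_def)
  have nQ: "norm (Q x) = norm x" for x using Q by (simp add: orthogonal_transformation_norm)
  have linQ: "linear Q" using Q by (rule orthogonal_transformation_linear)
  have Q0: "Q x = 0 \<longleftrightarrow> x = 0" for x using nQ[of x] by (metis norm_eq_zero)
  have "C' = Q -` C"
    by (auto simp: C_def C'_def nQ Q0 linear_scale[OF linQ])
  then have "Q ` C' = C" using Q by (simp add: orthogonal_transformation_surj surj_image_vimage_eq)
  then have "emeasure lborel C = emeasure lborel C'"
    using emeasure_lborel_orthogonal_image[OF Q, of C'] Cb by simp
  then show "emeasure (distr sphere_measure borel Q) A = emeasure sphere_measure A"
  proof -
    have Qm': "Q \<in> sphere_measure \<rightarrow>\<^sub>M borel" using Qm by (simp add: measurable_def sets_s sp)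
    have "emeasure (distr sphere_measure borel Q) A = emeasure sphere_measure (Q -` A)"
      using emeasure_distr[OF Qm' A] by (simp add: sp)
    also have "\<dots> = ennreal (real CARD('n)) * emeasure lborel C'"
      unfolding emeasure_sphere_measure[OF QA] C'_def[symmetric] using Cb by simp
    also have "\<dots> = emeasure sphere_measure A"
      unfolding emeasure_sphere_measure[OF A] C_def[symmetric] using Cb \<open>emeasure lborel C = emeasure lborel C'\<close> by simp
    finally show ?thesis .
  qed
qed

lemma space_sphere_measure [simp]: "space (sphere_measure :: (real^'n::finite) measure) = UNIV"
  and sets_sphere_measure [simp, measurable_cong]: "sets (sphere_measure :: (real^'n::finite) measure) = sets borel"
  by (simp_all add: sphere_measure_def)

lemma emeasure_sphere_measure_UNIV:
  "emeasure (sphere_measure :: (real^'n::finite) measure) UNIV = ennreal (real CARD('n) * measure lborel (ball (0::real^'n) 1))"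
proof -
  have "(\<integral>\<^sup>+x\<in>{x::real^'n. x /\<^sub>R norm x \<in> UNIV} \<inter> (ball 0 1 - {0}). 1 \<partial>lborel) = emeasure lborel (ball (0::real^'n) 1 - {0})"
    by simp
  also have "\<dots> = emeasure lborel (ball (0::real^'n) 1)"
    by (subst emeasure_Diff) auto
  also have "\<dots> = ennreal (measure lborel (ball (0::real^'n) 1))"
    using emeasure_lborel_ball_finite[of "0::real^'n" 1] by (intro emeasure_eq_ennreal_measure) simp
  finally show ?thesis by (simp add: emeasure_sphere_measure ennreal_mult)
qed

lemma borel_measurable_sphere_measure [simp]:
  "borel_measurable (sphere_measure :: (real^'n::finite) measure) = borel_measurable borel"
  by (intro measurable_cong_sets) auto

interpretation sphere_measure: finite_measure "sphere_measure :: (real^'n::finite) measure"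
  by (rule finite_measureI) (simp add: emeasure_sphere_measure_UNIV)

lemma AE_sphere_measure: "AE x in (sphere_measure :: (real^'n::finite) measure). norm x = 1"
proof -
  have "(-sphere 0 1 :: (real^'n) set) \<in> sets borel" by simp
  from emeasure_sphere_measure[OF this]
  have "emeasure (sphere_measure :: (real^'n::finite) measure) (- sphere 0 1) = 0"
  proof -
    have "norm (x /\<^sub>R norm x) = 1" if "x \<noteq> 0" for x :: "real^'n" using that by simp
    then have "{x. x /\<^sub>R norm x \<in> - sphere (0::real^'n) 1} \<inter> (ball 0 1 - {0}) = {}" by fastforce
    then show ?thesis by (simp add: emeasure_sphere_measure)
  qed
  then have "(- sphere 0 1 :: (real^'n) set) \<in> null_sets sphere_measure" by (simp add: null_sets_def)
  then show ?thesis by (rule AE_I') auto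
qed

lemma integrable_sphere_measure:
  fixes h :: "real^'n::finite \<Rightarrow> real"
  assumes "continuous_on UNIV h"
  shows "integrable sphere_measure h"
proof -
  have "compact (h ` sphere 0 1)"
    by (intro compact_continuous_image continuous_on_subset[OF assms]) auto
  then obtain B where B: "\<And>x. norm x = 1 \<Longrightarrow> norm (h x) \<le> B"
    using compact_imp_bounded[of "h ` sphere 0 1"] unfolding bounded_iff by force
  show ?thesis
  proof (rule sphere_measure.integrable_const_bound)
    show "AE x in sphere_measure. norm (h x) \<le> B" using AE_sphere_measure by eventually_elim (rule B)
    show "h \<in> borel_measurable sphere_measure"
      using borel_measurable_continuous_onI[OF assms] by simp
  qed
qed

section \<open>Exponential moments of a coordinate on the sphere\<close>

lemma component_le_1: "norm (x::real^'n::finite) = 1 \<Longrightarrow> \<bar>x $ i\<bar> \<le> 1"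
  using component_le_norm_cart[of x i] by simp

text \<open>A correction along two axes is added to \<open>x\<close>, so the remaining coordinates
  need no case distinction.\<close>

definition plane_rotation :: "'n::finite \<Rightarrow> 'n \<Rightarrow> real \<Rightarrow> real^'n \<Rightarrow> real^'n" where
  "plane_rotation k j \<theta> x = x + ((cos \<theta> - 1) * x $ k - sin \<theta> * x $ j) *\<^sub>R axis k 1
     + (sin \<theta> * x $ k + (cos \<theta> - 1) * x $ j) *\<^sub>R axis j 1"

lemma orthogonal_plane_rotation:
  fixes k j :: "'n::finite"
  assumes "j \<noteq> k"
  shows "orthogonal_transformation (plane_rotation k j \<theta>)"
  unfolding orthogonal_transformation
proof (intro conjI allI)
  show "linear (plane_rotation k j \<theta>)"
    by (rule linearI) (simp_all add: plane_rotation_def algebra_simps)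
  fix x :: "real^'n"
  define a where "a = (cos \<theta> - 1) * x $ k - sin \<theta> * x $ j"
  define a' where "a' = sin \<theta> * x $ k + (cos \<theta> - 1) * x $ j"
  have ax: "axis k (1::real) $ j = 0" "axis j (1::real) $ k = 0" "axis k (1::real) $ k = 1" "axis j (1::real) $ j = 1"
    using assms by (simp_all add: axis_def)
  have "(norm (plane_rotation k j \<theta> x))\<^sup>2 = (norm x)\<^sup>2 + (2 * a * x $ k + 2 * a' * x $ j + a\<^sup>2 + a'\<^sup>2)"
    using assms unfolding plane_rotation_def a_def[symmetric] a'_def[symmetric] power2_norm_eq_inner
    by (simp add: inner_add_left inner_add_right inner_axis inner_axis' ax power2_eq_square algebra_simps)
  also have "2 * a * x $ k + 2 * a' * x $ j + a\<^sup>2 + a'\<^sup>2 = 0"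
  proof -
    have id: "2 * ((c - 1) * u - s * v) * u + 2 * (s * u + (c - 1) * v) * v + ((c - 1) * u - s * v)\<^sup>2 + (s * u + (c - 1) * v)\<^sup>2
      = (s\<^sup>2 + c\<^sup>2 - 1) * (u\<^sup>2 + v\<^sup>2)" for c s u v :: real
      by (simp add: power2_eq_square algebra_simps)
    show ?thesis unfolding a_def a'_def id by simp
  qed
  finally have "(norm (plane_rotation k j \<theta> x))\<^sup>2 = (norm x)\<^sup>2" by simp
  then show "norm (plane_rotation k j \<theta> x) = norm x" by simp
qed

lemma plane_rotation_nth:
  assumes "j \<noteq> k"
  shows "plane_rotation k j \<theta> x $ k = cos \<theta> * x $ k - sin \<theta> * x $ j"
    and "plane_rotation k j \<theta> x $ j = sin \<theta> * x $ k + cos \<theta> * x $ j"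
  using assms by (simp_all add: plane_rotation_def axis_def algebra_simps)

text \<open>Rotating \<open>x $ j * exp (\<rho> * x $ k)\<close> in the \<open>(k, j)\<close>-plane leaves its integral unchanged; differentiate at angle 0.\<close>

lemma sphere_rotation_identity:
  fixes k j :: "'n::finite"
  assumes jk: "j \<noteq> k"
  shows "(\<integral>x. (x $ k - \<rho> * (x $ j)\<^sup>2) * exp (\<rho> * x $ k) \<partial>sphere_measure) = 0"
proof -
  define h where "h = (\<lambda>x::real^'n. x $ j * exp (\<rho> * x $ k))"
  define F where "F = (\<lambda>\<theta> x::real^'n. (sin \<theta> * x $ k + cos \<theta> * x $ j) * exp (\<rho> * (cos \<theta> * x $ k - sin \<theta> * x $ j)))"
  define F' where "F' = (\<lambda>\<theta> x::real^'n. (cos \<theta> * x $ k - sin \<theta> * x $ j) * exp (\<rho> * (cos \<theta> * x $ k - sin \<theta> * x $ j))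
     + (sin \<theta> * x $ k + cos \<theta> * x $ j) * (exp (\<rho> * (cos \<theta> * x $ k - sin \<theta> * x $ j)) * (\<rho> * (- sin \<theta> * x $ k - cos \<theta> * x $ j))))"
  have const: "(\<integral>x. F \<theta> x \<partial>sphere_measure) = (\<integral>x. h x \<partial>sphere_measure)" for \<theta>
  proof -
    have bl: "bounded_linear (plane_rotation k j \<theta>)"
      using orthogonal_plane_rotation[OF jk] by (simp add: orthogonal_transformation_linear linear_conv_bounded_linear[symmetric])
    have "(\<integral>x. h x \<partial>sphere_measure) = (\<integral>x. h x \<partial>distr sphere_measure borel (plane_rotation k j \<theta>))"
      by (simp add: distr_sphere_measure_orthogonal[OF orthogonal_plane_rotation[OF jk]])
    also have "\<dots> = (\<integral>x. h (plane_rotation k j \<theta> x) \<partial>sphere_measure)"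
    proof (rule integral_distr)
      show "plane_rotation k j \<theta> \<in> sphere_measure \<rightarrow>\<^sub>M borel"
        using borel_measurable_continuous_onI[OF linear_continuous_on[OF bl]] by simp
      show "h \<in> borel_measurable borel"
        unfolding h_def by (intro borel_measurable_continuous_onI continuous_intros)
    qed
    also have "(\<lambda>x. h (plane_rotation k j \<theta> x)) = F \<theta>"
      using jk by (auto simp: h_def F_def plane_rotation_nth)
    finally show ?thesis by simp
  qed
  have "((\<lambda>\<theta>. \<integral>x. F \<theta> x \<partial>sphere_measure) has_real_derivative (\<integral>x. F' 0 x \<partial>sphere_measure)) (at 0)"
  \<comment> \<open>The dominating constant bounds both rotated coordinates by 2 on the sphere,
    which is crude but uniform in the angle.\<close>
  proof (rule has_real_derivative_integral[where a = "-1" and b = 1 and g = "\<lambda>_. 2 * exp (2 * \<bar>\<rho>\<bar>) + 2 * (exp (2 * \<bar>\<rho>\<bar>) * (2 * \<bar>\<rho>\<bar>))"])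
    show "integrable sphere_measure (F t)" for t
      unfolding F_def by (intro integrable_sphere_measure continuous_intros)
    show "F' 0 \<in> borel_measurable sphere_measure"
    proof -
      have "F' 0 \<in> borel_measurable borel"
        unfolding F'_def by (intro borel_measurable_continuous_onI continuous_intros)
      then show ?thesis by simp
    qed
    show "AE x in sphere_measure. \<forall>t\<in>{-1<..<1}. ((\<lambda>s. F s x) has_real_derivative F' t x) (at t) \<and>
       \<bar>F' t x\<bar> \<le> 2 * exp (2 * \<bar>\<rho>\<bar>) + 2 * (exp (2 * \<bar>\<rho>\<bar>) * (2 * \<bar>\<rho>\<bar>))"
      using AE_sphere_measure
    proof eventually_elim
      case (elim x)
      have xk: "\<bar>x $ k\<bar> \<le> 1" "\<bar>x $ j\<bar> \<le> 1" using elim by (auto intro: component_le_1)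
      show ?case
      proof (intro ballI conjI)
        fix t :: real
        show "((\<lambda>s. F s x) has_real_derivative F' t x) (at t)"
          unfolding F_def F'_def by (auto intro!: derivative_eq_intros simp: algebra_simps)
        have p: "\<bar>c * x $ i\<bar> \<le> 1" if "\<bar>c\<bar> \<le> 1" "i = k \<or> i = j" for c i
          using mult_mono[OF that(1), of "\<bar>x $ i\<bar>" 1] xk that(2) by (auto simp: abs_mult)
        have b1: "\<bar>cos t * x $ k - sin t * x $ j\<bar> \<le> 2" "\<bar>sin t * x $ k + cos t * x $ j\<bar> \<le> 2"
          using p[of "cos t" k] p[of "sin t" j] p[of "sin t" k] p[of "cos t" j] by auto
        define u where "u = cos t * x $ k - sin t * x $ j"
        define v where "v = sin t * x $ k + cos t * x $ j"
        have uv: "\<bar>u\<bar> \<le> 2" "\<bar>v\<bar> \<le> 2" using b1 by (auto simp: u_def v_def)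
        have e: "exp (\<rho> * u) \<le> exp (2 * \<bar>\<rho>\<bar>)"
        proof -
          have "\<rho> * u \<le> \<bar>\<rho>\<bar> * \<bar>u\<bar>" by (metis abs_ge_self abs_mult)
          also have "\<dots> \<le> \<bar>\<rho>\<bar> * 2" using uv by (intro mult_left_mono) auto
          finally show ?thesis by simp
        qed
        have "F' t x = u * exp (\<rho> * u) + v * (exp (\<rho> * u) * (\<rho> * (- v)))"
          by (simp add: F'_def u_def v_def algebra_simps)
        also have "\<bar>\<dots>\<bar> \<le> \<bar>u\<bar> * exp (\<rho> * u) + \<bar>v\<bar> * (exp (\<rho> * u) * (\<bar>v\<bar> * \<bar>\<rho>\<bar>))"
          by (rule order_trans[OF abs_triangle_ineq]) (simp add: abs_mult)
        also have "\<dots> \<le> 2 * exp (2 * \<bar>\<rho>\<bar>) + 2 * (exp (2 * \<bar>\<rho>\<bar>) * (2 * \<bar>\<rho>\<bar>))"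
          using uv e by (intro add_mono mult_mono) auto
        finally show "\<bar>F' t x\<bar> \<le> 2 * exp (2 * \<bar>\<rho>\<bar>) + 2 * (exp (2 * \<bar>\<rho>\<bar>) * (2 * \<bar>\<rho>\<bar>))" .
      qed
    qed
  qed auto
  moreover have "((\<lambda>\<theta>. \<integral>x. F \<theta> x \<partial>sphere_measure) has_real_derivative 0) (at 0)"
    by (simp add: const)
  ultimately have "(\<integral>x. F' 0 x \<partial>sphere_measure) = 0" by (rule DERIV_unique)
  moreover have "F' 0 = (\<lambda>x. (x $ k - \<rho> * (x $ j)\<^sup>2) * exp (\<rho> * x $ k))"
    by (simp add: F'_def fun_eq_iff power2_eq_square algebra_simps)
  ultimately show ?thesis by simp
qed


text \<open>The rotation identities are summed over all \<open>j \<noteq> k\<close>; on the sphere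
  the squares \<open>(x $ j)\<^sup>2\<close> then add up to \<open>1 - (x $ k)\<^sup>2\<close>. The
  result is the divergence theorem on the sphere for \<open>exp (\<rho> * x $ k)\<close> times the
  tangential gradient of the coordinate \<open>x $ k\<close>.\<close>

lemma sphere_divergence_identity:
  fixes k :: "'n::finite"
  shows "\<rho> * (\<integral>x. (1 - (x $ k)\<^sup>2) * exp (\<rho> * x $ k) \<partial>sphere_measure) =
    (real CARD('n) - 1) * (\<integral>x. x $ k * exp (\<rho> * x $ k) \<partial>(sphere_measure :: (real^'n) measure))"
proof -
  have int: "integrable sphere_measure (\<lambda>x::real^'n. (x $ k - \<rho> * (x $ j)\<^sup>2) * exp (\<rho> * x $ k))" for j
    by (intro integrable_sphere_measure continuous_intros)
  have "0 = (\<Sum>j\<in>UNIV - {k}. \<integral>x. (x $ k - \<rho> * (x $ j)\<^sup>2) * exp (\<rho> * x $ k) \<partial>sphere_measure)"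
    by (simp add: sphere_rotation_identity)
  also have "\<dots> = (\<integral>x. (\<Sum>j\<in>UNIV - {k}. (x $ k - \<rho> * (x $ j)\<^sup>2) * exp (\<rho> * x $ k)) \<partial>sphere_measure)"
    by (rule Bochner_Integration.integral_sum[symmetric]) (rule int)
  also have "\<dots> = (\<integral>x. (real CARD('n) - 1) * (x $ k * exp (\<rho> * x $ k)) - \<rho> * ((1 - (x $ k)\<^sup>2) * exp (\<rho> * x $ k)) \<partial>sphere_measure)"
  proof (rule integral_cong_AE)
    show "AE x in sphere_measure. (\<Sum>j\<in>UNIV - {k}. (x $ k - \<rho> * (x $ j)\<^sup>2) * exp (\<rho> * x $ k)) =
       (real CARD('n) - 1) * (x $ k * exp (\<rho> * x $ k)) - \<rho> * ((1 - (x $ k)\<^sup>2) * exp (\<rho> * x $ k))"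
      using AE_sphere_measure
    proof eventually_elim
      case (elim x)
      have "1 = (\<Sum>j\<in>UNIV. (x $ j)\<^sup>2)"
        using elim by (simp add: norm_eq_1 inner_vec_def power2_eq_square)
      also have "\<dots> = (x $ k)\<^sup>2 + (\<Sum>j\<in>UNIV - {k}. (x $ j)\<^sup>2)" by (rule sum.remove) auto
      finally have s: "(\<Sum>j\<in>UNIV - {k}. (x $ j)\<^sup>2) = 1 - (x $ k)\<^sup>2" by simp
      have "(\<Sum>j\<in>UNIV - {k}. (x $ k - \<rho> * (x $ j)\<^sup>2) * exp (\<rho> * x $ k)) =
        (real (card (UNIV - {k})) * x $ k - \<rho> * (\<Sum>j\<in>UNIV - {k}. (x $ j)\<^sup>2)) * exp (\<rho> * x $ k)"
        by (simp add: sum_distrib_right[symmetric] sum_subtractf sum_distrib_left)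
      also have "real (card (UNIV - {k})) = real CARD('n) - 1"
        by (simp add: card_Diff_singleton of_nat_diff Suc_leI)
      finally show ?case by (simp add: s algebra_simps)
    qed
    have "(\<lambda>x. \<Sum>j\<in>UNIV - {k}. (x $ k - \<rho> * (x $ j)\<^sup>2) * exp (\<rho> * x $ k)) \<in> borel_measurable borel"
      by (intro borel_measurable_continuous_onI continuous_intros)
    then show "(\<lambda>x. \<Sum>j\<in>UNIV - {k}. (x $ k - \<rho> * (x $ j)\<^sup>2) * exp (\<rho> * x $ k)) \<in> borel_measurable sphere_measure" by simp
    have "(\<lambda>x::real^'n. (real CARD('n) - 1) * (x $ k * exp (\<rho> * x $ k)) - \<rho> * ((1 - (x $ k)\<^sup>2) * exp (\<rho> * x $ k))) \<in> borel_measurable borel"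
      by (intro borel_measurable_continuous_onI continuous_intros)
    then show "(\<lambda>x::real^'n. (real CARD('n) - 1) * (x $ k * exp (\<rho> * x $ k)) - \<rho> * ((1 - (x $ k)\<^sup>2) * exp (\<rho> * x $ k))) \<in> borel_measurable sphere_measure" by simp
  qed
  also have "\<dots> = (real CARD('n) - 1) * (\<integral>x. x $ k * exp (\<rho> * x $ k) \<partial>(sphere_measure :: (real^'n) measure)) -
     \<rho> * (\<integral>x. (1 - (x $ k)\<^sup>2) * exp (\<rho> * x $ k) \<partial>(sphere_measure :: (real^'n) measure))"
    by (subst Bochner_Integration.integral_diff)
      (auto intro!: integrable_mult_right integrable_sphere_measure continuous_intros)
  finally show ?thesis by simp
qed

text \<open>For positive \<rho> and \<open>n = CARD('n)\<close> this is a constant times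
  \<open>\<rho> powr (1 - n / 2)\<close> times the modified Bessel function of the first kind of
  order \<open>n / 2 - 1\<close> at \<rho>.\<close>

definition sphere_mgf :: "'n::finite \<Rightarrow> real \<Rightarrow> real" where
  "sphere_mgf k \<rho> = (\<integral>x. exp (\<rho> * x $ k) \<partial>(sphere_measure :: (real^'n) measure))"

definition sphere_mgf' :: "'n::finite \<Rightarrow> real \<Rightarrow> real" where
  "sphere_mgf' k \<rho> = (\<integral>x. x $ k * exp (\<rho> * x $ k) \<partial>(sphere_measure :: (real^'n) measure))"

lemma sphere_mgf_has_derivative: "(sphere_mgf k has_real_derivative sphere_mgf' k \<rho>) (at \<rho>)"
  unfolding sphere_mgf_def[abs_def] sphere_mgf'_def
proof (rule has_real_derivative_integral[where a = "\<rho> - 1" and b = "\<rho> + 1" and F' = "\<lambda>\<rho> x. x $ k * exp (\<rho> * x $ k)" and g = "\<lambda>_. exp (\<bar>\<rho>\<bar> + 1)"])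
  show "integrable sphere_measure (\<lambda>x. exp (t * x $ k))" for t
    by (intro integrable_sphere_measure continuous_intros)
  have "(\<lambda>x. x $ k * exp (\<rho> * x $ k)) \<in> borel_measurable borel"
    by (intro borel_measurable_continuous_onI continuous_intros)
  then show "(\<lambda>x. x $ k * exp (\<rho> * x $ k)) \<in> borel_measurable sphere_measure" by simp
  show "AE x in sphere_measure. \<forall>t\<in>{\<rho> - 1<..<\<rho> + 1}.
     ((\<lambda>s. exp (s * x $ k)) has_real_derivative x $ k * exp (t * x $ k)) (at t) \<and> \<bar>x $ k * exp (t * x $ k)\<bar> \<le> exp (\<bar>\<rho>\<bar> + 1)"
    using AE_sphere_measure
  proof eventually_elim
    case (elim x)
    have xk: "\<bar>x $ k\<bar> \<le> 1" using elim by (rule component_le_1)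
    show ?case
    proof (intro ballI conjI)
      fix t assume t: "t \<in> {\<rho> - 1<..<\<rho> + 1}"
      show "((\<lambda>s. exp (s * x $ k)) has_real_derivative x $ k * exp (t * x $ k)) (at t)"
        by (auto intro!: derivative_eq_intros)
      have "t * x $ k \<le> \<bar>t\<bar> * \<bar>x $ k\<bar>" by (metis abs_ge_self abs_mult)
      also have "\<dots> \<le> (\<bar>\<rho>\<bar> + 1) * 1" using t xk by (intro mult_mono) auto
      finally have "exp (t * x $ k) \<le> exp (\<bar>\<rho>\<bar> + 1)" by simp
      then have "\<bar>x $ k\<bar> * exp (t * x $ k) \<le> 1 * exp (\<bar>\<rho>\<bar> + 1)" using xk by (intro mult_mono) auto
      then show "\<bar>x $ k * exp (t * x $ k)\<bar> \<le> exp (\<bar>\<rho>\<bar> + 1)" by (simp add: abs_mult)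
    qed
  qed
qed auto

lemma sphere_mgf_0: "sphere_mgf (k::'n::finite) 0 = real CARD('n) * measure lborel (ball (0::real^'n) 1)"
  by (simp add: sphere_mgf_def measure_def emeasure_sphere_measure_UNIV)

lemma sphere_mgf_pos: "0 < sphere_mgf (k::'n::finite) \<rho>"
proof -
  have int: "integrable sphere_measure (\<lambda>x::real^'n. exp (\<rho> * x $ k))"
    by (intro integrable_sphere_measure continuous_intros)
  have "exp (- \<bar>\<rho>\<bar>) * sphere_mgf k 0 = (\<integral>x. exp (- \<bar>\<rho>\<bar>) \<partial>(sphere_measure :: (real^'n) measure))"
    by (simp add: sphere_mgf_def)
  also have "\<dots> \<le> sphere_mgf k \<rho>"
    unfolding sphere_mgf_def
  proof (rule integral_mono_AE)
    show "AE x in sphere_measure. exp (- \<bar>\<rho>\<bar>) \<le> exp (\<rho> * x $ k)"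
      using AE_sphere_measure
    proof eventually_elim
      case (elim x)
      then have "\<bar>x $ k\<bar> \<le> 1" by (rule component_le_1)
      then have "\<bar>\<rho> * x $ k\<bar> \<le> \<bar>\<rho>\<bar> * 1" unfolding abs_mult by (intro mult_left_mono) auto
      then show ?case by simp
    qed
  qed (use int in auto)
  finally show ?thesis
    using content_ball_pos[of 1 "0::real^'n"]
    by (smt (verit) exp_gt_zero mult_pos_pos of_nat_0_less_iff sphere_mgf_0 zero_less_card_finite)
qed

text \<open>By Cauchy-Schwarz the divergence identity becomes a quadratic inequality for the logarithmic derivative.\<close>

lemma sphere_mgf_riccati:
  fixes k :: "'n::finite"
  assumes "0 \<le> \<rho>"
  defines "y \<equiv> sphere_mgf' k \<rho> / sphere_mgf k \<rho>"
  shows "(real CARD('n) - 1) * y \<le> \<rho> * (1 - y\<^sup>2)"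
proof -
  let ?S = "sphere_measure :: (real^'n) measure"
  let ?I = "sphere_mgf k \<rho>" and ?J = "sphere_mgf' k \<rho>"
  let ?K = "\<integral>x. (x $ k)\<^sup>2 * exp (\<rho> * x $ k) \<partial>?S"
  have int: "integrable ?S (\<lambda>x. exp (\<rho> * x $ k))" "integrable ?S (\<lambda>x. x $ k * exp (\<rho> * x $ k))"
    "integrable ?S (\<lambda>x. (x $ k)\<^sup>2 * exp (\<rho> * x $ k))"
    by (intro integrable_sphere_measure continuous_intros)+
  have J: "?J = y * ?I" using sphere_mgf_pos[of k \<rho>] by (simp add: y_def)
  \<comment> \<open>Cauchy-Schwarz as nonnegativity of a weighted variance about the weighted mean
    \<open>y\<close>.\<close>
  have "0 \<le> (\<integral>x. (x $ k - y)\<^sup>2 * exp (\<rho> * x $ k) \<partial>?S)"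
    by (intro Bochner_Integration.integral_nonneg) auto
  also have "\<dots> = (\<integral>x. (x $ k)\<^sup>2 * exp (\<rho> * x $ k) - 2 * y * (x $ k * exp (\<rho> * x $ k)) + y\<^sup>2 * exp (\<rho> * x $ k) \<partial>?S)"
    by (intro Bochner_Integration.integral_cong) (auto simp: power2_eq_square algebra_simps)
  also have "\<dots> = ?K - 2 * y * ?J + y\<^sup>2 * ?I"
    unfolding sphere_mgf_def sphere_mgf'_def using int by simp
  finally have K: "y\<^sup>2 * ?I \<le> ?K" unfolding J by (simp add: power2_eq_square)
  have "(real CARD('n) - 1) * ?J = \<rho> * (\<integral>x. (1 - (x $ k)\<^sup>2) * exp (\<rho> * x $ k) \<partial>?S)"
    unfolding sphere_mgf'_def by (rule sphere_divergence_identity[symmetric])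
  also have "(\<integral>x. (1 - (x $ k)\<^sup>2) * exp (\<rho> * x $ k) \<partial>?S) = ?I - ?K"
    unfolding sphere_mgf_def using int by (simp add: left_diff_distrib)
  also have "\<rho> * (?I - ?K) \<le> \<rho> * (?I - y\<^sup>2 * ?I)"
    using K assms(1) by (intro mult_left_mono) auto
  finally have "((real CARD('n) - 1) * y) * ?I \<le> (\<rho> * (1 - y\<^sup>2)) * ?I"
    unfolding J by (simp add: algebra_simps)
  then show ?thesis using sphere_mgf_pos[of k \<rho>] by (simp add: mult_le_cancel_right)
qed

text \<open>The comparison value \<open>u = \<rho> / (2 * A)\<close> is a nonnegative solution of
  \<open>m * u = \<rho> * (1 - u\<^sup>2)\<close>, the equality case of
  \<open>sphere_mgf_riccati\<close>. Beyond \<open>u\<close> the left side is larger and the right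
  side is no larger, so a bigger logarithmic derivative is impossible.\<close>

lemma sphere_mgf_ratio_le:
  fixes k :: "'n::finite"
  assumes "0 \<le> \<rho>" and m: "m = real CARD('n) - 1" "0 < m" and A: "0 < A" "A\<^sup>2 = m * A / 2 + \<rho>\<^sup>2 / 4"
  shows "sphere_mgf' k \<rho> / sphere_mgf k \<rho> \<le> \<rho> / (2 * A)"
proof (rule ccontr)
  define y where "y = sphere_mgf' k \<rho> / sphere_mgf k \<rho>"
  define u where "u = \<rho> / (2 * A)"
  assume "\<not> sphere_mgf' k \<rho> / sphere_mgf k \<rho> \<le> \<rho> / (2 * A)"
  then have yu: "u < y" by (simp add: y_def u_def)
  have u0: "0 \<le> u" using assms by (simp add: u_def)
  have "\<rho> * (1 - u\<^sup>2) = \<rho> * (A\<^sup>2 - \<rho>\<^sup>2 / 4) / A\<^sup>2"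
    using A(1) by (simp add: u_def power_divide field_simps)
  also have "\<dots> = m * u" proof -
    have e: "A\<^sup>2 - \<rho>\<^sup>2 / 4 = m * A / 2" using A(2) by simp
    show ?thesis unfolding e using A(1) by (simp add: u_def power2_eq_square)
  qed
  finally have "\<rho> * (1 - u\<^sup>2) = m * u" .
  moreover have "\<rho> * (1 - y\<^sup>2) \<le> \<rho> * (1 - u\<^sup>2)"
    using assms(1) u0 yu by (intro mult_left_mono) (auto intro: power_mono)
  moreover have "m * u < m * y" using m(2) yu by simp
  ultimately show False
    using sphere_mgf_riccati[OF assms(1), of k] m(1) by (simp add: y_def)
qed

text \<open>With \<open>B = 1 / (4 * t)\<close> and \<open>\<rho> = norm z / (2 * t)\<close> the
  left side is, up to a constant, the logarithm of the \<open>F\<close>-functional of the sphere.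
  For fixed \<rho> it is largest at \<open>B = A \<rho>\<close>; along this curve of optima the
  value does not increase with \<rho>, because its derivative is the difference estimated in
  \<open>sphere_mgf_ratio_le\<close>.\<close>

lemma sphere_mgf_bound:
  fixes k :: "'n::finite"
  assumes "0 \<le> \<rho>" and m: "m = real CARD('n) - 1" "0 < m" and "0 < B"
  shows "m / 2 * ln B - B - \<rho>\<^sup>2 / (4 * B) + ln (sphere_mgf k \<rho>) \<le> m / 2 * ln (m / 2) - m / 2 + ln (sphere_mgf k 0)"
proof -
  \<comment> \<open>The positive solution of \<open>B\<^sup>2 = m * B / 2 + r\<^sup>2 / 4\<close>,
    which is the critical point equation in \<open>B\<close>.\<close>
  define A where "A r = (m + sqrt (m\<^sup>2 + 4 * r\<^sup>2)) / 4" for r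
  have sq: "0 < m\<^sup>2 + 4 * r\<^sup>2" for r using m by (simp add: add_pos_nonneg)
  have Apos: "m / 2 \<le> A r" "0 < A r" for r
  proof -
    have "m \<le> sqrt (m\<^sup>2 + 4 * r\<^sup>2)" by (rule real_le_rsqrt) simp
    then show "m / 2 \<le> A r" by (simp add: A_def)
    then show "0 < A r" using m by simp
  qed
  have A2: "(A r)\<^sup>2 = m * A r / 2 + r\<^sup>2 / 4" for r
  proof -
    have "(sqrt (m\<^sup>2 + 4 * r\<^sup>2))\<^sup>2 = m\<^sup>2 + 4 * r\<^sup>2" using sq[of r] by simp
    then show ?thesis by (simp add: A_def power2_eq_square field_simps)
  qed
  define \<beta> where "\<beta> r = m / 2 * ln (A r) - A r - r\<^sup>2 / (4 * A r) + ln (sphere_mgf k r)" for r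
  have "\<beta> \<rho> \<le> \<beta> 0"
  proof (rule DERIV_nonpos_imp_nonincreasing[OF assms(1)])
    fix r :: real assume r: "0 \<le> r" "r \<le> \<rho>"
    define A' where "A' = r / sqrt (m\<^sup>2 + 4 * r\<^sup>2)"
    have dA: "(A has_real_derivative A') (at r)"
      unfolding A_def[abs_def] A'_def using sq[of r] by (auto intro!: derivative_eq_intros simp: field_simps)
    have "(\<beta> has_real_derivative (m / 2 * (A' / A r) - A' - (2 * r * (4 * A r) - r\<^sup>2 * (4 * A')) / (4 * A r)\<^sup>2 + sphere_mgf' k r / sphere_mgf k r)) (at r)"
      unfolding \<beta>_def[abs_def] using Apos(2)[of r] sphere_mgf_pos[of k r]
      by (auto intro!: derivative_eq_intros dA sphere_mgf_has_derivative simp: power2_eq_square field_simps)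
    \<comment> \<open>All terms with \<open>A'\<close> cancel because \<open>A r\<close> is
      critical, as in the envelope theorem.\<close>
    moreover have "m / 2 * (A' / A r) - A' - (2 * r * (4 * A r) - r\<^sup>2 * (4 * A')) / (4 * A r)\<^sup>2 = - (r / (2 * A r))"
    proof -
      have "m / 2 * (A' / A r) - A' - (2 * r * (4 * A r) - r\<^sup>2 * (4 * A')) / (4 * A r)\<^sup>2 =
        A' * ((m * A r / 2 + r\<^sup>2 / 4) - (A r)\<^sup>2) / (A r)\<^sup>2 - r / (2 * A r)"
        using Apos(2)[of r] by (simp add: power2_eq_square field_simps)
      then show ?thesis by (simp add: A2[symmetric])
    qed
    ultimately have "(\<beta> has_real_derivative (sphere_mgf' k r / sphere_mgf k r - r / (2 * A r))) (at r)" by simp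
    moreover have "sphere_mgf' k r / sphere_mgf k r - r / (2 * A r) \<le> 0"
      using sphere_mgf_ratio_le[OF r(1) m Apos(2) A2] by simp
    ultimately show "\<exists>y. (\<beta> has_real_derivative y) (at r) \<and> y \<le> 0" by blast
  qed
  moreover have "\<beta> 0 = m / 2 * ln (m / 2) - m / 2 + ln (sphere_mgf k 0)"
    proof -
    have A0: "A 0 = m / 2" using m(2) by (simp add: A_def)
    show ?thesis unfolding \<beta>_def A0 by simp
  qed
  moreover have "m / 2 * ln B - B - \<rho>\<^sup>2 / (4 * B) \<le> m / 2 * ln (A \<rho>) - A \<rho> - \<rho>\<^sup>2 / (4 * A \<rho>)"
  proof -
    let ?A = "A \<rho>"
    \<comment> \<open>With \<open>B\<close> measured in units of the optimum \<open>?A\<close>, the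
      defect splits into \<open>m / 2\<close> times \<open>ln x - (x - 1)\<close> and
      \<open>m / 2 - ?A\<close> times \<open>x + 1 / x - 2\<close>, both nonpositive.\<close>
    define x where "x = B / ?A"
    have x: "0 < x" "B = x * ?A" using Apos(2)[of \<rho>] \<open>0 < B\<close> by (auto simp: x_def)
    have c: "\<rho>\<^sup>2 / 4 = ?A * (?A - m / 2)" using A2[of \<rho>] by (simp add: power2_eq_square algebra_simps)
    have "\<rho>\<^sup>2 / (4 * B) = (\<rho>\<^sup>2 / 4) / B" by simp
    then have 1: "\<rho>\<^sup>2 / (4 * B) = (?A - m / 2) * (1 / x)" unfolding c x(2) using Apos(2)[of \<rho>] x(1) by (simp add: field_simps)
    have "\<rho>\<^sup>2 / (4 * ?A) = (\<rho>\<^sup>2 / 4) / ?A" by simp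
    then have 2: "\<rho>\<^sup>2 / (4 * ?A) = ?A - m / 2" unfolding c using Apos(2)[of \<rho>] by simp
    have lnB: "ln B = ln x + ln ?A" unfolding x(2) using x(1) Apos(2)[of \<rho>] by (simp add: ln_mult)
    have "x + 1 / x - 2 = (x - 1)\<^sup>2 / x" using x(1) by (simp add: power2_eq_square field_simps)
    then have nn: "0 \<le> x + 1 / x - 2" using x(1) by simp
    have i1: "m / 2 * (x + 1 / x - 2) \<le> ?A * (x + 1 / x - 2)"
      using Apos(1)[of \<rho>] nn by (intro mult_right_mono) auto
    have i2: "m / 2 * ln x \<le> m / 2 * (x - 1)"
      using ln_le_minus_one[OF x(1)] m(2) by (intro mult_left_mono) auto
    have id: "m / 2 * l - a * (x - 1) - (a - m / 2) * (w - 1)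
        = m / 2 * l - m / 2 * (x - 1) + (m / 2 * (x + w - 2) - a * (x + w - 2))" for l a w
      by (simp add: field_simps)
    have "m / 2 * ln x - ?A * (x - 1) - (?A - m / 2) * (1 / x - 1) \<le> 0"
      unfolding id using i1 i2 by linarith
    moreover have "m / 2 * (l + l') - x * a - (a - m / 2) * w - (m / 2 * l' - a - (a - m / 2))
        = m / 2 * l - a * (x - 1) - (a - m / 2) * (w - 1)" for l l' a w
      by (simp add: field_simps)
    note this[of "ln x" "ln ?A" ?A "1 / x"]
    ultimately show ?thesis unfolding 1 2 lnB unfolding x(2) by linarith
  qed
  ultimately show ?thesis by (simp add: \<beta>_def)
qed


section \<open>Gaussian integrals over the sphere\<close>

context split_coordinates
begin

text \<open>On unit vectors \<open>(norm (x - z))\<^sup>2\<close> is affine in \<open>x\<close>, and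
  a rotation of \<open>z\<close> onto the axis \<open>i0\<close> reduces the integral to an
  exponential moment of one coordinate.\<close>

lemma F_functional_sphere:
  assumes "0 < t"
  shows "F_functional TYPE('k) z t (sphere (0::real^'n) 1) =
    ennreal ((4 * pi * t) powr (- (real CARD('k) / 2)) * (exp (- ((1 + (norm z)\<^sup>2) / (4 * t))) * sphere_mgf i0 (norm z / (2 * t))))"
proof -
  let ?S = "sphere_measure :: (real^'n) measure"
  have nz: "norm z = norm (norm z *\<^sub>R axis i0 (1::real))" by (simp add: norm_axis_1)
  obtain Q :: "real^'n \<Rightarrow> real^'n" where Q: "orthogonal_transformation Q" "Q z = norm z *\<^sub>R axis i0 1"
    using orthogonal_transformation_exists[OF nz] by blast
  have bl: "bounded_linear Q" using Q by (simp add: orthogonal_transformation_linear linear_conv_bounded_linear[symmetric])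
  have "x \<bullet> z = norm z * (Q x $ i0)" for x
  proof -
    have "x \<bullet> z = Q x \<bullet> Q z" using Q(1) by (simp add: orthogonal_transformation_def)
    then show ?thesis by (simp add: Q(2) inner_axis)
  qed
  then have "(\<integral>x. exp (x \<bullet> z / (2 * t)) \<partial>?S) = (\<integral>x. exp (norm z / (2 * t) * (Q x $ i0)) \<partial>?S)"
    by simp
  also have "\<dots> = (\<integral>x. exp (norm z / (2 * t) * (x $ i0)) \<partial>distr ?S borel Q)"
  proof (rule integral_distr[symmetric])
    show "Q \<in> ?S \<rightarrow>\<^sub>M borel" using borel_measurable_continuous_onI[OF linear_continuous_on[OF bl]] by simp
    show "(\<lambda>x::real^'n. exp (norm z / (2 * t) * (x $ i0))) \<in> borel_measurable borel"
      by (intro borel_measurable_continuous_onI continuous_intros)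
  qed
  also have "\<dots> = sphere_mgf i0 (norm z / (2 * t))"
    by (simp add: distr_sphere_measure_orthogonal[OF Q(1)] sphere_mgf_def)
  finally have I: "(\<integral>x. exp (x \<bullet> z / (2 * t)) \<partial>?S) = sphere_mgf i0 (norm z / (2 * t))" .
  have int: "integrable ?S (\<lambda>x. exp (- ((1 + (norm z)\<^sup>2) / (4 * t))) * exp (x \<bullet> z / (2 * t)))"
    using assms by (intro integrable_sphere_measure continuous_intros) auto
  have "(\<integral>\<^sup>+ x \<in> sphere 0 1. ennreal (exp (- ((norm (x - z))\<^sup>2 / (4 * t)))) \<partial>?S) =
    (\<integral>\<^sup>+ x. ennreal (exp (- ((1 + (norm z)\<^sup>2) / (4 * t))) * exp (x \<bullet> z / (2 * t))) \<partial>?S)"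
  proof (rule nn_integral_cong_AE)
    show "AE x in ?S. ennreal (exp (- ((norm (x - z))\<^sup>2 / (4 * t)))) * indicator (sphere 0 1) x =
      ennreal (exp (- ((1 + (norm z)\<^sup>2) / (4 * t))) * exp (x \<bullet> z / (2 * t)))"
      using AE_sphere_measure
    proof eventually_elim
      case (elim x)
      have "(norm (x - z))\<^sup>2 = 1 + (norm z)\<^sup>2 - 2 * (x \<bullet> z)"
        using elim by (simp add: power2_norm_eq_inner inner_diff_left inner_diff_right inner_commute norm_eq_1)
      then have "- ((norm (x - z))\<^sup>2 / (4 * t)) = - ((1 + (norm z)\<^sup>2) / (4 * t)) + x \<bullet> z / (2 * t)"
        using assms by (simp add: field_simps)
      then have "exp (- ((norm (x - z))\<^sup>2 / (4 * t))) = exp (- ((1 + (norm z)\<^sup>2) / (4 * t))) * exp (x \<bullet> z / (2 * t))"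
        by (simp only: exp_add)
      then show ?case using elim by simp
    qed
  qed
  also have "\<dots> = ennreal (\<integral>x. exp (- ((1 + (norm z)\<^sup>2) / (4 * t))) * exp (x \<bullet> z / (2 * t)) \<partial>?S)"
    by (rule nn_integral_eq_integral[OF int]) simp
  also have "\<dots> = ennreal (exp (- ((1 + (norm z)\<^sup>2) / (4 * t))) * sphere_mgf i0 (norm z / (2 * t)))"
    by (simp add: I)
  finally show ?thesis
    unfolding F_functional_def area_measure_sphere
    using assms by (simp add: ennreal_mult'[symmetric])
qed

lemma entropy_sphere:
  "entropy TYPE('k) (sphere (0::real^'n) 1) =
    ennreal (real CARD('n) * measure lborel (ball (0::real^'n) 1) * (real CARD('k) / (2 * pi * exp 1)) powr (real CARD('k) / 2))"
    (is "_ = ennreal ?L")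
proof (rule antisym)
  define m where "m = real CARD('k)"
  have m: "m = real CARD('n) - 1" "0 < m" by (simp_all add: m_def card_n)
  have I0: "0 < sphere_mgf i0 0" by (rule sphere_mgf_pos)
  have L: "?L = exp (- (m / 2) * ln pi + (m / 2 * ln (m / 2) - m / 2 + ln (sphere_mgf i0 0)))"
  proof -
    have "(m / (2 * pi * exp 1)) powr (m / 2) = exp (m / 2 * ln (m / 2) - (m / 2) * ln pi - m / 2)"
      using m(2) by (simp add: powr_def ln_div ln_mult algebra_simps)
    then have "?L = sphere_mgf i0 0 * exp (m / 2 * ln (m / 2) - (m / 2) * ln pi - m / 2)"
      by (simp add: sphere_mgf_0 m_def)
    also have "\<dots> = exp (ln (sphere_mgf i0 0)) * exp (m / 2 * ln (m / 2) - (m / 2) * ln pi - m / 2)" using I0 by simp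
    finally show ?thesis by (simp add: exp_add[symmetric] algebra_simps)
  qed
  have F: "(4 * pi * t) powr (- (m / 2)) * (exp (- ((1 + (norm z)\<^sup>2) / (4 * t))) * sphere_mgf i0 (norm z / (2 * t))) =
     exp (- (m / 2) * ln pi + (m / 2 * ln (1 / (4 * t)) - 1 / (4 * t) - (norm z / (2 * t))\<^sup>2 / (4 * (1 / (4 * t))) + ln (sphere_mgf i0 (norm z / (2 * t)))))"
    if "0 < t" for t and z :: "real^'n"
  proof -
    have 1: "(4 * pi * t) powr (- (m / 2)) = exp (- (m / 2) * ln pi + m / 2 * ln (1 / (4 * t)))"
      using that by (simp add: powr_def ln_mult ln_div algebra_simps)
    have 2: "- ((1 + (norm z)\<^sup>2) / (4 * t)) = - 1 / (4 * t) - (norm z / (2 * t))\<^sup>2 / (4 * (1 / (4 * t)))"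
      using that by (simp add: power2_eq_square field_simps)
    have 3: "sphere_mgf i0 (norm z / (2 * t)) = exp (ln (sphere_mgf i0 (norm z / (2 * t))))"
      by (simp add: sphere_mgf_pos)
    show ?thesis unfolding 1 2 by (subst 3) (simp add: exp_add[symmetric] algebra_simps)
  qed
  show "entropy TYPE('k) (sphere (0::real^'n) 1) \<le> ennreal ?L"
    unfolding entropy_def
  proof (intro SUP_least)
    fix z :: "real^'n" and t :: real assume "t \<in> {0<..}"
    then have t: "0 < t" by simp
    show "F_functional TYPE('k) z t (sphere (0::real^'n) 1) \<le> ennreal ?L"
      unfolding F_functional_sphere[OF t] L unfolding m_def[symmetric] F[OF t]
      using sphere_mgf_bound[OF _ m, of "norm z / (2 * t)" "1 / (4 * t)" i0] t
      by (intro ennreal_leI) simp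
  qed
  \<comment> \<open>At \<open>z = 0\<close> this scale gives \<open>1 / (4 * t) = m / 2\<close>, the
    optimum; it is the scale for which the unit sphere is a self-shrinker.\<close>
  have t: "0 < 1 / (2 * m)" using m(2) by simp
  have "F_functional TYPE('k) 0 (1 / (2 * m)) (sphere (0::real^'n) 1) = ennreal ?L"
    unfolding F_functional_sphere[OF t] L unfolding m_def[symmetric] F[OF t] by simp
  then show "ennreal ?L \<le> entropy TYPE('k) (sphere (0::real^'n) 1)"
    unfolding entropy_def using t by (intro SUP_upper2[of 0] SUP_upper2[of "1 / (2 * m)"]) auto
qed

end

section \<open>The profile of the bowl soliton\<close>

locale bowl =
  fixes f :: "real^'n::finite \<Rightarrow> real"
  assumes bowl: "bowl_function f" and card_ge_2: "2 \<le> CARD('n)"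
begin

definition e :: "real^'n" where "e = axis undefined 1"
text \<open>The profile along a whole line through the origin, spanned by an arbitrary coordinate
  axis. Negative arguments are included, so differentiation at 0 is two-sided and convexity holds on
  all of the reals.\<close>

definition G :: "real \<Rightarrow> real" where "G r = f (r *\<^sub>R e)"
definition g :: "real \<Rightarrow> real" where "g r = grad f (r *\<^sub>R e) \<bullet> e"
definition g' :: "real \<Rightarrow> real" where "g' r = frechet_derivative (grad f) (at (r *\<^sub>R e)) e \<bullet> e"
definition m :: real where "m = real CARD('n) - 1"

lemma m: "1 \<le> m" "0 < m" "real CARD('n) = m + 1"
  using card_ge_2 by (auto simp: m_def)

lemma norm_e [simp]: "norm e = 1" by (simp add: e_def norm_axis_1)
lemma e_nonzero [simp]: "e \<noteq> 0" using norm_e by force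

lemma bowl_facts: "C2_function f" "\<And>x y. norm x = norm y \<Longrightarrow> f x = f y" "convex_on UNIV f"
  "\<And>x. divergence (\<lambda>y. grad f y /\<^sub>R sqrt (1 + (norm (grad f y))\<^sup>2)) x = 1 / sqrt (1 + (norm (grad f x))\<^sup>2)"
  "f 0 = 0" "grad f 0 = 0"
  using bowl unfolding bowl_function_def by blast+

lemma f_differentiable: "f differentiable (at x)"
  and grad_differentiable: "grad f differentiable (at x)"
  and continuous_hessian: "continuous_on UNIV (\<lambda>x. frechet_derivative (grad f) (at x) v)"
  using bowl_facts(1) unfolding C2_function_def differentiable_on_def by auto

lemma has_derivative_hessian: "(grad f has_derivative frechet_derivative (grad f) (at x)) (at x)"
  using grad_differentiable by (simp add: frechet_derivative_works)

lemma continuous_grad: "continuous_on UNIV (grad f)"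
  by (simp add: continuous_on_eq_continuous_at differentiable_imp_continuous_within[OF grad_differentiable])

lemma f_radial: "f x = G (norm x)"
  unfolding G_def by (rule bowl_facts(2)) simp

section \<open>Regularity and convexity of the profile\<close>

lemma G_has_derivative: "(G has_real_derivative g r) (at r)"
proof -
  have "((\<lambda>r. r *\<^sub>R e) has_derivative (\<lambda>h. h *\<^sub>R e)) (at r)"
    by (auto intro!: derivative_eq_intros)
  from has_derivative_compose[OF this has_derivative_grad[OF f_differentiable]]
  have "(G has_derivative (\<lambda>h. grad f (r *\<^sub>R e) \<bullet> (h *\<^sub>R e))) (at r)"
    by (simp add: G_def[abs_def])
  then show ?thesis unfolding has_field_derivative_def
    by (rule has_derivative_eq_rhs) (simp add: fun_eq_iff g_def)
qed

lemma g_has_derivative: "(g has_real_derivative g' r) (at r)"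
proof -
  have lin: "linear (frechet_derivative (grad f) (at (r *\<^sub>R e)))"
    using grad_differentiable by (rule linear_frechet_derivative)
  have "((\<lambda>r. r *\<^sub>R e) has_derivative (\<lambda>h. h *\<^sub>R e)) (at r)"
    by (auto intro!: derivative_eq_intros)
  from has_derivative_compose[OF this has_derivative_hessian]
  have "((\<lambda>r. grad f (r *\<^sub>R e)) has_derivative (\<lambda>h. frechet_derivative (grad f) (at (r *\<^sub>R e)) (h *\<^sub>R e))) (at r)" .
  then have "(g has_derivative (\<lambda>h. frechet_derivative (grad f) (at (r *\<^sub>R e)) (h *\<^sub>R e) \<bullet> e)) (at r)"
    unfolding g_def[abs_def] by (rule has_derivative_inner_left)
  then show ?thesis unfolding has_field_derivative_def
    by (rule has_derivative_eq_rhs) (simp add: fun_eq_iff g'_def linear_scale[OF lin])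
qed

lemma continuous_G: "continuous_on A G"
  by (rule continuous_at_imp_continuous_on) (simp add: DERIV_isCont[OF G_has_derivative])

lemma continuous_g: "continuous_on A g"
  by (rule continuous_at_imp_continuous_on) (simp add: DERIV_isCont[OF g_has_derivative])

lemma G_0 [simp]: "G 0 = 0" and g_0 [simp]: "g 0 = 0"
  using bowl_facts(5,6) by (simp_all add: G_def g_def)

lemma convex_G: "convex_on UNIV G"
proof (rule convex_onI)
  fix t x y :: real assume "0 < t" "t < 1"
  then have "f ((1 - t) *\<^sub>R (x *\<^sub>R e) + t *\<^sub>R (y *\<^sub>R e)) \<le> (1 - t) * f (x *\<^sub>R e) + t * f (y *\<^sub>R e)"
    by (intro convex_onD[OF bowl_facts(3)]) auto
  then show "G ((1 - t) *\<^sub>R x + t *\<^sub>R y) \<le> (1 - t) * G x + t * G y"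
    by (simp add: G_def scaleR_add_left)
qed simp

lemma g_mono: "r \<le> s \<Longrightarrow> g r \<le> g s"
proof (cases "r = s")
  case False
  assume "r \<le> s"
  then have rs: "r < s" using False by simp
  have tangent: "G x - G c \<ge> g c * (x - c)" for c x
    by (rule convex_on_imp_above_tangent[OF convex_G])
      (auto intro: has_field_derivative_at_within G_has_derivative)
  from tangent[of r s] tangent[of s r] have "g r * (s - r) \<le> g s * (s - r)" by (simp add: algebra_simps)
  then show ?thesis using rs by simp
qed simp

lemma g_nonneg: "0 \<le> r \<Longrightarrow> 0 \<le> g r"
  using g_mono[of 0 r] by simp

lemma g'_nonneg: "0 \<le> g' r"
proof -
  have "((\<lambda>y. (g y - g r) / (y - r)) \<longlongrightarrow> g' r) (at r)"
    using g_has_derivative[of r] by (simp add: has_field_derivative_iff)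
  moreover have "eventually (\<lambda>y. 0 \<le> (g y - g r) / (y - r)) (at r)"
  proof (rule always_eventually, rule allI)
    fix y show "0 \<le> (g y - g r) / (y - r)"
      using g_mono[of r y] g_mono[of y r] by (cases "r \<le> y") (auto simp: divide_simps)
  qed
  ultimately show ?thesis by (rule tendsto_lowerbound) simp
qed

lemma grad_f: "grad f x = (g (norm x) / norm x) *\<^sub>R x"
proof (cases "x = 0")
  case True
  then show ?thesis using bowl_facts(6) by simp
next
  case False
  have "(norm has_derivative (\<lambda>h. h \<bullet> sgn x)) (at x)" using False by (rule has_derivative_norm)
  from has_derivative_compose[OF this, of G "\<lambda>h. g (norm x) * h"]
  have "((\<lambda>x. G (norm x)) has_derivative (\<lambda>h. g (norm x) * (h \<bullet> sgn x))) (at x)"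
    using G_has_derivative[of "norm x"] by (simp add: has_field_derivative_def)
  then have "(f has_derivative (\<lambda>h. g (norm x) * (h \<bullet> sgn x))) (at x)"
    by (simp add: f_radial[symmetric])
  then have "(\<lambda>v. grad f x \<bullet> v) = (\<lambda>h. g (norm x) * (h \<bullet> sgn x))"
    using has_derivative_unique has_derivative_grad[OF f_differentiable] by blast
  then have "grad f x \<bullet> v = ((g (norm x) / norm x) *\<^sub>R x) \<bullet> v" for v
    by (drule_tac fun_cong[of _ _ v]) (simp add: sgn_div_norm inner_commute divide_inverse mult_ac)
  then show ?thesis by (metis inner_commute vector_eq_ldot)
qed

lemma norm_grad_f: "norm (grad f x) = g (norm x)"
  using g_nonneg[of "norm x"] by (cases "x = 0") (simp_all add: grad_f)

text \<open>\<open>D\<close> is the area density of the graph and \<open>X\<close> is minus the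
  horizontal part of the upward unit normal, so the translator equation reads
  \<open>divergence X x = 1 / D x\<close>.\<close>

definition D :: "real^'n \<Rightarrow> real" where "D x = sqrt (1 + (norm (grad f x))\<^sup>2)"
definition X :: "real^'n \<Rightarrow> real^'n" where "X x = grad f x /\<^sub>R D x"

lemma D_radial: "D x = sqrt (1 + (g (norm x))\<^sup>2)" by (simp add: D_def norm_grad_f)

lemma D_pos: "1 \<le> D x" "0 < D x" "D x \<noteq> 0" "(D x)\<^sup>2 = 1 + grad f x \<bullet> grad f x"
proof -
  show "1 \<le> D x" by (simp add: D_def)
  then show "0 < D x" "D x \<noteq> 0" by auto
  show "(D x)\<^sup>2 = 1 + grad f x \<bullet> grad f x" unfolding D_def power2_norm_eq_inner by (simp add: add_nonneg_nonneg)
qed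

abbreviation H where "H x v \<equiv> frechet_derivative (grad f) (at x) v"

lemma D_has_derivative: "(D has_derivative (\<lambda>v. grad f x \<bullet> H x v / D x)) (at x)"
proof -
  have pos: "0 < 1 + grad f x \<bullet> grad f x" by (simp add: add_pos_nonneg)
  have "((\<lambda>x. 1 + grad f x \<bullet> grad f x) has_derivative (\<lambda>v. 0 + (grad f x \<bullet> H x v + H x v \<bullet> grad f x))) (at x)"
    by (rule has_derivative_add[OF has_derivative_const has_derivative_inner[OF has_derivative_hessian has_derivative_hessian]])
  then have "((\<lambda>x. 1 + grad f x \<bullet> grad f x) has_derivative (\<lambda>v. 2 * (grad f x \<bullet> H x v))) (at x)"
    by (rule has_derivative_eq_rhs) (simp add: inner_commute[of "frechet_derivative (grad f) (at x) _"] fun_eq_iff)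
  from has_derivative_compose[OF this DERIV_real_sqrt[OF pos, unfolded has_field_derivative_def]]
  have "((\<lambda>x. sqrt (1 + grad f x \<bullet> grad f x)) has_derivative (\<lambda>v. 2 * (grad f x \<bullet> H x v) * (inverse (sqrt (1 + grad f x \<bullet> grad f x)) / 2))) (at x)"
    by (rule has_derivative_eq_rhs) (simp add: fun_eq_iff)
  then have der: "((\<lambda>x. sqrt (1 + grad f x \<bullet> grad f x)) has_derivative (\<lambda>v. grad f x \<bullet> H x v / sqrt (1 + grad f x \<bullet> grad f x))) (at x)"
  proof (rule has_derivative_eq_rhs)
    have "2 * a * (inverse q / 2) = a / q" for a q :: real unfolding divide_inverse by simp
    then show "(\<lambda>v. 2 * (grad f x \<bullet> H x v) * (inverse (sqrt (1 + grad f x \<bullet> grad f x)) / 2)) = (\<lambda>v. grad f x \<bullet> H x v / sqrt (1 + grad f x \<bullet> grad f x))"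
      by (simp only:)
  qed
  have DD: "D = (\<lambda>x. sqrt (1 + grad f x \<bullet> grad f x))"
    by (rule ext) (simp only: D_def power2_norm_eq_inner)
  show ?thesis unfolding DD by (rule der)
qed

lemma X_has_derivative: "(X has_derivative (\<lambda>v. H x v /\<^sub>R D x - (grad f x \<bullet> H x v / (D x)^3) *\<^sub>R grad f x)) (at x)"
proof -
  have "((\<lambda>x. inverse (D x)) has_derivative (\<lambda>v. - (inverse (D x) * (grad f x \<bullet> H x v / D x) * inverse (D x)))) (at x)"
    by (rule Deriv.has_derivative_inverse[OF D_pos(3) D_has_derivative])
  from has_derivative_scaleR[OF this has_derivative_hessian]
  have "(X has_derivative (\<lambda>v. inverse (D x) *\<^sub>R H x v + (- (inverse (D x) * (grad f x \<bullet> H x v / D x) * inverse (D x))) *\<^sub>R grad f x)) (at x)"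
    by (simp add: X_def[abs_def])
  then show ?thesis
    by (rule has_derivative_eq_rhs) (simp add: fun_eq_iff power3_eq_cube field_simps)
qed

lemma divergence_X: "(\<Sum>i\<in>UNIV. (H x (axis i 1) /\<^sub>R D x - (grad f x \<bullet> H x (axis i 1) / (D x)^3) *\<^sub>R grad f x) $ i) = 1 / D x"
proof -
  have "divergence X x = 1 / D x"
    using bowl_facts(4) unfolding X_def[abs_def] D_def[abs_def] .
  then show ?thesis
    unfolding divergence_def using frechet_derivative_at[OF X_has_derivative[of x], symmetric] by simp
qed

text \<open>The sine of the slope angle, which is the radial component of \<open>X\<close>.\<close>

definition s :: "real \<Rightarrow> real" where "s r = g r / sqrt (1 + (g r)\<^sup>2)"
definition s' :: "real \<Rightarrow> real" where "s' r = g' r / (sqrt (1 + (g r)\<^sup>2))^3"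

lemma sqrt_g: "0 < sqrt (1 + (g r)\<^sup>2)" "(sqrt (1 + (g r)\<^sup>2))\<^sup>2 = 1 + (g r)\<^sup>2" "1 + (g r)\<^sup>2 > 0"
proof -
  show "1 + (g r)\<^sup>2 > 0" by (simp add: add_pos_nonneg)
  then show "0 < sqrt (1 + (g r)\<^sup>2)" "(sqrt (1 + (g r)\<^sup>2))\<^sup>2 = 1 + (g r)\<^sup>2" by auto
qed

lemma s_has_derivative: "(s has_real_derivative s' r) (at r)"
proof -
  let ?q = "sqrt (1 + (g r)\<^sup>2)"
  note q = sqrt_g[of r]
  have "((\<lambda>r. sqrt (1 + (g r)\<^sup>2)) has_real_derivative (g r * g' r / ?q)) (at r)"
    using q(3) by (auto intro!: derivative_eq_intros g_has_derivative simp: field_simps)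
  from DERIV_divide[OF g_has_derivative this]
  have "(s has_real_derivative ((g' r * ?q - g r * (g r * g' r / ?q)) / (?q * ?q))) (at r)"
    using q(1) by (simp add: s_def[abs_def])
  also have "(g' r * ?q - g r * (g r * g' r / ?q)) / (?q * ?q) = g' r * (?q\<^sup>2 - (g r)\<^sup>2) / ?q^3"
    using q(1) by (simp add: power2_eq_square power3_eq_cube field_simps)
  also have "\<dots> = s' r" unfolding q(2) by (simp add: s'_def)
  finally show ?thesis .
qed

text \<open>The field \<open>X\<close> is \<open>w (norm y) *\<^sub>R y\<close> with
  \<open>w r = s r / r\<close>, and such a radial field has divergence
  \<open>CARD('n) * w r + r * w'\<close>. The outcome is the profile equation in flux form, with the
  second derivative hidden in \<open>s'\<close>.\<close>

lemma ode_s: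
  assumes "0 < r"
  shows "s' r + m * s r / r = 1 / sqrt (1 + (g r)\<^sup>2)"
proof -
  define x where "x = r *\<^sub>R e"
  have x: "norm x = r" "x \<noteq> 0" using assms by (auto simp: x_def)
  define w where "w r = s r / r" for r
  define w' where "w' = (s' r * r - s r) / (r * r)"
  have dw: "(w has_real_derivative w') (at r)"
    unfolding w_def[abs_def] w'_def using assms by (auto intro!: derivative_eq_intros s_has_derivative)
  have Xw: "X y = w (norm y) *\<^sub>R y" for y
    unfolding X_def D_radial grad_f[of y] w_def s_def by (simp add: field_simps)
  have "(norm has_derivative (\<lambda>h. h \<bullet> sgn x)) (at x)" using x(2) by (rule has_derivative_norm)
  from has_derivative_compose[OF this, of w "\<lambda>h. w' * h"]
  have "((\<lambda>x. w (norm x)) has_derivative (\<lambda>h. w' * (h \<bullet> sgn x))) (at x)"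
    using dw by (simp add: has_field_derivative_def x)
  from has_derivative_scaleR[OF this has_derivative_ident]
  have "(X has_derivative (\<lambda>h. w r *\<^sub>R h + (w' * (h \<bullet> sgn x)) *\<^sub>R x)) (at x)"
    by (simp add: Xw[abs_def] x)
  then have "frechet_derivative X (at x) = (\<lambda>h. w r *\<^sub>R h + (w' * (h \<bullet> sgn x)) *\<^sub>R x)"
    by (rule frechet_derivative_at[symmetric])
  then have "divergence X x = (\<Sum>i\<in>UNIV. w r + w' * (sgn x $ i * x $ i))"
    unfolding divergence_def by (simp add: inner_axis' mult.assoc)
  also have "\<dots> = real CARD('n) * w r + w' * (sgn x \<bullet> x)"
    by (simp add: sum.distrib sum_distrib_left inner_vec_def)
  also have "sgn x \<bullet> x = r" using x assms by (simp add: sgn_div_norm power2_norm_eq_inner[symmetric] power2_eq_square)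
  also have "real CARD('n) * w r + w' * r = s' r + m * s r / r"
    using assms by (simp add: m w_def w'_def field_simps)
  also have "divergence X x = 1 / D x"
    using bowl_facts(4) unfolding X_def[abs_def] D_def[abs_def] .
  finally show ?thesis by (simp add: D_radial x)
qed

text \<open>Convexity makes \<open>s'\<close> nonnegative. Dropping it from \<open>ode_s\<close>
  leaves the claim once the square roots cancel.\<close>

lemma g_upper: "0 \<le> r \<Longrightarrow> m * g r \<le> r"
proof (cases "r = 0")
  case False
  assume "0 \<le> r"
  then have r: "0 < r" using False by simp
  let ?q = "sqrt (1 + (g r)\<^sup>2)"
  note q = sqrt_g[of r]
  have "0 \<le> s' r" using g'_nonneg[of r] q(1) by (simp add: s'_def)
  then have "m * s r / r \<le> 1 / ?q" using ode_s[OF r] by simp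
  then show ?thesis using r q(1) by (simp add: s_def field_simps)
qed simp

text \<open>Flux through spheres: \<open>\<rho>^m * s \<rho>\<close> has derivative \<open>\<rho>^m / sqrt (1 + g\<^sup>2)\<close>, and \<open>g\<close> is monotone.\<close>

lemma g_lower:
  assumes "0 \<le> r"
  shows "r \<le> real CARD('n) * g r"
proof (cases "r = 0")
  case False
  then have r: "0 < r" using assms by simp
  define k where "k = CARD('n) - 1"
  have k: "CARD('n) = Suc k" "real k = m" "1 \<le> k" using card_ge_2 by (auto simp: k_def m_def)
  let ?q = "\<lambda>r. sqrt (1 + (g r)\<^sup>2)"
  \<comment> \<open>Flux minus the flux that a constant source
    \<open>1 / sqrt (1 + (g r)\<^sup>2)\<close> would produce. The true source at smaller radii is
    at least as large, so \<open>\<psi>\<close> does not decrease from its value 0 at the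
    origin.\<close>
  define \<psi> where "\<psi> \<rho> = \<rho> ^ k * s \<rho> - \<rho> ^ Suc k / (real (Suc k) * ?q r)" for \<rho>
  define \<psi>' where "\<psi>' \<rho> = real k * \<rho> ^ (k - 1) * s \<rho> + \<rho> ^ k * s' \<rho> - \<rho> ^ k / ?q r" for \<rho>
  have d: "(\<psi> has_real_derivative \<psi>' \<rho>) (at \<rho>)" for \<rho>
  proof -
    define c where "c = 1 / (real (Suc k) * ?q r)"
    have "((\<lambda>\<rho>. \<rho> ^ k * s \<rho> - \<rho> ^ Suc k * c) has_real_derivative
        (real k * \<rho> ^ (k - 1) * s \<rho> + \<rho> ^ k * s' \<rho> - real (Suc k) * \<rho> ^ k * c)) (at \<rho>)"
      by (auto intro!: derivative_eq_intros s_has_derivative simp del: of_nat_Suc power_Suc)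
    moreover have "real (Suc k) * \<rho> ^ k * c = \<rho> ^ k / ?q r"
      by (simp add: c_def del: of_nat_Suc)
    ultimately show ?thesis by (simp add: \<psi>_def[abs_def] \<psi>'_def c_def)
  qed
  have "\<psi> 0 \<le> \<psi> r"
  proof (rule DERIV_nonneg_imp_nondecreasing[OF assms])
    fix \<rho> assume \<rho>: "0 \<le> \<rho>" "\<rho> \<le> r"
    have "0 \<le> \<psi>' \<rho>"
    \<comment> \<open>\<open>ode_s\<close> needs a positive radius; at 0 the derivative vanishes
      because \<open>s 0 = 0\<close> and \<open>k\<close> is positive.\<close>
    proof (cases "\<rho> = 0")
      case True
      then show ?thesis using k(3) by (cases k) (simp_all add: \<psi>'_def s_def)
    next
      case False
      then have pos: "0 < \<rho>" using \<rho> by simp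
      have "\<rho> ^ k = \<rho> * \<rho> ^ (k - 1)" using k(3) by (metis power_minus_mult mult.commute less_le_trans zero_less_one)
      then have "\<psi>' \<rho> = \<rho> ^ k * (s' \<rho> + m * s \<rho> / \<rho>) - \<rho> ^ k / ?q r"
        using pos by (simp add: \<psi>'_def k(2) field_simps)
      also have "\<dots> = \<rho> ^ k * (1 / ?q \<rho> - 1 / ?q r)"
        unfolding ode_s[OF pos] by (simp add: right_diff_distrib)
      finally have eq: "\<psi>' \<rho> = \<rho> ^ k * (1 / ?q \<rho> - 1 / ?q r)" .
      have "(g \<rho>)\<^sup>2 \<le> (g r)\<^sup>2" using g_mono[OF \<rho>(2)] g_nonneg[OF \<rho>(1)] by (rule power_mono)
      then have "1 / ?q r \<le> 1 / ?q \<rho>" using sqrt_g(1)[of \<rho>] by (intro divide_left_mono) auto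
      then show ?thesis unfolding eq using pos by simp
    qed
    then show "\<exists>y. (\<psi> has_real_derivative y) (at \<rho>) \<and> 0 \<le> y" using d by blast
  qed
  moreover have "\<psi> 0 = 0" using k(3) by (simp add: \<psi>_def)
  ultimately have "r ^ Suc k / (real (Suc k) * ?q r) \<le> r ^ k * (g r / ?q r)"
    by (simp add: \<psi>_def s_def)
  then have "r ^ k * r \<le> r ^ k * (real (Suc k) * g r)"
    using sqrt_g(1)[of r] by (simp add: field_simps del: of_nat_Suc)
  then show ?thesis using r k(1) by simp
qed simp

lemma G_bounds: "0 \<le> r \<Longrightarrow> 0 \<le> G r" "0 \<le> r \<Longrightarrow> G r \<le> r\<^sup>2"
proof -
  assume r: "0 \<le> r"
  have "G 0 \<le> G r"
    by (rule DERIV_nonneg_imp_nondecreasing[OF r]) (use G_has_derivative g_nonneg in blast)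
  then show "0 \<le> G r" by simp
  have "0\<^sup>2 - G 0 \<le> r\<^sup>2 - G r"
  proof (rule DERIV_nonneg_imp_nondecreasing[OF r])
    fix x :: real assume x: "0 \<le> x" "x \<le> r"
    have "g x \<le> m * g x" using m(1) g_nonneg[OF x(1)] mult_right_mono[of 1 m "g x"] by simp
    then have "0 \<le> 2 * x - g x" using g_upper[OF x(1)] x by simp
    moreover have "((\<lambda>r. r\<^sup>2 - G r) has_real_derivative 2 * x - g x) (at x)"
      by (auto intro!: derivative_eq_intros G_has_derivative)
    ultimately show "\<exists>y. ((\<lambda>r. r\<^sup>2 - G r) has_real_derivative y) (at x) \<and> 0 \<le> y" by blast
  qed
  then show "G r \<le> r\<^sup>2" by simp
qed

lemma g_le: "0 \<le> r \<Longrightarrow> g r \<le> r"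
proof -
  assume r: "0 \<le> r"
  have "g r \<le> m * g r" using m(1) g_nonneg[OF r] mult_right_mono[of 1 m "g r"] by simp
  then show ?thesis using g_upper[OF r] by simp
qed

text \<open>Radial symmetry makes the Hessian explicit away from the origin, which is enough almost everywhere.\<close>

lemma hessian_symmetric:
  assumes "x \<noteq> 0"
  shows "u \<bullet> H x v = v \<bullet> H x u"
proof -
  define w where "w r = g r / r" for r
  define w' where "w' = (g' (norm x) * norm x - g (norm x)) / (norm x * norm x)"
  have dw: "(w has_real_derivative w') (at (norm x))"
    unfolding w_def[abs_def] w'_def using assms by (auto intro!: derivative_eq_intros g_has_derivative)
  have "(norm has_derivative (\<lambda>h. h \<bullet> sgn x)) (at x)" using assms by (rule has_derivative_norm)
  from has_derivative_compose[OF this, of w "\<lambda>h. w' * h"]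
  have "((\<lambda>x. w (norm x)) has_derivative (\<lambda>h. w' * (h \<bullet> sgn x))) (at x)"
    using dw by (simp add: has_field_derivative_def)
  from has_derivative_scaleR[OF this has_derivative_ident]
  have "(grad f has_derivative (\<lambda>h. w (norm x) *\<^sub>R h + (w' * (h \<bullet> sgn x)) *\<^sub>R x)) (at x)"
    by (simp add: grad_f[abs_def] w_def)
  then have "H x = (\<lambda>h. w (norm x) *\<^sub>R h + (w' * (h \<bullet> sgn x)) *\<^sub>R x)"
    by (rule frechet_derivative_at[symmetric])
  then show ?thesis by (simp add: inner_add_right sgn_div_norm inner_commute)
qed

end

section \<open>Radial integrals and the divergence theorem\<close>

text \<open>Half-lines form an intersection-stable generator, so it is enough to compare
  distribution functions; both are the volume of a ball as a function of its radius.\<close>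

lemma distr_norm_lborel:
  "distr lborel borel (norm :: real^'n::finite \<Rightarrow> real) =
    density lborel (\<lambda>r. ennreal (real CARD('n) * measure lborel (ball (0::real^'n) 1) * r ^ (CARD('n) - 1) * indicator {0..} r))"
    (is "?M = ?N")
proof (rule measure_eqI_generator_eq[where E = "range atMost" and A = "\<lambda>i. {..real i}" and \<Omega> = UNIV])
  define \<alpha> where "\<alpha> = measure lborel (ball (0::real^'n) 1)"
  define k where "k = CARD('n) - 1"
  have n: "CARD('n) = Suc k" by (simp add: k_def)
  have \<alpha>: "0 \<le> \<alpha>" by (simp add: \<alpha>_def)
  show "Int_stable (range (atMost :: real \<Rightarrow> _))" by (auto simp: Int_stable_def)
  show "range (atMost :: real \<Rightarrow> _) \<subseteq> Pow UNIV" by auto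
  show "sets ?M = sigma_sets UNIV (range atMost)" "sets ?N = sigma_sets UNIV (range atMost)"
    by (simp_all add: borel_eq_atMost)
  show "range (\<lambda>i. {..real i}) \<subseteq> range atMost" by auto
  show "(\<Union>i. {..real i}) = UNIV" using real_arch_simple by auto
  have M: "emeasure ?M {..r} = (if 0 \<le> r then ennreal (\<alpha> * r ^ Suc k) else 0)" for r
  proof -
    have "emeasure ?M {..r} = emeasure lborel (norm -` {..r} :: (real^'n) set)"
      by (subst emeasure_distr) auto
    also have "norm -` {..r} = (cball 0 r :: (real^'n) set)" by auto
    also have "emeasure lborel \<dots> = (if 0 \<le> r then ennreal (\<alpha> * r ^ Suc k) else 0)"
    proof (cases "0 \<le> r")
      case True
      have "emeasure lborel (cball (0::real^'n) r) = ennreal (measure lborel (cball (0::real^'n) r))"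
        using emeasure_lborel_cball_finite[of "0::real^'n" r] by (intro emeasure_eq_ennreal_measure) simp
      then show ?thesis using True
        by (simp add: \<alpha>_def content_cball content_ball n mult.commute del: power_Suc)
    qed auto
    finally show ?thesis .
  qed
  then show "emeasure ?M {..real i} \<noteq> \<infinity>" for i by simp
  fix A :: "real set" assume "A \<in> range atMost"
  then obtain r where A: "A = {..r}" by auto
  have "emeasure ?N {..r} = (\<integral>\<^sup>+x\<in>{..r}. ennreal (real CARD('n) * \<alpha> * x ^ k * indicator {0..} x) \<partial>lborel)"
    by (subst emeasure_density) (auto simp: k_def \<alpha>_def)
  also have "\<dots> = (\<integral>\<^sup>+x. ennreal (real (Suc k) * \<alpha> * x ^ k) * indicator {0..r} x \<partial>lborel)"
    by (intro nn_integral_cong) (auto simp: n split: split_indicator)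
  also have "\<dots> = (if 0 \<le> r then ennreal (\<alpha> * r ^ Suc k) else 0)"
  proof (cases "0 \<le> r")
    case True
    have "(\<integral>\<^sup>+x. ennreal (real (Suc k) * \<alpha> * x ^ k) * indicator {0..r} x \<partial>lborel) = ennreal (\<alpha> * r ^ Suc k - \<alpha> * 0 ^ Suc k)"
    proof (rule nn_integral_FTC_Icc)
      show "((\<lambda>x. \<alpha> * x ^ Suc k) has_real_derivative real (Suc k) * \<alpha> * x ^ k) (at x)" for x
        by (auto intro!: derivative_eq_intros simp del: power_Suc of_nat_Suc)
    qed (use True \<alpha> in auto)
    then show ?thesis using True by simp
  qed auto
  finally show "emeasure ?M A = emeasure ?N A" by (simp add: A M)
qed

lemma nn_integral_radial:
  assumes [measurable]: "h \<in> borel_measurable borel" and nn: "\<And>r. 0 \<le> r \<Longrightarrow> 0 \<le> h r"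
  shows "(\<integral>\<^sup>+x. ennreal (h (norm (x::real^'n::finite))) \<partial>lborel) =
    ennreal (real CARD('n) * measure lborel (ball (0::real^'n) 1)) * (\<integral>\<^sup>+r\<in>{0..}. ennreal (r ^ (CARD('n) - 1) * h r) \<partial>lborel)"
proof -
  let ?c = "real CARD('n) * measure lborel (ball (0::real^'n) 1)"
  have "(\<integral>\<^sup>+x. ennreal (h (norm (x::real^'n))) \<partial>lborel) = (\<integral>\<^sup>+r. ennreal (h r) \<partial>distr lborel borel (norm :: real^'n \<Rightarrow> real))"
    by (subst nn_integral_distr) auto
  also have "\<dots> = (\<integral>\<^sup>+r. ennreal (?c * r ^ (CARD('n) - 1) * indicator {0..} r) * ennreal (h r) \<partial>lborel)"
    unfolding distr_norm_lborel by (subst nn_integral_density) auto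
  also have "\<dots> = (\<integral>\<^sup>+r. ennreal ?c * (ennreal (r ^ (CARD('n) - 1) * h r) * indicator {0..} r) \<partial>lborel)"
    using nn by (intro nn_integral_cong) (auto split: split_indicator simp: ennreal_mult mult.assoc)
  also have "\<dots> = ennreal ?c * (\<integral>\<^sup>+r\<in>{0..}. ennreal (r ^ (CARD('n) - 1) * h r) \<partial>lborel)"
    by (rule nn_integral_cmult) measurable
  finally show ?thesis .
qed

section \<open>Integrability against Gaussians\<close>

lemma linear_le_square:
  fixes y c b :: real
  assumes "0 < c"
  shows "b * y \<le> y\<^sup>2 / (4 * c) + c * b\<^sup>2"
proof -
  have "0 \<le> (y - 2 * c * b)\<^sup>2" by simp
  then have "4 * c * (b * y) \<le> y\<^sup>2 + 4 * c * (c * b\<^sup>2)" by (simp add: power2_eq_square algebra_simps)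
  then show ?thesis using assms by (simp add: field_simps)
qed

lemma power_one_plus_le_exp:
  assumes "0 \<le> (y::real)"
  shows "(1 + y) ^ N \<le> exp (real N * y)"
proof -
  have "(1 + y) ^ N \<le> exp y ^ N" using assms exp_ge_add_one_self[of y] by (intro power_mono) auto
  then show ?thesis by (simp add: exp_of_nat_mult[symmetric] mult.commute)
qed

lemma integrable_gaussian:
  assumes "0 < c"
  shows "integrable lborel (\<lambda>x::real^'n::finite. exp (- (norm x)\<^sup>2 / c))"
proof (rule integrableI_nonneg)
  let ?k = "CARD('n) - 1"
  define C where "C = exp (c / 4 * (real ?k + 1)\<^sup>2)"
  have bound: "r ^ ?k * exp (- r\<^sup>2 / c) \<le> C * exp (- r)" if "0 \<le> r" for r :: real
  proof -
    have "r ^ ?k \<le> (1 + r) ^ ?k" using that by (intro power_mono) auto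
    also have "\<dots> \<le> exp (real ?k * r)" using that by (rule power_one_plus_le_exp)
    finally have "r ^ ?k * exp (- r\<^sup>2 / c) \<le> exp (real ?k * r) * exp (- r\<^sup>2 / c)" by (intro mult_right_mono) auto
    also have "\<dots> = exp (real ?k * r - r\<^sup>2 / c)" by (simp add: exp_add[symmetric])
    also have "\<dots> \<le> exp (c / 4 * (real ?k + 1)\<^sup>2 - r)"
      using linear_le_square[of "c / 4" "real ?k + 1" r] assms by (simp add: algebra_simps)
    also have "\<dots> = C * exp (- r)" unfolding C_def mult_exp_exp by simp
    finally show ?thesis .
  qed
  have "(\<integral>\<^sup>+x. ennreal (exp (- (norm (x::real^'n))\<^sup>2 / c)) \<partial>lborel) =
    ennreal (real CARD('n) * measure lborel (ball (0::real^'n) 1)) * (\<integral>\<^sup>+r\<in>{0..}. ennreal (r ^ ?k * exp (- r\<^sup>2 / c)) \<partial>lborel)"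
    by (rule nn_integral_radial) auto
  moreover have "(\<integral>\<^sup>+r\<in>{0..}. ennreal (r ^ ?k * exp (- r\<^sup>2 / c)) \<partial>lborel) \<le> (\<integral>\<^sup>+r\<in>{0..}. ennreal (C * exp (- r)) \<partial>lborel)"
    using bound by (intro nn_integral_mono) (auto split: split_indicator intro: ennreal_leI)
  moreover have "(\<integral>\<^sup>+r\<in>{0..}. ennreal (C * exp (- r)) \<partial>lborel) = ennreal (0 - (- C * exp (- 0)))"
  proof (rule nn_integral_FTC_atLeast)
    show "((\<lambda>r. - C * exp (- r)) has_real_derivative C * exp (- x)) (at x)" for x
      by (auto intro!: derivative_eq_intros)
    show "((\<lambda>r. - C * exp (- r)) \<longlongrightarrow> 0) at_top"
      by (rule tendsto_mult_right_zero) (rule filterlim_compose[OF exp_at_bot filterlim_uminus_at_bot_at_top])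
  qed (auto simp: C_def)
  ultimately show "(\<integral>\<^sup>+x. ennreal (exp (- (norm (x::real^'n))\<^sup>2 / c)) \<partial>lborel) < \<infinity>"
    by (auto simp: ennreal_mult_less_top intro: le_less_trans)
qed auto

text \<open>Two losses in the exponent: recentering at the origin halves the rate of the Gaussian,
  and half of the rest absorbs the polynomial through \<open>exp (N * norm x)\<close>. This is where
  \<open>4 * c\<close> comes from.\<close>

lemma integrable_gaussian_bound:
  fixes h :: "real^'n::finite \<Rightarrow> real"
  assumes h: "h \<in> borel_measurable borel" and c: "0 < c" and C: "0 \<le> C"
    and bound: "\<And>x. \<bar>h x\<bar> \<le> C * (1 + norm x) ^ N * exp (- (norm (x - a))\<^sup>2 / c)"
  shows "integrable lborel h"
proof -
  define C' where "C' = C * exp ((norm a)\<^sup>2 / c + c * (real N)\<^sup>2)"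
  have "\<bar>h x\<bar> \<le> C' * exp (- (norm x)\<^sup>2 / (4 * c))" for x
  proof -
    have "(norm x)\<^sup>2 \<le> (norm (x - a) + norm a)\<^sup>2"
      using norm_triangle_ineq[of "x - a" a] by (intro power_mono) auto
    also have "\<dots> \<le> 2 * (norm (x - a))\<^sup>2 + 2 * (norm a)\<^sup>2"
      using sum_squares_bound[of "norm (x - a)" "norm a"] by (simp add: power2_sum)
    finally have "- (norm (x - a))\<^sup>2 / c \<le> (norm a)\<^sup>2 / c - (norm x)\<^sup>2 / (2 * c)"
      using c by (simp add: field_simps)
    moreover have "real N * norm x \<le> (norm x)\<^sup>2 / (4 * c) + c * (real N)\<^sup>2" by (rule linear_le_square[OF c])
    moreover have "(norm x)\<^sup>2 / (2 * c) = (norm x)\<^sup>2 / (4 * c) + (norm x)\<^sup>2 / (4 * c)" by simp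
    ultimately have le: "real N * norm x + - (norm (x - a))\<^sup>2 / c \<le> (norm a)\<^sup>2 / c + c * (real N)\<^sup>2 + - (norm x)\<^sup>2 / (4 * c)"
      unfolding minus_divide_left[symmetric] by linarith
    have "\<bar>h x\<bar> \<le> C * (1 + norm x) ^ N * exp (- (norm (x - a))\<^sup>2 / c)" by (rule bound)
    also have "\<dots> \<le> C * exp (real N * norm x) * exp (- (norm (x - a))\<^sup>2 / c)"
      using C by (intro mult_right_mono mult_left_mono power_one_plus_le_exp) auto
    also have "\<dots> = C * exp (real N * norm x + - (norm (x - a))\<^sup>2 / c)" by (simp only: exp_add mult.assoc)
    also have "\<dots> \<le> C * exp ((norm a)\<^sup>2 / c + c * (real N)\<^sup>2 + - (norm x)\<^sup>2 / (4 * c))"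
      using le C by (intro mult_left_mono) auto
    also have "\<dots> = C' * exp (- (norm x)\<^sup>2 / (4 * c))" by (simp only: exp_add C'_def mult.assoc)
    finally show ?thesis .
  qed
  moreover have "integrable lborel (\<lambda>x::real^'n. C' * exp (- (norm x)\<^sup>2 / (4 * c)))"
    using c by (intro integrable_mult_right integrable_gaussian) auto
  ultimately show ?thesis
  proof -
    assume le: "\<And>x. \<bar>h x\<bar> \<le> C' * exp (- (norm x)\<^sup>2 / (4 * c))"
      and int: "integrable lborel (\<lambda>x::real^'n. C' * exp (- (norm x)\<^sup>2 / (4 * c)))"
    show ?thesis
    proof (rule Bochner_Integration.integrable_bound[OF int])
      show "AE x in lborel. norm (h x) \<le> norm (C' * exp (- (norm x)\<^sup>2 / (4 * c)))"
        unfolding real_norm_def by (intro always_eventually allI order_trans[OF le abs_ge_self])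
    qed (use h in simp)
  qed
qed

section \<open>Integrals of derivatives and of divergences\<close>

lemma integrable_continuous_compact_support:
  fixes h :: "real^'n::finite \<Rightarrow> real"
  assumes c: "continuous_on UNIV h" and z: "\<And>x. R < norm x \<Longrightarrow> h x = 0"
  shows "integrable lborel h"
proof -
  have "bounded (h ` cball 0 R)"
    by (intro compact_imp_bounded compact_continuous_image continuous_on_subset[OF c]) auto
  then obtain B where B: "\<And>x. norm x \<le> R \<Longrightarrow> \<bar>h x\<bar> \<le> B"
    unfolding bounded_iff by force
  have "integrable lborel (\<lambda>x::real^'n. B * indicator (cball 0 R) x)"
    using emeasure_lborel_cball_finite[of "0::real^'n" R] by (intro integrable_mult_right integrable_real_indicator) auto
  then show ?thesis
  proof (rule Bochner_Integration.integrable_bound)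
    show "h \<in> borel_measurable lborel" using borel_measurable_continuous_onI[OF c] by simp
    show "AE x in lborel. norm (h x) \<le> norm (B * indicator (cball 0 R) x)"
      using z B by (intro always_eventually) (force simp: indicator_def not_le)
  qed
qed

text \<open>By translation invariance the integral of \<open>\<Phi> (x + t *\<^sub>R u)\<close> does
  not depend on \<open>t\<close>; its derivative at 0 is the integral in question.\<close>

lemma integral_directional_derivative_eq_0:
  fixes \<Phi> :: "real^'n::finite \<Rightarrow> real"
  assumes der: "\<And>x. (\<Phi> has_derivative \<Phi>' x) (at x)" and cont: "continuous_on UNIV (\<lambda>x. \<Phi>' x u)"
    and supp: "\<And>x. R < norm x \<Longrightarrow> \<Phi> x = 0" and u: "norm u \<le> 1"
  shows "integrable lborel (\<lambda>x. \<Phi>' x u)" "(\<integral>x. \<Phi>' x u \<partial>lborel) = 0"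
proof -
  have c\<Phi>: "continuous_on UNIV \<Phi>" by (rule has_derivative_continuous_on[OF has_derivative_at_withinI[OF der]])
  have z: "\<Phi>' x u = 0" if "R < norm x" for x
  proof -
    have "(\<Phi> has_derivative (\<lambda>v. 0)) (at x)"
    proof (rule has_derivative_transform_within_open)
      show "((\<lambda>_. 0) has_derivative (\<lambda>v. 0::real)) (at x)" by (rule has_derivative_const)
      show "open {x::real^'n. R < norm x}" by (intro open_Collect_less continuous_intros)
    qed (use that supp in auto)
    then have "\<Phi>' x = (\<lambda>v. 0)" using der has_derivative_unique by blast
    then show ?thesis by simp
  qed
  show int: "integrable lborel (\<lambda>x. \<Phi>' x u)" by (rule integrable_continuous_compact_support[OF cont z])
  have "bounded ((\<lambda>x. \<Phi>' x u) ` cball 0 R)"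
    by (intro compact_imp_bounded compact_continuous_image continuous_on_subset[OF cont]) auto
  then obtain B0 where B0: "\<And>x. norm x \<le> R \<Longrightarrow> \<bar>\<Phi>' x u\<bar> \<le> B0" unfolding bounded_iff by force
  define B where "B = max B0 0"
  have B: "\<bar>\<Phi>' x u\<bar> \<le> B" for x using B0[of x] z[of x] by (cases "norm x \<le> R") (auto simp: B_def)
  have tr: "(\<integral>x. h (x + v) \<partial>lborel) = (\<integral>x. h x \<partial>lborel)" "integrable lborel h \<Longrightarrow> integrable lborel (\<lambda>x. h (x + v))"
    if "h \<in> borel_measurable borel" for h :: "real^'n \<Rightarrow> real" and v
  proof -
    have "(\<integral>x. h x \<partial>lborel) = (\<integral>x. h x \<partial>distr lborel borel ((+) v))" by (simp add: lborel_distr_plus)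
    also have "\<dots> = (\<integral>x. h (v + x) \<partial>lborel)" using that by (intro integral_distr) auto
    finally show "(\<integral>x. h (x + v) \<partial>lborel) = (\<integral>x. h x \<partial>lborel)" by (simp add: add.commute)
    assume "integrable lborel h"
    then have "integrable (distr lborel borel ((+) v)) h" by (simp add: lborel_distr_plus)
    then have "integrable lborel (\<lambda>x. h (v + x))" using that by (subst (asm) integrable_distr_eq) auto
    then show "integrable lborel (\<lambda>x. h (x + v))" by (simp add: add.commute)
  qed
  have \<Phi>m: "\<Phi> \<in> borel_measurable borel" by (rule borel_measurable_continuous_onI[OF c\<Phi>])
  have int\<Phi>: "integrable lborel \<Phi>" by (rule integrable_continuous_compact_support[OF c\<Phi> supp])
  have "((\<lambda>t. \<integral>x. \<Phi> (x + t *\<^sub>R u) \<partial>lborel) has_real_derivative (\<integral>x. \<Phi>' (x + 0 *\<^sub>R u) u \<partial>lborel)) (at 0)"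
  \<comment> \<open>Translations by at most one unit keep the support inside the ball of radius
    \<open>R + 1\<close>.\<close>
  proof (rule has_real_derivative_integral[where a = "-1" and b = 1 and g = "\<lambda>x. B * indicator (cball 0 (R + 1)) x"])
    show "integrable lborel (\<lambda>x. \<Phi> (x + t *\<^sub>R u))" for t using tr(2)[OF \<Phi>m int\<Phi>] .
    show "(\<lambda>x. \<Phi>' (x + 0 *\<^sub>R u) u) \<in> borel_measurable lborel" using int by auto
    show "integrable lborel (\<lambda>x::real^'n. B * indicator (cball 0 (R + 1)) x)"
      using emeasure_lborel_cball_finite[of "0::real^'n" "R + 1"] by (intro integrable_mult_right integrable_real_indicator) auto
    show "AE x in lborel. \<forall>t\<in>{-1<..<1}. ((\<lambda>s. \<Phi> (x + s *\<^sub>R u)) has_real_derivative \<Phi>' (x + t *\<^sub>R u) u) (at t) \<and>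
      \<bar>\<Phi>' (x + t *\<^sub>R u) u\<bar> \<le> B * indicator (cball 0 (R + 1)) x"
    proof (intro always_eventually allI ballI conjI)
      fix x and t :: real assume t: "t \<in> {-1<..<1}"
      have "((\<lambda>s. x + s *\<^sub>R u) has_derivative (\<lambda>h. h *\<^sub>R u)) (at t)" by (auto intro!: derivative_eq_intros)
      from has_derivative_compose[OF this der]
      have "((\<lambda>s. \<Phi> (x + s *\<^sub>R u)) has_derivative (\<lambda>h. \<Phi>' (x + t *\<^sub>R u) (h *\<^sub>R u))) (at t)" .
      then show "((\<lambda>s. \<Phi> (x + s *\<^sub>R u)) has_real_derivative \<Phi>' (x + t *\<^sub>R u) u) (at t)"
        unfolding has_field_derivative_def
        by (rule has_derivative_eq_rhs) (simp add: fun_eq_iff linear_scale[OF has_derivative_linear[OF der]])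
      show "\<bar>\<Phi>' (x + t *\<^sub>R u) u\<bar> \<le> B * indicator (cball 0 (R + 1)) x"
      proof (cases "norm x \<le> R + 1")
        case True
        then show ?thesis using B by simp
      next
        case False
        have "norm x \<le> norm (x + t *\<^sub>R u) + norm (t *\<^sub>R u)" using norm_triangle_ineq4[of "x + t *\<^sub>R u" "t *\<^sub>R u"] by simp
        also have "norm (t *\<^sub>R u) \<le> 1 * 1" unfolding norm_scaleR using t u by (intro mult_mono) auto
        finally have "R < norm (x + t *\<^sub>R u)" using False by simp
        then show ?thesis using z False by simp
      qed
    qed
  qed auto
  then have "((\<lambda>t::real. \<integral>x. \<Phi> x \<partial>lborel) has_real_derivative (\<integral>x. \<Phi>' x u \<partial>lborel)) (at 0)"
    by (simp add: tr(1)[OF \<Phi>m])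
  moreover have "((\<lambda>t::real. \<integral>x. \<Phi> x \<partial>lborel) has_real_derivative 0) (at 0)" by simp
  ultimately show "(\<integral>x. \<Phi>' x u \<partial>lborel) = 0" by (rule DERIV_unique)
qed

text \<open>Squaring removes the corner of the positive part, so the cutoffs built from it are
  continuously differentiable.\<close>

lemma positive_part_square_has_derivative: "((\<lambda>u::real. (max 0 u)\<^sup>2) has_real_derivative 2 * max 0 u) (at u)"
proof (cases u "0::real" rule: linorder_cases)
  case less
  have "((\<lambda>u::real. 0) has_real_derivative 0) (at u)" by simp
  then have "((\<lambda>u::real. (max 0 u)\<^sup>2) has_real_derivative 0) (at u)"
    by (rule DERIV_cong_ev[THEN iffD1, rotated 3])
      (use less eventually_nhds_in_open[of "{..<0}" u] in \<open>auto elim!: eventually_mono\<close>)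
  then show ?thesis using less by simp
next
  case greater
  have "((\<lambda>u::real. u\<^sup>2) has_real_derivative 2 * u) (at u)" by (auto intro!: derivative_eq_intros)
  then have "((\<lambda>u::real. (max 0 u)\<^sup>2) has_real_derivative 2 * u) (at u)"
    by (rule DERIV_cong_ev[THEN iffD1, rotated 3])
      (use greater eventually_nhds_in_open[of "{0<..}" u] in \<open>auto elim!: eventually_mono\<close>)
  then show ?thesis using greater by simp
next
  case equal
  have "((\<lambda>h::real. ((max 0 h)\<^sup>2 - 0) / h) \<longlongrightarrow> 0) (at 0)"
  proof (rule Lim_null_comparison)
    show "\<forall>\<^sub>F h in at 0. norm (((max 0 h)\<^sup>2 - 0) / h) \<le> \<bar>h::real\<bar>"
      by (intro always_eventually allI) (auto simp: max_def power2_eq_square)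
    show "((\<lambda>h::real. \<bar>h\<bar>) \<longlongrightarrow> 0) (at 0)" by (rule tendsto_rabs_zero) (rule tendsto_ident_at)
  qed
  then show ?thesis using equal by (simp add: has_field_derivative_iff)
qed

text \<open>Cutoffs reduce the claim to compact support. The term in which the derivative falls on
  the cutoff is at most \<open>4 / Suc k\<close> times \<open>norm (V x)\<close>, and integrability
  of \<open>V\<close> makes it vanish in the limit.\<close>

lemma integral_divergence_eq_0:
  fixes V :: "real^'n::finite \<Rightarrow> real^'n"
  assumes der: "\<And>x. (V has_derivative V' x) (at x)"
    and cont: "\<And>i. continuous_on UNIV (\<lambda>x. V' x (axis i 1))"
    and intV: "integrable lborel (\<lambda>x. norm (V x))"
    and intd: "integrable lborel (\<lambda>x. \<Sum>i\<in>UNIV. V' x (axis i 1) $ i)"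
  shows "(\<integral>x. (\<Sum>i\<in>UNIV. V' x (axis i 1) $ i) \<partial>lborel) = 0"
proof -
  define dv where "dv x = (\<Sum>i\<in>UNIV. V' x (axis i 1) $ i)" for x
  \<comment> \<open>A function of \<open>x \<bullet> x\<close>, hence differentiable at the origin
    as well. \<open>Suc k\<close> keeps the radius positive.\<close>
  define \<eta> where "\<eta> k x = (max 0 (1 - (x \<bullet> x) / (real (Suc k))\<^sup>2))\<^sup>2" for k and x :: "real^'n"
  define \<eta>' where "\<eta>' k x v = 2 * max 0 (1 - (x \<bullet> x) / (real (Suc k))\<^sup>2) * (- (2 * (x \<bullet> v) / (real (Suc k))\<^sup>2))" for k and x v :: "real^'n"
  have d\<eta>: "(\<eta> k has_derivative \<eta>' k x) (at x)" for k x
  proof -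
    have "((\<lambda>x::real^'n. 1 - (x \<bullet> x) / (real (Suc k))\<^sup>2) has_derivative (\<lambda>v. - (2 * (x \<bullet> v) / (real (Suc k))\<^sup>2))) (at x)"
    proof -
      have "((\<lambda>x::real^'n. 1 - (x \<bullet> x) * c) has_derivative (\<lambda>v. - (2 * (x \<bullet> v) * c))) (at x)" for c
        by (auto intro!: derivative_eq_intros simp: inner_commute)
      then show ?thesis unfolding divide_inverse .
    qed
    from has_derivative_compose[OF this positive_part_square_has_derivative[unfolded has_field_derivative_def]]
    show ?thesis by (simp add: \<eta>_def[abs_def] \<eta>'_def[abs_def])
  qed
  have c\<eta>: "continuous_on UNIV (\<eta> k)" "continuous_on UNIV (\<lambda>x. \<eta>' k x v)" for k v
    unfolding \<eta>_def \<eta>'_def by (intro continuous_intros; simp)+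
  have cV: "continuous_on UNIV V" by (rule has_derivative_continuous_on[OF has_derivative_at_withinI[OF der]])
  have \<eta>01: "0 \<le> \<eta> k x" "\<eta> k x \<le> 1" for k x
    unfolding \<eta>_def by (auto intro!: power_le_one)
  have zero: "(\<integral>x. (\<eta> k x * dv x + \<eta>' k x (V x)) \<partial>lborel) = 0" for k
  proof -
    define P where "P i x = \<eta> k x * V' x (axis i 1) $ i + \<eta>' k x (axis i 1) * V x $ i" for i x
    have P: "integrable lborel (P i)" "(\<integral>x. P i x \<partial>lborel) = 0" for i
    proof -
      have 1: "((\<lambda>x. \<eta> k x * V x $ i) has_derivative (\<lambda>v. \<eta> k x * V' x v $ i + \<eta>' k x v * V x $ i)) (at x)" for x
        by (rule has_derivative_mult[OF d\<eta> bounded_linear.has_derivative[OF bounded_linear_vec_nth der]])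
      have 2: "continuous_on UNIV (\<lambda>x. \<eta> k x * V' x (axis i 1) $ i + \<eta>' k x (axis i 1) * V x $ i)"
        by (intro continuous_intros c\<eta> cV cont)
      have 3: "\<eta> k x * V x $ i = 0" if "real (Suc k) < norm x" for x
      proof -
        have "(real (Suc k))\<^sup>2 < (norm x)\<^sup>2" using that by (intro power_strict_mono) auto
        then have "1 - (x \<bullet> x) / (real (Suc k))\<^sup>2 \<le> 0" using that by (simp add: power2_norm_eq_inner[symmetric] divide_simps)
        then show ?thesis by (simp add: \<eta>_def)
      qed
      show "integrable lborel (P i)" "(\<integral>x. P i x \<partial>lborel) = 0"
        using integral_directional_derivative_eq_0[OF 1 2 3] unfolding P_def[abs_def] by (auto simp: norm_axis_1)
    qed
    have "(\<Sum>i\<in>UNIV. P i x) = \<eta> k x * dv x + \<eta>' k x (V x)" for x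
    proof -
      have "(\<Sum>i\<in>UNIV. \<eta>' k x (axis i 1) * V x $ i) = \<eta>' k x (V x)"
      proof -
        define c where "c = - 4 * max 0 (1 - (x \<bullet> x) / (real (Suc k))\<^sup>2) / (real (Suc k))\<^sup>2"
        have c: "\<eta>' k x v = c * (x \<bullet> v)" for v by (simp add: \<eta>'_def c_def)
        have "(\<Sum>i\<in>UNIV. \<eta>' k x (axis i 1) * V x $ i) = c * (\<Sum>i\<in>UNIV. x $ i * V x $ i)"
          unfolding c by (simp add: inner_axis sum_distrib_left mult.assoc)
        then show ?thesis by (simp add: c inner_vec_def)
      qed
      then show ?thesis by (simp add: P_def sum.distrib sum_distrib_left dv_def)
    qed
    moreover have "(\<integral>x. (\<Sum>i\<in>UNIV. P i x) \<partial>lborel) = 0" using P by simp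
    ultimately show ?thesis by simp
  qed
  have dvm: "dv \<in> borel_measurable borel" using intd by (auto simp: dv_def[abs_def])
  have \<eta>'b: "\<bar>\<eta>' k x (V x)\<bar> \<le> 4 / real (Suc k) * norm (V x)" for k x
  proof (cases "norm x \<le> real (Suc k)")
    case True
    let ?M = "max 0 (1 - (x \<bullet> x) / (real (Suc k))\<^sup>2)"
    have M: "0 \<le> ?M" "?M \<le> 1" by auto
    have "\<bar>x \<bullet> V x\<bar> \<le> norm x * norm (V x)" by (rule Cauchy_Schwarz_ineq2)
    also have "\<dots> \<le> real (Suc k) * norm (V x)" using True by (intro mult_right_mono) auto
    finally have xv: "\<bar>x \<bullet> V x\<bar> \<le> real (Suc k) * norm (V x)" .
    have "\<bar>\<eta>' k x (V x)\<bar> = ?M * (4 * \<bar>x \<bullet> V x\<bar> / (real (Suc k))\<^sup>2)"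
      using M(1) by (simp add: \<eta>'_def abs_mult del: of_nat_Suc)
    also have "\<dots> \<le> 1 * (4 * (real (Suc k) * norm (V x)) / (real (Suc k))\<^sup>2)"
      using M xv by (intro mult_mono divide_right_mono) auto
    also have "\<dots> = 4 / real (Suc k) * norm (V x)" by (simp add: power2_eq_square del: of_nat_Suc)
    finally show ?thesis .
  next
    case False
    then have "(real (Suc k))\<^sup>2 < (norm x)\<^sup>2" by (intro power_strict_mono) auto
    then have "1 - (x \<bullet> x) / (real (Suc k))\<^sup>2 \<le> 0" using False by (simp add: power2_norm_eq_inner[symmetric] divide_simps)
    then have "\<eta>' k x (V x) = 0" by (simp add: \<eta>'_def)
    then show ?thesis by simp
  qed
  have "(\<lambda>k. \<integral>x. (\<eta> k x * dv x + \<eta>' k x (V x)) \<partial>lborel) \<longlonglongrightarrow> (\<integral>x. dv x \<partial>lborel)"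
  proof (rule integral_dominated_convergence[where w = "\<lambda>x. \<bar>dv x\<bar> + 4 * norm (V x)"])
    show "dv \<in> borel_measurable lborel" using dvm by simp
    have "(\<lambda>x. \<eta>' k x (V x)) \<in> borel_measurable borel" for k
      unfolding \<eta>'_def by (intro borel_measurable_continuous_onI continuous_intros cV) auto
    then show "(\<lambda>x. \<eta> k x * dv x + \<eta>' k x (V x)) \<in> borel_measurable lborel" for k
      using dvm borel_measurable_continuous_onI[OF c\<eta>(1)] by simp
    show "integrable lborel (\<lambda>x. \<bar>dv x\<bar> + 4 * norm (V x))"
      using intd intV by (auto simp: dv_def)
    show "AE x in lborel. norm (\<eta> k x * dv x + \<eta>' k x (V x)) \<le> \<bar>dv x\<bar> + 4 * norm (V x)" for k
    proof (intro always_eventually allI)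
      fix x :: "real^'n"
      have "\<bar>\<eta> k x * dv x\<bar> \<le> 1 * \<bar>dv x\<bar>" unfolding abs_mult using \<eta>01[of k x] by (intro mult_right_mono) auto
      moreover have "\<bar>\<eta>' k x (V x)\<bar> \<le> 4 * norm (V x)"
        by (rule order_trans[OF \<eta>'b]) (intro mult_right_mono, auto simp: divide_simps)
      ultimately show "norm (\<eta> k x * dv x + \<eta>' k x (V x)) \<le> \<bar>dv x\<bar> + 4 * norm (V x)"
        using abs_triangle_ineq[of "\<eta> k x * dv x" "\<eta>' k x (V x)"] by simp
    qed
    show "AE x in lborel. (\<lambda>k. \<eta> k x * dv x + \<eta>' k x (V x)) \<longlonglongrightarrow> dv x"
    proof (intro always_eventually allI)
      fix x :: "real^'n"
      have inv: "(\<lambda>k. inverse (real (Suc k))) \<longlonglongrightarrow> 0" by (rule LIMSEQ_inverse_real_of_nat)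
      have "(\<lambda>k. (max 0 (1 - (x \<bullet> x) * (inverse (real (Suc k)))\<^sup>2))\<^sup>2) \<longlonglongrightarrow> (max 0 (1 - (x \<bullet> x) * 0\<^sup>2))\<^sup>2"
        by (intro tendsto_intros inv)
      then have "(\<lambda>k. \<eta> k x) \<longlonglongrightarrow> 1" by (simp add: \<eta>_def divide_inverse power_inverse)
      moreover have "(\<lambda>k. \<eta>' k x (V x)) \<longlonglongrightarrow> 0"
      proof (rule Lim_null_comparison)
        show "\<forall>\<^sub>F k in sequentially. norm (\<eta>' k x (V x)) \<le> 4 * inverse (real (Suc k)) * norm (V x)"
          using \<eta>'b[of _ x] by (intro always_eventually allI) (simp add: divide_inverse)
        have "(\<lambda>k. 4 * inverse (real (Suc k)) * norm (V x)) \<longlonglongrightarrow> 4 * 0 * norm (V x)"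
          by (intro tendsto_intros inv)
        then show "(\<lambda>k. 4 * inverse (real (Suc k)) * norm (V x)) \<longlonglongrightarrow> 0" by simp
      qed
      ultimately have "(\<lambda>k. \<eta> k x * dv x + \<eta>' k x (V x)) \<longlonglongrightarrow> 1 * dv x + 0" by (intro tendsto_intros)
      then show "(\<lambda>k. \<eta> k x * dv x + \<eta>' k x (V x)) \<longlonglongrightarrow> dv x" by simp
    qed
  qed
  then have "(\<lambda>k::nat. 0::real) \<longlonglongrightarrow> (\<integral>x. dv x \<partial>lborel)" by (simp add: zero)
  then show ?thesis by (simp add: dv_def LIMSEQ_const_iff)
qed

section \<open>The monotonicity identity\<close>

context bowl
begin

text \<open>
  With \<open>z = (x - a, f x - c)\<close>, unit normal \<open>\<nu> = (- grad f x, 1) / D x\<close> and vertical unit vector \<open>u\<close>, one has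
  \<open>S = D \<langle>z, \<nu>\<rangle>\<close>, and for \<open>w = 1 / (2 t)\<close> the field \<open>W\<close> is \<open>D\<close> times the horizontal part of the tangential
  projection of \<open>w z + u\<close>. \<open>E\<close> is, up to the power of \<open>4 \<pi> t\<close>, the \<open>\<tau>\<close>-derivative at 0 of the integrand of the
  \<open>F\<close>-functional at \<open>((a, c + \<tau>), t + \<tau>)\<close>, and \<open>R\<close> is the squared normal component of \<open>w z + u\<close>
  weighted by \<open>D K\<close>.
\<close>

definition S :: "real^'n \<Rightarrow> real \<Rightarrow> real^'n \<Rightarrow> real" where
  "S a c x = f x - c - (x - a) \<bullet> grad f x"

definition K :: "real^'n \<Rightarrow> real \<Rightarrow> real \<Rightarrow> real^'n \<Rightarrow> real" where
  "K a c t x = exp (- (((norm (x - a))\<^sup>2 + (f x - c)\<^sup>2) / (4 * t)))"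

definition W :: "real^'n \<Rightarrow> real \<Rightarrow> real \<Rightarrow> real^'n \<Rightarrow> real^'n" where
  "W a c w x = (w * D x) *\<^sub>R (x - a) + (w * S a c x + 1) *\<^sub>R X x"

definition E :: "real^'n \<Rightarrow> real \<Rightarrow> real \<Rightarrow> real^'n \<Rightarrow> real" where
  "E a c t x = D x * K a c t x *
     (- (real CARD('n) / (2 * t)) + ((norm (x - a))\<^sup>2 + (f x - c)\<^sup>2) / (4 * t\<^sup>2) + (f x - c) / (2 * t))"

definition R :: "real^'n \<Rightarrow> real \<Rightarrow> real \<Rightarrow> real^'n \<Rightarrow> real" where
  "R a c t x = K a c t x * (S a c x / (2 * t) + 1)\<^sup>2 / D x"

section \<open>Continuity, growth and integrability of the integrands\<close>

lemma continuous_f: "continuous_on A f"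
  by (rule continuous_at_imp_continuous_on) (simp add: differentiable_imp_continuous_within[OF f_differentiable])

lemma continuous_grad': "continuous_on A (grad f)"
  using continuous_grad by (rule continuous_on_subset) simp

lemma continuous_D: "continuous_on A D"
  unfolding D_def by (intro continuous_intros continuous_grad')

lemma continuous_X: "continuous_on A X"
  unfolding X_def by (intro continuous_intros continuous_grad' continuous_D) (simp add: D_pos)

lemma continuous_S: "continuous_on A (S a c)"
  unfolding S_def by (intro continuous_intros continuous_f continuous_grad')

lemma continuous_K: "t \<noteq> 0 \<Longrightarrow> continuous_on A (K a c t)"
  unfolding K_def by (intro continuous_intros continuous_f) auto

lemma continuous_E: "t \<noteq> 0 \<Longrightarrow> continuous_on A (E a c t)"
  unfolding E_def by (intro continuous_intros continuous_D continuous_K continuous_f) auto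

lemma continuous_R: "t \<noteq> 0 \<Longrightarrow> continuous_on A (R a c t)"
  unfolding R_def by (intro continuous_intros continuous_D continuous_K continuous_S) (auto simp: D_pos)

lemma continuous_W: "continuous_on A (W a c w)"
  unfolding W_def by (intro continuous_intros continuous_D continuous_S continuous_X)

lemma D_le: "D x \<le> 1 + norm x"
proof -
  have "D x \<le> 1 + g (norm x)"
    unfolding D_radial using g_nonneg[of "norm x"]
    by (intro real_le_lsqrt) (auto simp: power2_sum)
  then show ?thesis using g_le[of "norm x"] by simp
qed

lemma norm_grad_le: "norm (grad f x) \<le> norm x"
  using g_le[of "norm x"] by (simp add: norm_grad_f)

lemma norm_X_le: "norm (X x) \<le> 1"
proof -
  have "norm (grad f x) \<le> D x" unfolding D_def by (rule real_le_rsqrt) simp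
  then show ?thesis using D_pos[of x] by (simp add: X_def field_simps)
qed

lemma f_bounds: "0 \<le> f x" "f x \<le> (norm x)\<^sup>2"
  using G_bounds[of "norm x"] by (simp_all add: f_radial)

text \<open>The constants depend on a bound \<open>C\<close> for the height instead of the height
  itself, because the domination argument lets the centre move.\<close>

lemma polynomial_bounds:
  fixes a x :: "real^'n"
  assumes "\<bar>c\<bar> \<le> C"
  defines "M \<equiv> 1 + norm a + C"
  shows "1 \<le> M" "norm (x - a) \<le> M * (1 + norm x)" "\<bar>f x - c\<bar> \<le> M * (1 + norm x)\<^sup>2" "\<bar>S a c x\<bar> \<le> 2 * M * (1 + norm x)\<^sup>2"
proof -
  have C: "0 \<le> C" using assms(1) by linarith
  show M1: "1 \<le> M" using C by (simp add: M_def)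
  have "norm (x - a) \<le> norm x + norm a" by (rule norm_triangle_ineq4)
  also have "\<dots> \<le> M * (1 + norm x)" using C by (simp add: M_def algebra_simps)
  finally show p: "norm (x - a) \<le> M * (1 + norm x)" .
  have "\<bar>f x - c\<bar> \<le> (norm x)\<^sup>2 + C" using f_bounds[of x] assms(1) by linarith
  also have "\<dots> \<le> (1 + C) * (1 + norm x)\<^sup>2" using C by (simp add: power2_sum algebra_simps)
  also have "\<dots> \<le> M * (1 + norm x)\<^sup>2" by (intro mult_right_mono) (auto simp: M_def)
  finally show q: "\<bar>f x - c\<bar> \<le> M * (1 + norm x)\<^sup>2" .
  have "\<bar>(x - a) \<bullet> grad f x\<bar> \<le> norm (x - a) * norm (grad f x)" by (rule Cauchy_Schwarz_ineq2)
  also have "\<dots> \<le> (M * (1 + norm x)) * (1 + norm x)"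
    using p norm_grad_le[of x] M1 by (intro mult_mono) auto
  finally have "\<bar>(x - a) \<bullet> grad f x\<bar> \<le> M * (1 + norm x)\<^sup>2" by (simp add: power2_eq_square)
  then show "\<bar>S a c x\<bar> \<le> 2 * M * (1 + norm x)\<^sup>2" using q by (simp add: S_def)
qed

lemma K_le:
  assumes "0 < t" "t \<le> t2"
  shows "0 < K a c t x" "K a c t x \<le> exp (- (norm (x - a))\<^sup>2 / (4 * t2))"
proof -
  show "0 < K a c t x" by (simp add: K_def)
  have "(norm (x - a))\<^sup>2 / (4 * t2) \<le> (norm (x - a))\<^sup>2 / (4 * t)"
    using assms by (intro divide_left_mono) auto
  also have "\<dots> \<le> ((norm (x - a))\<^sup>2 + (f x - c)\<^sup>2) / (4 * t)"
    using assms by (intro divide_right_mono) auto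
  finally show "K a c t x \<le> exp (- (norm (x - a))\<^sup>2 / (4 * t2))" by (simp add: K_def)
qed

text \<open>Uniform in time and height, in order to dominate the time derivative: powers of
  \<open>1 / t\<close> are largest at \<open>t1\<close>, while the Gaussian is widest at
  \<open>t2\<close>. Of the five powers of \<open>1 + norm x\<close>, one comes from
  \<open>D\<close> and four from the square of the quadratically bounded height.\<close>

lemma E_bound:
  fixes a x :: "real^'n"
  assumes t: "0 < t1" "t1 \<le> t" "t \<le> t2" and c: "\<bar>c\<bar> \<le> C"
  defines "M \<equiv> 1 + norm a + C" and "w \<equiv> 1 / (2 * t1)"
  shows "\<bar>E a c t x\<bar> \<le> (real CARD('n) * w + 2 * M\<^sup>2 * w\<^sup>2 + M * w) * (1 + norm x) ^ 5 * exp (- (norm (x - a))\<^sup>2 / (4 * t2))"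
proof -
  define y where "y = 1 + norm x"
  define v where "v = 1 / (2 * t)"
  have y: "1 \<le> y" by (simp add: y_def)
  have v: "0 < v" "v \<le> w" using t by (auto simp: v_def w_def frac_le)
  have b0: "1 \<le> M" using polynomial_bounds(1)[OF c, where a = a] by (simp add: M_def)
  note b = polynomial_bounds(2-4)[OF c, where a = a and x = x, folded M_def, folded y_def]
  have p2: "(norm (x - a))\<^sup>2 \<le> M\<^sup>2 * y ^ 4"
  proof -
    have "(norm (x - a))\<^sup>2 \<le> (M * y)\<^sup>2" using b(1) by (intro power_mono) auto
    also have "\<dots> = M\<^sup>2 * y\<^sup>2" by (simp add: power_mult_distrib)
    also have "\<dots> \<le> M\<^sup>2 * y ^ 4" using y by (intro mult_left_mono power_increasing) auto
    finally show ?thesis .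
  qed
  have q2: "(f x - c)\<^sup>2 \<le> M\<^sup>2 * y ^ 4"
  proof -
    have "\<bar>f x - c\<bar>\<^sup>2 \<le> (M * y\<^sup>2)\<^sup>2" using b(2) by (intro power_mono) auto
    also have "\<dots> = M\<^sup>2 * y ^ 4" by (simp add: power_mult_distrib)
    finally show ?thesis by simp
  qed
  define B where "B = - (real CARD('n) * v) + ((norm (x - a))\<^sup>2 + (f x - c)\<^sup>2) * v\<^sup>2 + (f x - c) * v"
  have EB: "E a c t x = D x * K a c t x * B"
    unfolding E_def B_def v_def by (simp add: power_divide)
  have "\<bar>B\<bar> \<le> real CARD('n) * v + ((norm (x - a))\<^sup>2 + (f x - c)\<^sup>2) * v\<^sup>2 + \<bar>f x - c\<bar> * v"
  proof -
    have "\<bar>B\<bar> \<le> \<bar>- (real CARD('n) * v)\<bar> + \<bar>((norm (x - a))\<^sup>2 + (f x - c)\<^sup>2) * v\<^sup>2\<bar> + \<bar>(f x - c) * v\<bar>"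
      unfolding B_def by linarith
    then show ?thesis using v by (simp add: abs_mult)
  qed
  also have "\<dots> \<le> real CARD('n) * w * y ^ 4 + (M\<^sup>2 * y ^ 4 + M\<^sup>2 * y ^ 4) * w\<^sup>2 + (M * y ^ 4) * w"
  proof -
    have "real CARD('n) * v * 1 \<le> real CARD('n) * w * y ^ 4"
      using v y by (intro mult_mono) auto
    then have "real CARD('n) * v \<le> real CARD('n) * w * y ^ 4" by (simp only: mult_1_right)
    moreover have "((norm (x - a))\<^sup>2 + (f x - c)\<^sup>2) * v\<^sup>2 \<le> (M\<^sup>2 * y ^ 4 + M\<^sup>2 * y ^ 4) * w\<^sup>2"
      using p2 q2 v by (intro mult_mono add_mono power_mono) auto
    moreover have "\<bar>f x - c\<bar> * v \<le> (M * y ^ 4) * w"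
    proof (rule mult_mono)
      have "\<bar>f x - c\<bar> \<le> M * y\<^sup>2" by (rule b(2))
      also have "\<dots> \<le> M * y ^ 4" using y b0 by (intro mult_left_mono power_increasing) auto
      finally show "\<bar>f x - c\<bar> \<le> M * y ^ 4" .
    qed (use v b0 y in auto)
    ultimately show ?thesis by (intro add_mono)
  qed
  also have "\<dots> = (real CARD('n) * w + 2 * M\<^sup>2 * w\<^sup>2 + M * w) * y ^ 4" by (simp add: algebra_simps)
  finally have B: "\<bar>B\<bar> \<le> (real CARD('n) * w + 2 * M\<^sup>2 * w\<^sup>2 + M * w) * y ^ 4" .
  have Dy: "D x \<le> y" using D_le[of x] by (simp add: y_def)
  have t0: "0 < t" using t by linarith
  have "\<bar>E a c t x\<bar> = D x * K a c t x * \<bar>B\<bar>"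
    using D_pos[of x] K_le[OF t0 t(3), of a c x] by (simp add: EB abs_mult)
  also have "\<dots> \<le> (y * exp (- (norm (x - a))\<^sup>2 / (4 * t2))) * ((real CARD('n) * w + 2 * M\<^sup>2 * w\<^sup>2 + M * w) * y ^ 4)"
    using B Dy K_le[OF t0 t(3), of a c x] D_pos[of x] y by (intro mult_mono) auto
  also have "\<dots> = (real CARD('n) * w + 2 * M\<^sup>2 * w\<^sup>2 + M * w) * y ^ 5 * exp (- (norm (x - a))\<^sup>2 / (4 * t2))"
    by (simp add: eval_nat_numeral algebra_simps)
  finally show ?thesis by (simp add: y_def)
qed

lemma integrable_E:
  assumes "0 < t"
  shows "integrable lborel (E a c t)"
proof (rule integrable_gaussian_bound)
  show "E a c t \<in> borel_measurable borel"
    using assms by (intro borel_measurable_continuous_onI continuous_E) auto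
  show "\<bar>E a c t x\<bar> \<le> (real CARD('n) * (1 / (2 * t)) + 2 * (1 + norm a + \<bar>c\<bar>)\<^sup>2 * (1 / (2 * t))\<^sup>2 + (1 + norm a + \<bar>c\<bar>) * (1 / (2 * t))) * (1 + norm x) ^ 5 * exp (- (norm (x - a))\<^sup>2 / (4 * t))" for x
    by (rule E_bound) (use assms in auto)
qed (use assms in auto)

lemma integrable_DK:
  assumes "0 < t"
  shows "integrable lborel (\<lambda>x. D x * K a c t x)"
proof (rule integrable_gaussian_bound)
  show "(\<lambda>x. D x * K a c t x) \<in> borel_measurable borel"
    using assms by (intro borel_measurable_continuous_onI continuous_intros continuous_K continuous_D) auto
  show "\<bar>D x * K a c t x\<bar> \<le> 1 * (1 + norm x) ^ 1 * exp (- (norm (x - a))\<^sup>2 / (4 * t))" for x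
    using D_le[of x] D_pos[of x] K_le[OF assms order_refl, of a c x] by (simp add: abs_mult) (intro mult_mono, auto)
qed (use assms in auto)

lemma integrable_R:
  assumes "0 < t"
  shows "integrable lborel (R a c t)"
proof (rule integrable_gaussian_bound)
  show "R a c t \<in> borel_measurable borel"
    using assms by (intro borel_measurable_continuous_onI continuous_R) auto
  define M where "M = 1 + norm a + \<bar>c\<bar>"
  define w where "w = 1 / (2 * t)"
  have w: "0 < w" using assms by (simp add: w_def)
  show "\<bar>R a c t x\<bar> \<le> (2 * M * w + 1)\<^sup>2 * (1 + norm x) ^ 4 * exp (- (norm (x - a))\<^sup>2 / (4 * t))" for x
  proof -
    have b0: "1 \<le> M" by (simp add: M_def)
    note b = polynomial_bounds(2-4)[OF order_refl, where a = a and x = x and c = c, folded M_def]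
    have "\<bar>w * S a c x + 1\<bar> \<le> w * \<bar>S a c x\<bar> + 1"
      using w by (simp add: abs_mult abs_triangle_ineq[THEN order_trans])
    also have "\<dots> \<le> w * (2 * M * (1 + norm x)\<^sup>2) + (1 + norm x)\<^sup>2"
      using w b(3) by (intro add_mono mult_left_mono) auto
    also have "\<dots> = (2 * M * w + 1) * (1 + norm x)\<^sup>2" by (simp add: algebra_simps)
    finally have "\<bar>w * S a c x + 1\<bar>\<^sup>2 \<le> ((2 * M * w + 1) * (1 + norm x)\<^sup>2)\<^sup>2" by (rule power_mono) simp
    then have sq: "(w * S a c x + 1)\<^sup>2 \<le> (2 * M * w + 1)\<^sup>2 * (1 + norm x) ^ 4" by (simp add: power_mult_distrib)
    have "\<bar>R a c t x\<bar> = K a c t x * (w * S a c x + 1)\<^sup>2 / D x"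
      using D_pos[of x] K_le[OF assms order_refl, of a c x] by (simp add: R_def w_def abs_mult)
    also have "\<dots> \<le> K a c t x * (w * S a c x + 1)\<^sup>2 / 1"
      using D_pos[of x] K_le[OF assms order_refl, of a c x] by (intro divide_left_mono) auto
    also have "\<dots> \<le> exp (- (norm (x - a))\<^sup>2 / (4 * t)) * ((2 * M * w + 1)\<^sup>2 * (1 + norm x) ^ 4)"
      using sq K_le[OF assms order_refl, of a c x] by (simp, intro mult_mono) auto
    finally show ?thesis by (simp add: mult.commute)
  qed
qed (use assms in auto)

lemma integrable_KW:
  assumes "0 < t"
  shows "integrable lborel (\<lambda>x. norm (K a c t x *\<^sub>R W a c (1 / (2 * t)) x))"
proof (rule integrable_gaussian_bound)
  show "(\<lambda>x. norm (K a c t x *\<^sub>R W a c (1 / (2 * t)) x)) \<in> borel_measurable borel"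
    using assms by (intro borel_measurable_continuous_onI continuous_intros continuous_K continuous_W) auto
  define M where "M = 1 + norm a + \<bar>c\<bar>"
  define w where "w = 1 / (2 * t)"
  have w: "0 < w" using assms by (simp add: w_def)
  show "0 \<le> 3 * M * w + 1" using w by (simp add: M_def)
  show "\<bar>norm (K a c t x *\<^sub>R W a c (1 / (2 * t)) x)\<bar> \<le> (3 * M * w + 1) * (1 + norm x) ^ 2 * exp (- (norm (x - a))\<^sup>2 / (4 * t))" for x
  proof -
    have b0: "1 \<le> M" by (simp add: M_def)
    note b = polynomial_bounds(2-4)[OF order_refl, where a = a and x = x and c = c, folded M_def]
    have "norm (W a c w x) \<le> norm ((w * D x) *\<^sub>R (x - a)) + norm ((w * S a c x + 1) *\<^sub>R X x)"
      unfolding W_def by (rule norm_triangle_ineq)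
    also have "norm ((w * D x) *\<^sub>R (x - a)) = (w * D x) * norm (x - a)" using w D_pos[of x] by simp
    also have "\<dots> \<le> (w * (1 + norm x)) * (M * (1 + norm x))"
      using w b D_le[of x] D_pos[of x] by (intro mult_mono mult_left_mono) auto
    also have "norm ((w * S a c x + 1) *\<^sub>R X x) \<le> \<bar>w * S a c x + 1\<bar> * 1"
      unfolding norm_scaleR using norm_X_le[of x] by (intro mult_mono) auto
    also have "\<bar>w * S a c x + 1\<bar> \<le> w * \<bar>S a c x\<bar> + 1"
      using w by (simp add: abs_mult abs_triangle_ineq[THEN order_trans])
    also have "\<dots> \<le> w * (2 * M * (1 + norm x)\<^sup>2) + (1 + norm x)\<^sup>2"
      using w b(3) by (intro add_mono mult_left_mono) auto
    finally have W: "norm (W a c w x) \<le> (3 * M * w + 1) * (1 + norm x)\<^sup>2"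
      by (simp add: power2_eq_square algebra_simps)
    have "K a c t x * norm (W a c w x) \<le> exp (- (norm (x - a))\<^sup>2 / (4 * t)) * ((3 * M * w + 1) * (1 + norm x)\<^sup>2)"
      using W K_le[OF assms order_refl, of a c x] by (intro mult_mono) auto
    then show ?thesis using K_le[OF assms order_refl, of a c x] by (simp add: w_def mult.commute)
  qed
qed (use assms in auto)

section \<open>Derivatives and the divergence identity\<close>

lemma S_has_derivative: "(S a c has_derivative (\<lambda>v. - ((x - a) \<bullet> H x v))) (at x)"
proof -
  have 1: "((\<lambda>x. f x - c) has_derivative (\<lambda>v. grad f x \<bullet> v - 0)) (at x)"
    by (intro has_derivative_diff has_derivative_grad f_differentiable has_derivative_const)
  have "((\<lambda>x. x - a) has_derivative (\<lambda>v. v - 0)) (at x)"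
    by (intro has_derivative_diff has_derivative_ident has_derivative_const)
  from has_derivative_diff[OF 1 has_derivative_inner[OF this has_derivative_hessian]]
  show ?thesis unfolding S_def[abs_def]
    by (rule has_derivative_eq_rhs) (simp add: fun_eq_iff inner_commute)
qed

lemma K_has_derivative:
  assumes "0 < t"
  shows "(K a c t has_derivative (\<lambda>v. - (K a c t x / (2 * t)) * ((x - a) \<bullet> v + (f x - c) * (grad f x \<bullet> v)))) (at x)"
proof -
  have 1: "((\<lambda>x. f x - c) has_derivative (\<lambda>v. grad f x \<bullet> v - 0)) (at x)"
    by (intro has_derivative_diff has_derivative_grad f_differentiable has_derivative_const)
  have 2: "((\<lambda>x. x - a) has_derivative (\<lambda>v. v - 0)) (at x)"
    by (intro has_derivative_diff has_derivative_ident has_derivative_const)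
  have "((\<lambda>x. ((x - a) \<bullet> (x - a) + (f x - c) * (f x - c)) * (- (1 / (4 * t)))) has_derivative
      (\<lambda>v. (((x - a) \<bullet> (v - 0) + (v - 0) \<bullet> (x - a)) + ((f x - c) * (grad f x \<bullet> v - 0) + (grad f x \<bullet> v - 0) * (f x - c))) * (- (1 / (4 * t))))) (at x)"
    by (intro has_derivative_mult_left has_derivative_add has_derivative_inner has_derivative_mult 1 2)
  from has_derivative_compose[OF this DERIV_exp[unfolded has_field_derivative_def]]
  have "((\<lambda>x. exp (((x - a) \<bullet> (x - a) + (f x - c) * (f x - c)) * (- (1 / (4 * t))))) has_derivative
    (\<lambda>v. exp (((x - a) \<bullet> (x - a) + (f x - c) * (f x - c)) * (- (1 / (4 * t)))) *
      ((((x - a) \<bullet> (v - 0) + (v - 0) \<bullet> (x - a)) + ((f x - c) * (grad f x \<bullet> v - 0) + (grad f x \<bullet> v - 0) * (f x - c))) * (- (1 / (4 * t)))))) (at x)" .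
  note deriv = this
  have Keq: "(\<lambda>x. exp (((x - a) \<bullet> (x - a) + (f x - c) * (f x - c)) * (- (1 / (4 * t))))) = K a c t"
  proof
    fix x
    have "A * (- (1 / (4 * t))) = - (A / (4 * t))" for A by simp
    then show "exp (((x - a) \<bullet> (x - a) + (f x - c) * (f x - c)) * (- (1 / (4 * t)))) = K a c t x"
      unfolding K_def power2_norm_eq_inner unfolding power2_eq_square by (simp only:)
  qed
  have "(K a c t has_derivative
    (\<lambda>v. K a c t x * ((((x - a) \<bullet> (v - 0) + (v - 0) \<bullet> (x - a)) + ((f x - c) * (grad f x \<bullet> v - 0) + (grad f x \<bullet> v - 0) * (f x - c))) * (- (1 / (4 * t)))))) (at x)"
    using deriv unfolding Keq fun_cong[OF Keq] .
  then show ?thesis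
  proof (rule has_derivative_eq_rhs, intro ext)
    fix v
    have "(v - 0) \<bullet> (x - a) = (x - a) \<bullet> v" by (simp add: inner_commute)
    then show "K a c t x * ((((x - a) \<bullet> (v - 0) + (v - 0) \<bullet> (x - a)) + ((f x - c) * (grad f x \<bullet> v - 0) + (grad f x \<bullet> v - 0) * (f x - c))) * (- (1 / (4 * t))))
      = - (K a c t x / (2 * t)) * ((x - a) \<bullet> v + (f x - c) * (grad f x \<bullet> v))"
      using assms by (simp add: field_simps)
  qed
qed

definition X' :: "real^'n \<Rightarrow> real^'n \<Rightarrow> real^'n" where
  "X' x v = H x v /\<^sub>R D x - (grad f x \<bullet> H x v / (D x)^3) *\<^sub>R grad f x"

definition W' :: "real^'n \<Rightarrow> real \<Rightarrow> real \<Rightarrow> real^'n \<Rightarrow> real^'n \<Rightarrow> real^'n" where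
  "W' a c w x v = (w * D x) *\<^sub>R v + (w * (grad f x \<bullet> H x v / D x)) *\<^sub>R (x - a)
     + ((w * S a c x + 1) *\<^sub>R X' x v + (w * (- ((x - a) \<bullet> H x v))) *\<^sub>R X x)"

lemma W_has_derivative: "(W a c w has_derivative W' a c w x) (at x)"
proof -
  have 2: "((\<lambda>x. x - a) has_derivative (\<lambda>v. v - 0)) (at x)"
    by (intro has_derivative_diff has_derivative_ident has_derivative_const)
  have X: "(X has_derivative X' x) (at x)" using X_has_derivative unfolding X'_def[abs_def] .
  have S: "((\<lambda>x. w * S a c x + 1) has_derivative (\<lambda>v. w * (- ((x - a) \<bullet> H x v)) + 0)) (at x)"
    by (intro has_derivative_add has_derivative_mult_right S_has_derivative has_derivative_const)
  have D: "((\<lambda>x. w * D x) has_derivative (\<lambda>v. w * (grad f x \<bullet> H x v / D x))) (at x)"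
    by (intro has_derivative_mult_right D_has_derivative)
  show ?thesis unfolding W_def[abs_def]
    by (rule has_derivative_eq_rhs[OF has_derivative_add[OF has_derivative_scaleR[OF D 2] has_derivative_scaleR[OF S X]]])
      (simp add: fun_eq_iff W'_def)
qed

lemma trace_rank_one:
  assumes "linear (L :: real^'n \<Rightarrow> real)"
  shows "(\<Sum>i\<in>UNIV. L (axis i 1) * v $ i) = L v"
proof -
  have "v = (\<Sum>i\<in>UNIV. v $ i *\<^sub>R axis i 1)"
    by (simp add: vec_eq_iff axis_def if_distrib cong: if_cong)
  then have "L v = L (\<Sum>i\<in>UNIV. v $ i *\<^sub>R axis i 1)" by simp
  also have "\<dots> = (\<Sum>i\<in>UNIV. L (axis i 1) * v $ i)"
    using assms by (simp add: linear_sum linear_scale mult.commute)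
  finally show ?thesis by simp
qed

text \<open>The two Hessian terms of the trace cancel because the Hessian is symmetric.\<close>

lemma trace_W':
  assumes "x \<noteq> 0"
  shows "(\<Sum>i\<in>UNIV. W' a c w x (axis i 1) $ i) = real CARD('n) * w * D x + (w * S a c x + 1) / D x"
proof -
  have linH: "linear (frechet_derivative (grad f) (at x))" using grad_differentiable by (rule linear_frechet_derivative)
  have L: "linear (\<lambda>v. u \<bullet> H x v)" for u
    by (auto intro!: linearI simp: linear_add[OF linH] linear_scale[OF linH] inner_add_right)
  have T: "(\<Sum>i\<in>UNIV. (u \<bullet> H x (axis i 1)) * v $ i) = u \<bullet> H x v" for u v
    by (rule trace_rank_one[OF L])
  have "(\<Sum>i\<in>UNIV. W' a c w x (axis i 1) $ i) =
    (\<Sum>i\<in>UNIV. w * D x * (axis i 1 :: real^'n) $ i) + (w / D x) * (\<Sum>i\<in>UNIV. (grad f x \<bullet> H x (axis i 1)) * (x - a) $ i)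
     + (w * S a c x + 1) * (\<Sum>i\<in>UNIV. X' x (axis i 1) $ i) - w * (\<Sum>i\<in>UNIV. ((x - a) \<bullet> H x (axis i 1)) * X x $ i)"
    unfolding W'_def sum_distrib_left sum.distrib[symmetric] sum_subtractf[symmetric]
    by (intro sum.cong refl) (simp add: algebra_simps)
  also have "(\<Sum>i\<in>UNIV. w * D x * (axis i 1 :: real^'n) $ i) = real CARD('n) * w * D x"
    by (simp add: axis_def)
  also have "(\<Sum>i\<in>UNIV. (grad f x \<bullet> H x (axis i 1)) * (x - a) $ i) = grad f x \<bullet> H x (x - a)" by (rule T)
  also have "(\<Sum>i\<in>UNIV. ((x - a) \<bullet> H x (axis i 1)) * X x $ i) = (x - a) \<bullet> H x (X x)" by (rule T)
  also have "(\<Sum>i\<in>UNIV. X' x (axis i 1) $ i) = 1 / D x" unfolding X'_def by (rule divergence_X)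
  also have "(x - a) \<bullet> H x (X x) = (grad f x \<bullet> H x (x - a)) / D x"
    unfolding hessian_symmetric[OF assms, of "x - a"] by (simp add: X_def divide_inverse mult.commute)
  finally show ?thesis by simp
qed

text \<open>The pointwise identity whose integral is the monotonicity formula. The product rule
  gives the trace of \<open>W'\<close> and the pairing of \<open>W\<close> with the gradient of the
  Gaussian exponent; the rest is algebra. The origin is excluded because \<open>trace_W'\<close>
  rests on the symmetry of the Hessian.\<close>

lemma divergence_identity:
  assumes t: "0 < t" and x: "x \<noteq> 0"
  shows "(\<Sum>i\<in>UNIV. (K a c t x *\<^sub>R W' a c (1 / (2 * t)) x (axis i 1)
      + (- (K a c t x / (2 * t)) * ((x - a) \<bullet> axis i 1 + (f x - c) * (grad f x \<bullet> axis i 1))) *\<^sub>R W a c (1 / (2 * t)) x) $ i)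
    = R a c t x - E a c t x"
proof -
  define w where "w = 1 / (2 * t)"
  define k where "k = K a c t x"
  define d where "d = D x"
  define q where "q = f x - c"
  define u where "u = (x - a) \<bullet> grad f x"
  define P where "P = (norm (x - a))\<^sup>2"
  define G2 where "G2 = grad f x \<bullet> grad f x"
  define n where "n = real CARD('n)"
  have d: "0 < d" "d\<^sup>2 = 1 + G2" using D_pos[of x] by (auto simp: d_def G2_def)
  have s: "S a c x = q - u" by (simp add: S_def q_def u_def)
  have kt: "K a c t x / (2 * t) = k * w" by (simp add: k_def w_def)
  have "(\<Sum>i\<in>UNIV. (K a c t x *\<^sub>R W' a c (1 / (2 * t)) x (axis i 1)
      + (- (K a c t x / (2 * t)) * ((x - a) \<bullet> axis i 1 + (f x - c) * (grad f x \<bullet> axis i 1))) *\<^sub>R W a c (1 / (2 * t)) x) $ i) =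
    k * (\<Sum>i\<in>UNIV. W' a c w x (axis i 1) $ i) - k * w * (((x - a) + q *\<^sub>R grad f x) \<bullet> W a c w x)"
  proof -
    define L where "L v = (x - a) \<bullet> v + q * (grad f x \<bullet> v)" for v
    have "linear L" unfolding L_def by (auto intro!: linearI simp: inner_add_right algebra_simps)
    have "(\<Sum>i\<in>UNIV. (k *\<^sub>R W' a c w x (axis i 1) + (- (k * w) * L (axis i 1)) *\<^sub>R W a c w x) $ i) =
      k * (\<Sum>i\<in>UNIV. W' a c w x (axis i 1) $ i) - k * w * (\<Sum>i\<in>UNIV. L (axis i 1) * W a c w x $ i)"
      by (simp add: sum_distrib_left sum_subtractf mult.assoc)
    also have "(\<Sum>i\<in>UNIV. L (axis i 1) * W a c w x $ i) = L (W a c w x)"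
      by (rule trace_rank_one[OF \<open>linear L\<close>])
    also have "\<dots> = ((x - a) + q *\<^sub>R grad f x) \<bullet> W a c w x" by (simp add: L_def inner_add_left)
    finally show ?thesis
      unfolding kt unfolding w_def[symmetric] k_def[symmetric] q_def[symmetric] L_def .
  qed
  also have "(\<Sum>i\<in>UNIV. W' a c w x (axis i 1) $ i) = n * w * d + (w * (q - u) + 1) / d"
    unfolding trace_W'[OF x] s n_def d_def ..
  also have "((x - a) + q *\<^sub>R grad f x) \<bullet> W a c w x = w * d * (P + q * u) + (w * (q - u) + 1) * ((u + q * G2) / d)"
  proof -
    have X: "X x = inverse d *\<^sub>R grad f x" by (simp add: X_def d_def)
    have "((x - a) + q *\<^sub>R grad f x) \<bullet> W a c w x =
      w * d * ((x - a) \<bullet> (x - a) + q * (grad f x \<bullet> (x - a))) + (w * (q - u) + 1) * inverse d * ((x - a) \<bullet> grad f x + q * (grad f x \<bullet> grad f x))"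
      unfolding W_def s X d_def[symmetric] by (simp only: inner_add_left inner_add_right inner_scaleR_left inner_scaleR_right)
    also have "(x - a) \<bullet> (x - a) = P" unfolding P_def by (rule power2_norm_eq_inner[symmetric])
    also have "grad f x \<bullet> (x - a) = u" unfolding u_def by (rule inner_commute)
    finally show ?thesis unfolding u_def[symmetric] G2_def[symmetric] by (simp add: divide_inverse)
  qed
  \<comment> \<open>After multiplication by \<open>d\<close>, replacing \<open>d\<^sup>2\<close> by
    \<open>1 + G2\<close> turns the terms that are not part of \<open>E\<close> into a perfect
    square.\<close>
  also have "k * (n * w * d + (w * (q - u) + 1) / d) - k * w * (w * d * (P + q * u) + (w * (q - u) + 1) * ((u + q * G2) / d))
    = k * (w * (q - u) + 1)\<^sup>2 / d - d * k * (- (n * w) + (P + q\<^sup>2) * w\<^sup>2 + q * w)"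
  proof -
    have "d\<^sup>2 * ((P + q\<^sup>2) * w\<^sup>2 + q * w) + (w * (q - u) + 1) - w * (d\<^sup>2 * w * (P + q * u) + (w * (q - u) + 1) * (u + q * G2)) = (w * (q - u) + 1)\<^sup>2"
      unfolding d(2) by (simp add: power2_eq_square algebra_simps)
    then have "(d\<^sup>2 * ((P + q\<^sup>2) * w\<^sup>2 + q * w) + (w * (q - u) + 1) - w * (d\<^sup>2 * w * (P + q * u) + (w * (q - u) + 1) * (u + q * G2))) / d = (w * (q - u) + 1)\<^sup>2 / d"
      by simp
    moreover have "(d\<^sup>2 * ((P + q\<^sup>2) * w\<^sup>2 + q * w) + (w * (q - u) + 1) - w * (d\<^sup>2 * w * (P + q * u) + (w * (q - u) + 1) * (u + q * G2))) / d
      = d * ((P + q\<^sup>2) * w\<^sup>2 + q * w) + (w * (q - u) + 1) / d - w * (w * d * (P + q * u) + (w * (q - u) + 1) * ((u + q * G2) / d))"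
    proof -
      have "(d\<^sup>2 * A + B - w * (d\<^sup>2 * w * C + B * F)) / d = d * A + B / d - w * (w * d * C + B * (F / d))" for A B C F
        using d(1) by (simp add: power2_eq_square field_simps)
      then show ?thesis .
    qed
    ultimately have key: "(w * (q - u) + 1)\<^sup>2 / d = d * ((P + q\<^sup>2) * w\<^sup>2 + q * w) + (w * (q - u) + 1) / d - w * (w * d * (P + q * u) + (w * (q - u) + 1) * ((u + q * G2) / d))"
      by simp
    have "k * (w * (q - u) + 1)\<^sup>2 / d = k * ((w * (q - u) + 1)\<^sup>2 / d)" by simp
    then show ?thesis unfolding key by (simp only: algebra_simps)
  qed
  also have "k * (w * (q - u) + 1)\<^sup>2 / d = R a c t x" by (simp add: R_def k_def d_def s w_def)
  also have "d * k * (- (n * w) + (P + q\<^sup>2) * w\<^sup>2 + q * w) = E a c t x"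
    by (simp add: E_def k_def d_def n_def w_def P_def q_def power_divide)
  finally show ?thesis .
qed

lemma integral_E_nonneg:
  assumes t: "0 < t"
  shows "0 \<le> (\<integral>x. E a c t x \<partial>lborel)"
proof -
  define w where "w = 1 / (2 * t)"
  define V where "V x = K a c t x *\<^sub>R W a c w x" for x
  define V' where "V' x v = K a c t x *\<^sub>R W' a c w x v
      + (- (K a c t x / (2 * t)) * ((x - a) \<bullet> v + (f x - c) * (grad f x \<bullet> v))) *\<^sub>R W a c w x" for x v
  have der: "(V has_derivative V' x) (at x)" for x
    using has_derivative_scaleR[OF K_has_derivative[OF t] W_has_derivative] unfolding V_def[abs_def] V'_def[abs_def] .
  have cX': "continuous_on UNIV (\<lambda>x. X' x v)" for v
    unfolding X'_def by (intro continuous_intros continuous_hessian continuous_D continuous_grad') (auto simp: D_pos)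
  have cont: "continuous_on UNIV (\<lambda>x. V' x (axis i 1))" for i
    unfolding V'_def W'_def using t
    by (intro continuous_intros continuous_K continuous_hessian continuous_D continuous_S continuous_X cX' continuous_W continuous_f continuous_grad') (auto simp: D_pos)
  have div: "AE x in lborel. (\<Sum>i\<in>UNIV. V' x (axis i 1) $ i) = R a c t x - E a c t x"
  proof (rule AE_I')
    show "{0::real^'n} \<in> null_sets lborel" by (rule finite_imp_null_set_lborel) simp
    show "{x \<in> space lborel. (\<Sum>i\<in>UNIV. V' x (axis i 1) $ i) \<noteq> R a c t x - E a c t x} \<subseteq> {0}"
      using divergence_identity[OF t] unfolding V'_def w_def by blast
  qed
  have dm: "(\<lambda>x. \<Sum>i\<in>UNIV. V' x (axis i 1) $ i) \<in> borel_measurable lborel"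
    using cont by (simp, intro borel_measurable_continuous_onI continuous_intros) auto
  have int: "integrable lborel (\<lambda>x. R a c t x - E a c t x)"
    using integrable_R[OF t] integrable_E[OF t] by auto
  have intd: "integrable lborel (\<lambda>x. \<Sum>i\<in>UNIV. V' x (axis i 1) $ i)"
    using integrable_cong_AE[OF dm _ div] int by auto
  have "0 = (\<integral>x. (\<Sum>i\<in>UNIV. V' x (axis i 1) $ i) \<partial>lborel)"
    by (rule integral_divergence_eq_0[OF der cont _ intd, symmetric])
      (use integrable_KW[OF t] in \<open>simp add: V_def w_def\<close>)
  also have "\<dots> = (\<integral>x. R a c t x - E a c t x \<partial>lborel)"
    by (rule integral_cong_AE[OF dm _ div]) (use int in auto)
  also have "\<dots> = (\<integral>x. R a c t x \<partial>lborel) - (\<integral>x. E a c t x \<partial>lborel)"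
    by (rule Bochner_Integration.integral_diff[OF integrable_R[OF t] integrable_E[OF t]])
  finally have "(\<integral>x. E a c t x \<partial>lborel) = (\<integral>x. R a c t x \<partial>lborel)" by simp
  also have "0 \<le> \<dots>"
    using D_pos K_le(1)[OF t order_refl] by (intro Bochner_Integration.integral_nonneg) (simp add: R_def less_imp_le)
  finally show ?thesis .
qed

end

section \<open>Monotonicity and the blow-down limit\<close>

text \<open>Chebyshev's inequality: \<open>1 - (y - c)\<^sup>2 / l\<^sup>2\<close> is at most the
  indicator of the interval, and its mean is given by the variance. The positive part of the product
  is taken so that it can be read in \<open>ennreal\<close>.\<close>

lemma normal_density_mean_square_bound:
  assumes "0 < \<sigma>" "0 < l"
  shows "ennreal (1 - \<sigma>\<^sup>2 / l\<^sup>2) \<le> (\<integral>\<^sup>+y\<in>{c - l..c + l}. ennreal (normal_density c \<sigma> y) \<partial>lborel)"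
proof -
  have var: "has_bochner_integral lborel (\<lambda>x. normal_density c \<sigma> x * (x - c)\<^sup>2) (\<sigma>\<^sup>2)"
    using normal_moment_even[OF assms(1), of c 1] by (simp add: power2_eq_square)
  have one: "has_bochner_integral lborel (normal_density c \<sigma>) 1"
    using assms(1) by (simp add: has_bochner_integral_iff)
  have hb: "has_bochner_integral lborel (\<lambda>x. normal_density c \<sigma> x - normal_density c \<sigma> x * (x - c)\<^sup>2 / l\<^sup>2) (1 - \<sigma>\<^sup>2 / l\<^sup>2)"
    by (intro has_bochner_integral_diff one has_bochner_integral_divide_zero var)
  define u where "u y = normal_density c \<sigma> y - normal_density c \<sigma> y * (y - c)\<^sup>2 / l\<^sup>2" for y
  have int: "integrable lborel (\<lambda>y. max 0 (u y))"
    using hb unfolding u_def has_bochner_integral_iff by (intro integrable_max) auto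
  have "1 - \<sigma>\<^sup>2 / l\<^sup>2 = (\<integral>y. u y \<partial>lborel)" using hb by (simp add: u_def has_bochner_integral_iff)
  also have "\<dots> \<le> (\<integral>y. max 0 (u y) \<partial>lborel)"
    using hb int by (intro integral_mono) (auto simp: u_def has_bochner_integral_iff)
  finally have "ennreal (1 - \<sigma>\<^sup>2 / l\<^sup>2) \<le> ennreal (\<integral>y. max 0 (u y) \<partial>lborel)" by (rule ennreal_leI)
  also have "\<dots> = (\<integral>\<^sup>+y. ennreal (max 0 (u y)) \<partial>lborel)"
    by (rule nn_integral_eq_integral[OF int, symmetric]) simp
  also have "\<dots> \<le> (\<integral>\<^sup>+y\<in>{c - l..c + l}. ennreal (normal_density c \<sigma> y) \<partial>lborel)"
  proof (rule nn_integral_mono)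
    fix y
    have nd: "0 \<le> normal_density c \<sigma> y" by simp
    show "ennreal (max 0 (u y)) \<le> ennreal (normal_density c \<sigma> y) * indicator {c - l..c + l} y"
    proof (cases "y \<in> {c - l..c + l}")
      case True
      have "u y \<le> normal_density c \<sigma> y" using nd by (simp add: u_def)
      then show ?thesis using True nd by (simp add: ennreal_leI)
    next
      case False
      then have "l \<le> \<bar>y - c\<bar>" by auto
      then have "l\<^sup>2 \<le> (y - c)\<^sup>2" using assms(2) by (simp add: abs_le_square_iff[symmetric])
      then have "1 \<le> (y - c)\<^sup>2 / l\<^sup>2" using assms(2) by simp
      then have "normal_density c \<sigma> y * 1 \<le> normal_density c \<sigma> y * ((y - c)\<^sup>2 / l\<^sup>2)"
        using nd by (rule mult_left_mono)
      then have "u y \<le> 0" by (simp add: u_def)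
      then show ?thesis by simp
    qed
  qed
  finally show ?thesis .
qed

lemma nn_integral_normal_density: "0 < \<sigma> \<Longrightarrow> (\<integral>\<^sup>+y. ennreal (normal_density c \<sigma> y) \<partial>lborel) = 1"
  by (subst nn_integral_eq_integral) auto

lemma normal_density_heat:
  assumes "0 < t"
  shows "normal_density c (sqrt (2 * t)) y = (4 * pi * t) powr (- (1 / 2)) * exp (- (y - c)\<^sup>2 / (4 * t))"
proof -
  have 1: "2 * pi * (sqrt (2 * t))\<^sup>2 = 4 * pi * t" "2 * (sqrt (2 * t))\<^sup>2 = 4 * t" using assms by simp_all
  have 2: "1 / sqrt (4 * pi * t) = (4 * pi * t) powr (- (1 / 2))"
    using assms by (simp add: powr_minus_divide powr_half_sqrt)
  show ?thesis unfolding normal_density_def 1 2 ..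
qed

lemma powr_uminus_eq_inverse_powr: "0 < x \<Longrightarrow> x powr (- a) = (1 / x) powr (a::real)"
  by (simp add: powr_def ln_div)

text \<open>The maximum is at \<open>w\<^sup>2 = k / (2 * \<kappa>)\<close>. In terms of
  \<open>z = 2 * \<kappa> * w\<^sup>2 / k\<close>, which is 1 there, the claim is
  \<open>ln z \<le> z - 1\<close>. For \<open>\<kappa> = 1 / (4 * t)\<close> the bound times
  \<open>(4 * pi * t) powr (- k / 2)\<close> is the power in the entropy of the sphere.\<close>

lemma power_times_gaussian_le:
  fixes w \<kappa> :: real
  assumes "0 \<le> w" "0 < \<kappa>" "1 \<le> k"
  shows "w ^ k * exp (- \<kappa> * w\<^sup>2) \<le> (real k / (2 * \<kappa> * exp 1)) powr (real k / 2)"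
proof (cases "w = 0")
  case True
  then have z: "w ^ k = 0" using assms(3) by (simp add: zero_power)
  show ?thesis unfolding z by simp
next
  case False
  then have w: "0 < w" using assms by simp
  have k: "0 < real k" using assms by simp
  define z where "z = 2 * \<kappa> * w\<^sup>2 / real k"
  have z: "0 < z" using w k assms by (simp add: z_def)
  have "ln z = ln (2 * \<kappa> / real k) + 2 * ln w"
    using w k assms by (simp add: z_def ln_mult ln_div ln_realpow)
  then have "real k / 2 * (ln (2 * \<kappa> / real k) + 2 * ln w) \<le> real k / 2 * (z - 1)"
    using ln_le_minus_one[OF z] k by (intro mult_left_mono) auto
  then have "real k * ln w - \<kappa> * w\<^sup>2 \<le> real k / 2 * (- ln (2 * \<kappa> / real k) - 1)"
    using k by (simp add: z_def algebra_simps)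
  also have "- ln (2 * \<kappa> / real k) - 1 = ln (real k / (2 * \<kappa> * exp 1))"
    using k assms by (simp add: ln_div ln_mult)
  finally have le: "real k * ln w - \<kappa> * w\<^sup>2 \<le> real k / 2 * ln (real k / (2 * \<kappa> * exp 1))" .
  have "w ^ k * exp (- \<kappa> * w\<^sup>2) = exp (real k * ln w - \<kappa> * w\<^sup>2)"
    using w by (simp add: exp_diff exp_of_nat_mult exp_minus divide_inverse)
  also have "\<dots> \<le> exp (real k / 2 * ln (real k / (2 * \<kappa> * exp 1)))" using le by simp
  also have "\<dots> = (real k / (2 * \<kappa> * exp 1)) powr (real k / 2)"
    using k assms by (simp add: powr_def)
  finally show ?thesis .
qed

context bowl
begin

section \<open>Monotonicity along the translating flow\<close>

definition \<Phi> :: "real^'n \<Rightarrow> real \<Rightarrow> real \<Rightarrow> real" where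
  "\<Phi> a c t = (4 * pi * t) powr (- (real CARD('n) / 2)) * (\<integral>x. D x * K a c t x \<partial>lborel)"

lemma nn_integral_DK:
  assumes "0 < t"
  shows "(\<integral>\<^sup>+x. ennreal (D x * K a c t x) \<partial>lborel) = ennreal (\<integral>x. D x * K a c t x \<partial>lborel)"
proof (rule nn_integral_eq_integral[OF integrable_DK[OF assms]])
  show "AE x in lborel. 0 \<le> D x * K a c t x"
    using D_pos(2) K_le(1)[OF assms order_refl] by (intro always_eventually allI) (simp add: less_imp_le)
qed

lemma F_functional_bowl:
  assumes "0 < t"
  shows "F_functional TYPE('n) (a, c) t (graph_of f) = ennreal (\<Phi> a c t)"
  unfolding F_functional_graph[OF f_differentiable continuous_grad] D_def[symmetric] K_def[symmetric] nn_integral_DK[OF assms] \<Phi>_def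
  by (rule ennreal_mult'[symmetric]) simp

lemma heat_weight_has_derivative:
  fixes s t0 b :: real
  assumes "0 < t0 + s"
  shows "((\<lambda>s. (4 * pi * (t0 + s)) powr (- (real CARD('n) / 2)) * (D x * K a (b + s) (t0 + s) x)) has_real_derivative
    (4 * pi * (t0 + s)) powr (- (real CARD('n) / 2)) * E a (b + s) (t0 + s) x) (at s)"
proof -
  define P where "P = (norm (x - a))\<^sup>2"
  define n where "n = real CARD('n)"
  have eq: "(4 * pi * (t0 + u)) powr (- (n / 2)) * (D x * K a (b + u) (t0 + u) x) =
    D x * exp (- (n / 2) * ln (4 * pi * (t0 + u)) - (P + (f x - (b + u))\<^sup>2) / (4 * (t0 + u)))" if "0 < t0 + u" for u
  proof -
    have "0 < 4 * pi * (t0 + u)" using that by simp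
    then have "(4 * pi * (t0 + u)) powr (- (n / 2)) = exp (- (n / 2) * ln (4 * pi * (t0 + u)))"
      unfolding powr_def by auto
    then show ?thesis unfolding K_def P_def[symmetric] diff_conv_add_uminus[of "- (n / 2) * ln _"] exp_add by simp
  qed
  have "((\<lambda>u. D x * exp (- (n / 2) * ln (4 * pi * (t0 + u)) - (P + (f x - (b + u))\<^sup>2) / (4 * (t0 + u)))) has_real_derivative
    D x * (exp (- (n / 2) * ln (4 * pi * (t0 + s)) - (P + (f x - (b + s))\<^sup>2) / (4 * (t0 + s))) *
      (- (n / (2 * (t0 + s))) + (P + (f x - (b + s))\<^sup>2) / (4 * (t0 + s)\<^sup>2) + (f x - (b + s)) / (2 * (t0 + s))))) (at s)"
  proof -
    have 1: "((\<lambda>u. - (n / 2) * ln (4 * pi * (t0 + u))) has_real_derivative - (n / (2 * (t0 + s)))) (at s)"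
    proof -
      have p: "0 < 4 * pi * (t0 + s)" using assms by simp
      have "((\<lambda>u. 4 * pi * (t0 + u)) has_real_derivative 4 * pi) (at s)" by (auto intro!: derivative_eq_intros)
      from DERIV_cmult[OF DERIV_chain2[OF DERIV_ln_divide[OF p] this], of "- (n / 2)"]
      have "((\<lambda>u. - (n / 2) * ln (4 * pi * (t0 + u))) has_real_derivative - (n / 2) * (1 / (4 * pi * (t0 + s)) * (4 * pi))) (at s)" .
      moreover have "- (n / 2) * (1 / (4 * pi * T) * (4 * pi)) = - (n / (2 * T))" for T :: real by simp
      ultimately show ?thesis by (simp only:)
    qed
    have 2: "((\<lambda>u. (P + (f x - (b + u))\<^sup>2) / (4 * (t0 + u))) has_real_derivative
      - ((P + (f x - (b + s))\<^sup>2) / (4 * (t0 + s)\<^sup>2) + (f x - (b + s)) / (2 * (t0 + s)))) (at s)"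
    proof -
      have d: "((\<lambda>u. (P + (f x - (b + u))\<^sup>2) / (4 * (t0 + u))) has_real_derivative
        ((- 2 * (f x - (b + s))) * (4 * (t0 + s)) - (P + (f x - (b + s))\<^sup>2) * 4) / ((4 * (t0 + s)) * (4 * (t0 + s)))) (at s)"
        using assms by (intro DERIV_divide) (auto intro!: derivative_eq_intros)
      have id: "((- 2 * q) * (4 * T) - Z * 4) / ((4 * T) * (4 * T)) = - (Z / (4 * T\<^sup>2) + q / (2 * T))" if "0 < T" for q T Z :: real
        using that by (simp add: power2_eq_square field_simps)
      show ?thesis using d unfolding id[OF assms] .
    qed
    have "u - - (v + w) = u + v + w" for u v w :: real by simp
    with DERIV_cmult[OF DERIV_fun_exp[OF DERIV_diff[OF 1 2]], of "D x"] show ?thesis by (simp only:)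
  qed
  also have "D x * (exp (- (n / 2) * ln (4 * pi * (t0 + s)) - (P + (f x - (b + s))\<^sup>2) / (4 * (t0 + s))) *
      (- (n / (2 * (t0 + s))) + (P + (f x - (b + s))\<^sup>2) / (4 * (t0 + s)\<^sup>2) + (f x - (b + s)) / (2 * (t0 + s))))
    = (4 * pi * (t0 + s)) powr (- (n / 2)) * E a (b + s) (t0 + s) x"
    unfolding E_def P_def[symmetric] n_def[symmetric] mult.assoc[of "D x", symmetric] eq[OF assms, symmetric]
    by (simp only: mult.assoc)
  finally have "((\<lambda>u. D x * exp (- (n / 2) * ln (4 * pi * (t0 + u)) - (P + (f x - (b + u))\<^sup>2) / (4 * (t0 + u)))) has_real_derivative
    (4 * pi * (t0 + s)) powr (- (n / 2)) * E a (b + s) (t0 + s) x) (at s)" .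
  then show ?thesis unfolding n_def[symmetric]
  \<comment> \<open>The rewriting \<open>eq\<close> is available only where \<open>t0 + u\<close> is
    positive, which is an open set around \<open>s\<close>.\<close>
  proof (rule has_field_derivative_transform_within_open[where S = "{- t0<..}"])
    fix u assume "u \<in> {- t0<..}"
    then have "0 < t0 + u" by simp
    from eq[OF this, symmetric] show "D x * exp (- (n / 2) * ln (4 * pi * (t0 + u)) - (P + (f x - (b + u))\<^sup>2) / (4 * (t0 + u))) =
      (4 * pi * (t0 + u)) powr (- (n / 2)) * (D x * K a (b + u) (t0 + u) x)" .
  qed (use assms in auto)
qed

text \<open>Huisken's monotonicity for the flow that translates the graph upwards with unit speed.\<close>

lemma \<Phi>_mono:
  assumes t0: "0 < t0" and T: "0 \<le> T"
  shows "\<Phi> a b t0 \<le> \<Phi> a (b + T) (t0 + T)"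
proof -
  define F where "F s x = (4 * pi * (t0 + s)) powr (- (real CARD('n) / 2)) * (D x * K a (b + s) (t0 + s) x)" for s x
  define F' where "F' s x = (4 * pi * (t0 + s)) powr (- (real CARD('n) / 2)) * E a (b + s) (t0 + s) x" for s x
  have \<Phi>F: "\<Phi> a (b + s) (t0 + s) = (\<integral>x. F s x \<partial>lborel)" for s
    by (simp add: \<Phi>_def F_def[abs_def])
  have "(\<integral>x. F 0 x \<partial>lborel) \<le> (\<integral>x. F T x \<partial>lborel)"
  proof (rule DERIV_nonneg_imp_nondecreasing[OF T])
    fix s assume s: "0 \<le> s" "s \<le> T"
    \<comment> \<open>For \<open>u\<close> between \<open>- (t0 / 2)\<close> and
      \<open>s + 1\<close> the time stays between \<open>t0 / 2\<close> and
      \<open>t0 + s + 1\<close>, and the height is at most \<open>C\<close> in absolute value; the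
      constants of the dominating function \<open>g0\<close> are taken at the worst of
      these.\<close>
    define C where "C = \<bar>b\<bar> + t0 + s + 1"
    define M where "M = 1 + norm a + C"
    define w where "w = 1 / (2 * (t0 / 2))"
    define Q where "Q = (4 * pi * (t0 / 2)) powr (- (real CARD('n) / 2))"
    define g0 where "g0 x = Q * ((real CARD('n) * w + 2 * M\<^sup>2 * w\<^sup>2 + M * w) * (1 + norm x) ^ 5 * exp (- (norm (x - a))\<^sup>2 / (4 * (t0 + s + 1))))" for x
    have "((\<lambda>s. \<integral>x. F s x \<partial>lborel) has_real_derivative (\<integral>x. F' s x \<partial>lborel)) (at s)"
    proof (rule has_real_derivative_integral[where a = "- (t0 / 2)" and b = "s + 1" and g = g0])
      show "s \<in> {- (t0 / 2)<..<s + 1}" using s t0 by auto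
      show "integrable lborel (F u)" if "u \<in> {- (t0 / 2)<..<s + 1}" for u
        unfolding F_def[abs_def] using that t0 by (intro integrable_mult_right integrable_DK) auto
      show "F' s \<in> borel_measurable lborel"
        unfolding F'_def[abs_def] using t0 s borel_measurable_integrable[OF integrable_E[of "t0 + s" a "b + s"]] by auto
      show "integrable lborel g0"
      proof (rule integrable_gaussian_bound[where N = 5 and a = a and c = "4 * (t0 + s + 1)"])
        have "0 \<le> Q * (real CARD('n) * w + 2 * M\<^sup>2 * w\<^sup>2 + M * w)"
          using t0 s by (simp add: Q_def M_def C_def w_def)
        then show "0 \<le> Q * (real CARD('n) * w + 2 * M\<^sup>2 * w\<^sup>2 + M * w)" .
        then have "0 \<le> g0 x" for x
          unfolding g0_def mult.assoc[symmetric] by (intro mult_nonneg_nonneg[of _ "exp _"] mult_nonneg_nonneg[of _ "(1 + norm x) ^ 5"]) auto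
        then show "\<bar>g0 x\<bar> \<le> Q * (real CARD('n) * w + 2 * M\<^sup>2 * w\<^sup>2 + M * w) * (1 + norm x) ^ 5 * exp (- (norm (x - a))\<^sup>2 / (4 * (t0 + s + 1)))" for x
          by (simp only: abs_of_nonneg) (simp add: g0_def)
        show "g0 \<in> borel_measurable borel"
          unfolding g0_def[abs_def] using t0 s by (intro borel_measurable_continuous_onI continuous_intros) auto
      qed (use t0 s in auto)
      show "AE x in lborel. \<forall>u\<in>{- (t0 / 2)<..<s + 1}. ((\<lambda>s. F s x) has_real_derivative F' u x) (at u) \<and> \<bar>F' u x\<bar> \<le> g0 x"
      proof (intro always_eventually allI ballI conjI)
        fix x u assume u: "u \<in> {- (t0 / 2)<..<s + 1}"
        then have tu: "0 < t0 + u" "t0 / 2 \<le> t0 + u" "t0 + u \<le> t0 + s + 1" and c: "\<bar>b + u\<bar> \<le> C"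
          using t0 s by (auto simp: C_def)
        show "((\<lambda>s. F s x) has_real_derivative F' u x) (at u)"
          unfolding F_def F'_def by (rule heat_weight_has_derivative[OF tu(1)])
        have "(4 * pi * (t0 + u)) powr (- (real CARD('n) / 2)) \<le> Q"
          unfolding Q_def using tu t0 by (intro powr_mono2') auto
        moreover have "\<bar>E a (b + u) (t0 + u) x\<bar> \<le> (real CARD('n) * w + 2 * M\<^sup>2 * w\<^sup>2 + M * w) * (1 + norm x) ^ 5 * exp (- (norm (x - a))\<^sup>2 / (4 * (t0 + s + 1)))"
          unfolding w_def M_def by (rule E_bound[OF _ tu(2,3) c]) (use t0 in simp)
        ultimately show "\<bar>F' u x\<bar> \<le> g0 x"
          unfolding F'_def g0_def abs_mult by (intro mult_mono) (auto simp: Q_def)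
      qed
    qed
    moreover have "0 \<le> (\<integral>x. F' s x \<partial>lborel)"
      unfolding F'_def using integral_E_nonneg[of "t0 + s" a "b + s"] t0 s by simp
    ultimately show "\<exists>y. ((\<lambda>s. \<integral>x. F s x \<partial>lborel) has_real_derivative y) (at s) \<and> 0 \<le> y" by blast
  qed
  then show ?thesis using \<Phi>F[of 0] \<Phi>F[of T] by simp
qed

section \<open>Upper bound at large scales\<close>

definition k :: nat where "k = CARD('n) - 1"
definition \<alpha> :: real where "\<alpha> = measure lborel (ball (0::real^'n) 1)"
definition \<Lambda> :: real where "\<Lambda> = real CARD('n) * \<alpha> * (m / (2 * pi * exp 1)) powr (m / 2)"

lemma k: "real k = m" "1 \<le> k" "CARD('n) = Suc k"
  using card_ge_2 by (auto simp: k_def m_def)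

lemma \<alpha>_nonneg: "0 \<le> \<alpha>" by (simp add: \<alpha>_def)

lemma g_measurable [measurable]: "g \<in> borel_measurable borel" "G \<in> borel_measurable borel"
  by (intro borel_measurable_continuous_onI continuous_g continuous_G)+

lemma nn_integral_profile_interval:
  assumes "0 \<le> r1" "r1 \<le> r2" "0 < t"
  shows "(\<integral>\<^sup>+r\<in>{r1..r2}. ennreal (normal_density c (sqrt (2 * t)) (G r) * g r) \<partial>lborel) =
    (\<integral>\<^sup>+y\<in>{G r1..G r2}. ennreal (normal_density c (sqrt (2 * t)) y) \<partial>lborel)"
proof -
  have "(\<integral>\<^sup>+x. ennreal (normal_density c (sqrt (2 * t)) x * indicator {G r1..G r2} x) \<partial>lborel) =
             (\<integral>\<^sup>+x. ennreal (normal_density c (sqrt (2 * t)) (G x) * g x * indicator {r1..r2} x) \<partial>lborel)"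
    by (rule nn_integral_substitution[OF _ G_has_derivative continuous_g])
      (use assms g_nonneg in \<open>auto simp: set_borel_measurable_def\<close>)
  moreover have "(\<integral>\<^sup>+x. ennreal (normal_density c (sqrt (2 * t)) x * indicator {G r1..G r2} x) \<partial>lborel) =
     (\<integral>\<^sup>+y\<in>{G r1..G r2}. ennreal (normal_density c (sqrt (2 * t)) y) \<partial>lborel)"
    by (intro nn_integral_cong) (auto split: split_indicator)
  moreover have "(\<integral>\<^sup>+x. ennreal (normal_density c (sqrt (2 * t)) (G x) * g x * indicator {r1..r2} x) \<partial>lborel) =
     (\<integral>\<^sup>+r\<in>{r1..r2}. ennreal (normal_density c (sqrt (2 * t)) (G r) * g r) \<partial>lborel)"
    by (intro nn_integral_cong) (auto split: split_indicator)
  ultimately show ?thesis by simp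
qed

text \<open>On \<open>{0..real j}\<close> the substitution by height gives part of a Gaussian of
  mass 1; monotone convergence extends the bound to the half-line.\<close>

lemma nn_integral_profile_le_1:
  assumes "0 < t"
  shows "(\<integral>\<^sup>+r\<in>{0..}. ennreal (normal_density c (sqrt (2 * t)) (G r) * g r) \<partial>lborel) \<le> 1"
proof -
  define u where "u j r = ennreal (normal_density c (sqrt (2 * t)) (G r) * g r) * indicator {0..real j} r" for j r
  have inc: "incseq u"
    by (auto simp: incseq_def le_fun_def u_def split: split_indicator)
  have sup: "(SUP j. u j r) = ennreal (normal_density c (sqrt (2 * t)) (G r) * g r) * indicator {0..} r" for r
  proof (cases "0 \<le> r")
    case True
    obtain N where "r \<le> real N" using real_arch_simple by blast
    then have "u N r = ennreal (normal_density c (sqrt (2 * t)) (G r) * g r)" using True by (simp add: u_def)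
    moreover have "u j r \<le> ennreal (normal_density c (sqrt (2 * t)) (G r) * g r)" for j
      by (auto simp: u_def split: split_indicator)
    ultimately have "(SUP j. u j r) = ennreal (normal_density c (sqrt (2 * t)) (G r) * g r)"
      by (intro antisym SUP_least) (auto intro: SUP_upper2[of N])
    then show ?thesis using True by simp
  qed (simp add: u_def)
  have "(\<integral>\<^sup>+r\<in>{0..}. ennreal (normal_density c (sqrt (2 * t)) (G r) * g r) \<partial>lborel) = (\<integral>\<^sup>+r. (SUP j. u j r) \<partial>lborel)"
    by (simp add: sup)
  also have "\<dots> = (SUP j. \<integral>\<^sup>+r. u j r \<partial>lborel)"
    by (rule nn_integral_monotone_convergence_SUP[OF inc]) (unfold u_def[abs_def], measurable)
  also have "\<dots> \<le> 1"
  proof (rule SUP_least)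
    fix j
    have "(\<integral>\<^sup>+r. u j r \<partial>lborel) = (\<integral>\<^sup>+y\<in>{G 0..G (real j)}. ennreal (normal_density c (sqrt (2 * t)) y) \<partial>lborel)"
      unfolding u_def by (rule nn_integral_profile_interval) (use assms in auto)
    also have "\<dots> \<le> (\<integral>\<^sup>+y. ennreal (normal_density c (sqrt (2 * t)) y) \<partial>lborel)"
      by (intro nn_integral_mono) (auto split: split_indicator)
    also have "\<dots> = 1" using assms by (simp add: nn_integral_normal_density)
    finally show "(\<integral>\<^sup>+r. u j r \<partial>lborel) \<le> 1" .
  qed
  finally show ?thesis .
qed

text \<open>The height substitution needs the factor \<open>g r\<close>. The area density is at most
  \<open>1 + g r\<close>, and \<open>r \<le> n * g r\<close> absorbs the 1 into a shift of the
  radius from \<open>r\<close> to \<open>r + n\<close>, where \<open>n = CARD('n)\<close>. This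
  shift and the offset \<open>A\<close> cost a fraction \<delta> of the exponent and the exponential
  factor; \<open>power_times_gaussian_le\<close> then bounds what is left.\<close>

lemma weight_le:
  assumes r: "0 \<le> r" and t: "0 < t" and \<delta>: "0 < \<delta>" "\<delta> < 1" and A: "0 \<le> A"
  shows "r ^ k * sqrt (1 + (g r)\<^sup>2) * exp (- (r - A)\<^sup>2 / (4 * t)) \<le>
    (m / (2 * ((1 - \<delta>) / (4 * t)) * exp 1)) powr (m / 2) * exp ((A + real CARD('n))\<^sup>2 / (4 * t * \<delta>)) * g r"
proof -
  define n where "n = real CARD('n)"
  define w where "w = r + n"
  define A' where "A' = A + n"
  define \<kappa> where "\<kappa> = (1 - \<delta>) / (4 * t)"
  have n0: "0 \<le> n" by (simp add: n_def)
  have w: "0 \<le> w" using r by (simp add: w_def n_def)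
  have g0: "0 \<le> g r" using r by (rule g_nonneg)
  have \<kappa>: "0 < \<kappa>" using t \<delta> by (simp add: \<kappa>_def)
  have "sqrt (1 + (g r)\<^sup>2) \<le> 1 + g r"
    using g0 by (intro real_le_lsqrt) (auto simp: power2_sum)
  then have "r ^ k * sqrt (1 + (g r)\<^sup>2) \<le> r ^ k * (1 + g r)" using r by (intro mult_left_mono) auto
  also have "\<dots> \<le> w ^ k * g r"
  proof -
    have rk: "r ^ k = r ^ (k - 1) * r" using k(2) by (simp add: power_eq_if mult.commute)
    have wk: "w ^ k = w ^ (k - 1) * w" using k(2) by (simp add: power_eq_if mult.commute)
    have "r ^ (k - 1) * r \<le> r ^ (k - 1) * (n * g r)"
      using g_lower[OF r] r by (intro mult_left_mono) (auto simp: n_def)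
    then have "r ^ k * (1 + g r) \<le> r ^ (k - 1) * (w * g r)"
      unfolding rk w_def by (simp add: algebra_simps)
    also have "\<dots> \<le> w ^ (k - 1) * (w * g r)"
      using r w g0 n0 by (intro mult_right_mono power_mono) (auto simp: w_def)
    finally show ?thesis unfolding wk by (simp add: mult.assoc)
  qed
  finally have 1: "r ^ k * sqrt (1 + (g r)\<^sup>2) \<le> w ^ k * g r" .
  \<comment> \<open>Completing the square trades the offset for a share \<delta> of
    \<open>w\<^sup>2\<close>. Here \<open>w - A' = r - A\<close>, since both are shifted by
    \<open>n\<close>.\<close>
  have "0 \<le> (\<delta> * w - A')\<^sup>2 / \<delta> + A'\<^sup>2" using \<delta> by simp
  also have "\<dots> = (w - A')\<^sup>2 - (1 - \<delta>) * w\<^sup>2 + A'\<^sup>2 / \<delta>"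
    using \<delta> by (simp add: power2_eq_square field_simps)
  finally have "(1 - \<delta>) * w\<^sup>2 - A'\<^sup>2 / \<delta> \<le> (r - A)\<^sup>2" by (simp add: w_def A'_def)
  then have "((1 - \<delta>) * w\<^sup>2 - A'\<^sup>2 / \<delta>) / (4 * t) \<le> (r - A)\<^sup>2 / (4 * t)" using t by (intro divide_right_mono) auto
  moreover have "((1 - \<delta>) * w\<^sup>2 - A'\<^sup>2 / \<delta>) / (4 * t) = \<kappa> * w\<^sup>2 - A'\<^sup>2 / (4 * t * \<delta>)"
    using t \<delta> by (simp add: \<kappa>_def field_simps)
  ultimately have "exp (- (r - A)\<^sup>2 / (4 * t)) \<le> exp (- \<kappa> * w\<^sup>2 + A'\<^sup>2 / (4 * t * \<delta>))"
    by simp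
  then have 2: "exp (- (r - A)\<^sup>2 / (4 * t)) \<le> exp (- \<kappa> * w\<^sup>2) * exp (A'\<^sup>2 / (4 * t * \<delta>))"
    by (simp only: exp_add)
  have "r ^ k * sqrt (1 + (g r)\<^sup>2) * exp (- (r - A)\<^sup>2 / (4 * t)) \<le> (w ^ k * g r) * (exp (- \<kappa> * w\<^sup>2) * exp (A'\<^sup>2 / (4 * t * \<delta>)))"
    by (rule mult_mono[OF 1 2]) (use w g0 in auto)
  also have "\<dots> = (w ^ k * exp (- \<kappa> * w\<^sup>2)) * exp (A'\<^sup>2 / (4 * t * \<delta>)) * g r" by (simp add: mult_ac)
  also have "\<dots> \<le> (m / (2 * \<kappa> * exp 1)) powr (m / 2) * exp (A'\<^sup>2 / (4 * t * \<delta>)) * g r"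
    using power_times_gaussian_le[OF w \<kappa> k(2)] g0 by (intro mult_right_mono) (auto simp: k)
  finally show ?thesis by (simp add: \<kappa>_def A'_def n_def)
qed

lemma \<Phi>_upper:
  assumes t: "0 < t" and \<delta>: "0 < \<delta>" "\<delta> < 1"
  shows "\<Phi> a c t \<le> \<Lambda> * (1 - \<delta>) powr (- (m / 2)) * exp ((norm a + real CARD('n))\<^sup>2 / (4 * t * \<delta>))"
proof -
  define A where "A = norm a"
  define N where "N = normal_density c (sqrt (2 * t))"
  define B where "B = (m / (2 * ((1 - \<delta>) / (4 * t)) * exp 1)) powr (m / 2) * exp ((A + real CARD('n))\<^sup>2 / (4 * t * \<delta>))"
  define h where "h r = sqrt (1 + (g r)\<^sup>2) * exp (- (((r - A)\<^sup>2 + (G r - c)\<^sup>2) / (4 * t)))" for r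
  \<comment> \<open>The square root of \<open>4 * pi * t\<close>, split off so that the height
    factor becomes a probability density.\<close>
  define s where "s = (4 * pi * t) powr (1 / 2)"
  have s: "0 < s" using t by (simp add: s_def)
  have B0: "0 \<le> B" by (simp add: B_def)
  have hm: "h \<in> borel_measurable borel" unfolding h_def by measurable
  have h0: "0 \<le> h r" for r by (simp add: h_def)
  \<comment> \<open>The distance to \<open>a\<close> is at least the difference of the norms, which
    leaves a radial integrand.\<close>
  have DKh: "D x * K a c t x \<le> h (norm x)" for x
  proof -
    have "(norm x - A)\<^sup>2 \<le> (norm (x - a))\<^sup>2"
      unfolding A_def using norm_triangle_ineq3[of x a] by (rule abs_le_square_iff[THEN iffD1, unfolded abs_norm_cancel, rotated -1, of "norm x - norm a" "norm (x - a)", simplified])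
    then have "((norm x - A)\<^sup>2 + (f x - c)\<^sup>2) / (4 * t) \<le> ((norm (x - a))\<^sup>2 + (f x - c)\<^sup>2) / (4 * t)"
      using t by (intro divide_right_mono) auto
    then show ?thesis unfolding h_def K_def D_radial f_radial[of x] by (intro mult_left_mono) auto
  qed
  have point: "r ^ k * h r \<le> B * s * (N (G r) * g r)" if "0 \<le> r" for r
  proof -
    have e: "exp (- (((r - A)\<^sup>2 + (G r - c)\<^sup>2) / (4 * t))) = exp (- (r - A)\<^sup>2 / (4 * t)) * exp (- (G r - c)\<^sup>2 / (4 * t))"
      by (simp add: mult_exp_exp add_divide_distrib)
    have "s * N (G r) = exp (- (G r - c)\<^sup>2 / (4 * t))"
      using t unfolding N_def normal_density_heat[OF t] s_def by (simp add: powr_minus)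
    then have e1: "B * s * (N (G r) * g r) = (B * g r) * exp (- (G r - c)\<^sup>2 / (4 * t))" by (simp add: mult_ac)
    have e2: "r ^ k * h r = (r ^ k * sqrt (1 + (g r)\<^sup>2) * exp (- (r - A)\<^sup>2 / (4 * t))) * exp (- (G r - c)\<^sup>2 / (4 * t))"
      unfolding h_def e by (simp add: mult_ac)
    have "r ^ k * sqrt (1 + (g r)\<^sup>2) * exp (- (r - A)\<^sup>2 / (4 * t)) \<le> B * g r"
      unfolding B_def by (rule weight_le[OF that t \<delta>]) (simp add: A_def)
    then show ?thesis unfolding e1 e2 by (rule mult_right_mono) simp
  qed
  have "ennreal (\<integral>x. D x * K a c t x \<partial>lborel) = (\<integral>\<^sup>+x. ennreal (D x * K a c t x) \<partial>lborel)"
    by (rule nn_integral_DK[OF t, symmetric])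
  also have "\<dots> \<le> (\<integral>\<^sup>+x. ennreal (h (norm x)) \<partial>(lborel :: (real^'n) measure))"
    by (intro nn_integral_mono ennreal_leI DKh)
  also have "\<dots> = ennreal (real CARD('n) * \<alpha>) * (\<integral>\<^sup>+r\<in>{0..}. ennreal (r ^ k * h r) \<partial>lborel)"
    unfolding \<alpha>_def k_def by (rule nn_integral_radial[OF hm h0])
  also have "(\<integral>\<^sup>+r\<in>{0..}. ennreal (r ^ k * h r) \<partial>lborel) \<le> (\<integral>\<^sup>+r. ennreal (B * s) * (ennreal (N (G r) * g r) * indicator {0..} r) \<partial>lborel)"
    using point B0 s by (intro nn_integral_mono) (auto split: split_indicator simp: ennreal_mult'[symmetric] intro: ennreal_leI)
  also have "\<dots> = ennreal (B * s) * (\<integral>\<^sup>+r\<in>{0..}. ennreal (N (G r) * g r) \<partial>lborel)"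
    unfolding N_def by (rule nn_integral_cmult) measurable
  also have "\<dots> \<le> ennreal (B * s) * 1"
    unfolding N_def by (intro mult_left_mono nn_integral_profile_le_1 t) simp
  finally have "ennreal (\<integral>x. D x * K a c t x \<partial>lborel) \<le> ennreal (real CARD('n) * \<alpha> * (B * s))"
    using \<alpha>_nonneg by (simp add: ennreal_mult' mult_left_mono)
  then have "(\<integral>x. D x * K a c t x \<partial>lborel) \<le> real CARD('n) * \<alpha> * (B * s)"
    using \<alpha>_nonneg B0 s by (subst (asm) ennreal_le_iff) auto
  then have "\<Phi> a c t \<le> (4 * pi * t) powr (- (real CARD('n) / 2)) * (real CARD('n) * \<alpha> * (B * s))"
    unfolding \<Phi>_def by (intro mult_left_mono) auto
  also have "\<dots> = \<Lambda> * (1 - \<delta>) powr (- (m / 2)) * exp ((A + real CARD('n))\<^sup>2 / (4 * t * \<delta>))"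
  proof -
    have e1: "(4 * pi * t) powr (- (real CARD('n) / 2)) * s = (4 * pi * t) powr (- (m / 2))"
      unfolding s_def powr_add[symmetric] by (simp add: m field_simps)
    \<comment> \<open>The time cancels between the heat normalisation and the maximal value of the
      radial factor.\<close>
    have e2: "(4 * pi * t) powr (- (m / 2)) * (m / (2 * ((1 - \<delta>) / (4 * t)) * exp 1)) powr (m / 2)
       = (m / (2 * pi * exp 1)) powr (m / 2) * (1 - \<delta>) powr (- (m / 2))"
    proof -
      have "(4 * pi * t) powr (- (m / 2)) = (1 / (4 * pi * t)) powr (m / 2)"
        using t by (intro powr_uminus_eq_inverse_powr) simp
      moreover have "(1 - \<delta>) powr (- (m / 2)) = (1 / (1 - \<delta>)) powr (m / 2)"
        using \<delta> by (intro powr_uminus_eq_inverse_powr) simp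
      moreover have "1 / (4 * pi * t) * (m / (2 * ((1 - \<delta>) / (4 * t)) * exp 1)) = m / (2 * pi * exp 1) * (1 / (1 - \<delta>))"
        using t \<delta> by (simp add: field_simps)
      moreover have "(1 / (4 * pi * t)) powr (m / 2) * (m / (2 * ((1 - \<delta>) / (4 * t)) * exp 1)) powr (m / 2)
          = (1 / (4 * pi * t) * (m / (2 * ((1 - \<delta>) / (4 * t)) * exp 1))) powr (m / 2)"
        by (rule powr_mult[symmetric])
      moreover have "(m / (2 * pi * exp 1)) powr (m / 2) * (1 / (1 - \<delta>)) powr (m / 2) = (m / (2 * pi * exp 1) * (1 / (1 - \<delta>))) powr (m / 2)"
        by (rule powr_mult[symmetric])
      ultimately show ?thesis by (simp only:)
    qed
    have ac: "p1 * (c1 * ((z * y) * s1)) = c1 * ((p1 * s1) * z) * y" for p1 c1 z y s1 :: real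
      by simp
    show ?thesis unfolding B_def \<Lambda>_def ac e1 e2 by (simp only: mult.assoc)
  qed
  finally show ?thesis by (simp add: A_def)
qed

text \<open>\<open>\<Phi>_mono\<close> pushes the scale to \<open>t + T\<close>, where
  \<open>\<Phi>_upper\<close> is applied with \<delta> the inverse square root of
  \<open>t + T\<close>. With this choice \<delta> tends to 0 while \<open>(t + T) * \<delta>\<close>
  tends to infinity, so both error factors tend to 1 as \<open>T\<close> grows.\<close>

lemma \<Phi>_le:
  assumes t: "0 < t"
  shows "\<Phi> a c t \<le> \<Lambda>"
proof -
  define \<delta> where "\<delta> T = inverse (sqrt (t + T))" for T
  have lim\<delta>: "(\<delta> \<longlongrightarrow> 0) at_top"
    unfolding \<delta>_def
    by (intro tendsto_inverse_0_at_top filterlim_compose[OF sqrt_at_top] filterlim_tendsto_add_at_top[OF tendsto_const] filterlim_ident)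
  have "((\<lambda>T. \<Lambda> * (1 - \<delta> T) powr (- (m / 2)) * exp ((norm a + real CARD('n))\<^sup>2 / 4 * \<delta> T)) \<longlongrightarrow>
      \<Lambda> * (1 - 0) powr (- (m / 2)) * exp ((norm a + real CARD('n))\<^sup>2 / 4 * 0)) at_top"
    by (intro tendsto_intros lim\<delta>) auto
  then have "((\<lambda>T. \<Lambda> * (1 - \<delta> T) powr (- (m / 2)) * exp ((norm a + real CARD('n))\<^sup>2 / 4 * \<delta> T)) \<longlongrightarrow> \<Lambda>) at_top"
    by simp
  moreover have "eventually (\<lambda>T. \<Phi> a c t \<le> \<Lambda> * (1 - \<delta> T) powr (- (m / 2)) * exp ((norm a + real CARD('n))\<^sup>2 / 4 * \<delta> T)) at_top"
    using eventually_gt_at_top[of 1]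
  proof eventually_elim
    case (elim T)
    have tT: "0 < t + T" "1 < t + T" using t elim by auto
    then have "1 < sqrt (t + T)" by simp
    then have d: "0 < \<delta> T" "\<delta> T < 1" by (auto simp: \<delta>_def inverse_less_1_iff)
    have "\<Phi> a c t \<le> \<Phi> a (c + T) (t + T)" using elim by (intro \<Phi>_mono t) simp
    also have "\<dots> \<le> \<Lambda> * (1 - \<delta> T) powr (- (m / 2)) * exp ((norm a + real CARD('n))\<^sup>2 / (4 * (t + T) * \<delta> T))"
      by (rule \<Phi>_upper[OF tT(1) d])
    also have "(norm a + real CARD('n))\<^sup>2 / (4 * (t + T) * \<delta> T) = (norm a + real CARD('n))\<^sup>2 / 4 * \<delta> T"
    proof -
      have sq: "sqrt (t + T) * sqrt (t + T) = t + T" using tT by simp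
      have "(t + T) * \<delta> T = sqrt (t + T)" unfolding \<delta>_def using tT by (subst sq[symmetric]) (simp add: field_simps)
      then have "4 * (t + T) * \<delta> T = 4 * sqrt (t + T)" by (simp only: mult.assoc)
      moreover have "z / (4 * y) = z / 4 * inverse y" for z y :: real unfolding divide_inverse by simp
      ultimately show ?thesis by (simp only: \<delta>_def)
    qed
    finally show ?case .
  qed
  ultimately show ?thesis by (intro tendsto_lowerbound) auto
qed

section \<open>Lower bound from an almost cylindrical window\<close>

lemma G_tangent: "g r * (u - r) \<le> G u - G r"
  by (rule convex_on_imp_above_tangent[OF convex_G])
    (auto intro: has_field_derivative_at_within G_has_derivative)

text \<open>The radius \<open>R = \<rho>\<^sup>2\<close> and the window from
  \<open>R - \<rho>\<close> to \<open>R + \<rho>\<close> balance two demands. Relative to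
  \<open>R\<close> the window shrinks like \<open>1 / \<rho>\<close>, so the radial factor stays
  near its maximum, attained at \<open>R\<close>. The image of the window under \<open>G\<close>
  contains all heights within \<open>R * (\<rho> - 1) / CARD('n)\<close> of \<open>G R\<close>, for
  large \<rho> many standard deviations \<open>R / sqrt m\<close> of the height Gaussian, so little
  mass is lost.\<close>

lemma \<Phi>_lower:
  assumes \<rho>: "1 < \<rho>"
  shows "real CARD('n) * \<alpha> * ((m / (2 * pi)) powr (m / 2) * (1 - 1 / \<rho>) ^ k * exp (- (m / 2) * (1 + 1 / \<rho>)\<^sup>2)) *
     (1 - (real CARD('n))\<^sup>2 / (m * (\<rho> - 1)\<^sup>2)) \<le> \<Phi> 0 (G (\<rho>\<^sup>2)) ((\<rho>\<^sup>2)\<^sup>2 / (2 * m))"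
proof -
  define R where "R = \<rho>\<^sup>2"
  define t where "t = R\<^sup>2 / (2 * m)"
  define c where "c = G R"
  define N where "N = normal_density c (sqrt (2 * t))"
  define s where "s = (4 * pi * t) powr (1 / 2)"
  \<comment> \<open>Half the width of the window times the least slope that \<open>g_lower\<close>
    and monotonicity guarantee there.\<close>
  define l where "l = (R - \<rho>) / real CARD('n) * \<rho>"
  \<comment> \<open>The radial factor is bounded below by the power at the inner end and the
    Gaussian at the outer end of the window.\<close>
  define B where "B = (R - \<rho>) ^ k * exp (- (R + \<rho>)\<^sup>2 / (4 * t))"
  define h where "h r = sqrt (1 + (g r)\<^sup>2) * exp (- ((r\<^sup>2 + (G r - c)\<^sup>2) / (4 * t)))" for r
  have R: "0 < R" "\<rho> < R" "R - \<rho> = \<rho> * (\<rho> - 1)" using \<rho> by (auto simp: R_def power2_eq_square algebra_simps)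
  have t: "0 < t" using R m by (simp add: t_def)
  have s: "0 < s" using t by (simp add: s_def)
  have l: "0 < l" using R \<rho> by (simp add: l_def)
  have B0: "0 \<le> B" using R by (simp add: B_def)
  have hm: "h \<in> borel_measurable borel" unfolding h_def by measurable
  have h0: "0 \<le> h r" for r by (simp add: h_def)
  have DKh: "D x * K 0 c t x = h (norm x)" for x
    unfolding h_def K_def D_radial f_radial[of x] by simp
  have glow: "(R - \<rho>) / real CARD('n) \<le> g r" if "R - \<rho> \<le> r" for r
  proof -
    have "R - \<rho> \<le> real CARD('n) * g (R - \<rho>)" using R by (intro g_lower) simp
    also have "\<dots> \<le> real CARD('n) * g r" using g_mono[OF that] by (intro mult_left_mono) auto
    finally show ?thesis by (simp add: field_simps)
  qed
  have G1: "G (R - \<rho>) \<le> c - l"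
  proof -
    have "l \<le> g (R - \<rho>) * \<rho>" unfolding l_def using glow[of "R - \<rho>"] \<rho> by (intro mult_right_mono) auto
    also have "\<dots> \<le> G R - G (R - \<rho>)" using G_tangent[of "R - \<rho>" R] by simp
    finally show ?thesis by (simp add: c_def)
  qed
  have G2: "c + l \<le> G (R + \<rho>)"
  proof -
    have "l \<le> g R * \<rho>" unfolding l_def using glow[of R] \<rho> by (intro mult_right_mono) auto
    also have "\<dots> \<le> G (R + \<rho>) - G R" using G_tangent[of R "R + \<rho>"] by simp
    finally show ?thesis by (simp add: c_def)
  qed
  have point: "B * s * (N (G r) * g r) \<le> r ^ k * h r" if r: "r \<in> {R - \<rho>..R + \<rho>}" for r
  proof -
    have r0: "0 \<le> r" using r R by auto
    have "s * N (G r) = exp (- (G r - c)\<^sup>2 / (4 * t))"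
      using t unfolding N_def normal_density_heat[OF t] s_def by (simp add: powr_minus)
    then have "B * s * (N (G r) * g r) = ((R - \<rho>) ^ k * g r * exp (- (R + \<rho>)\<^sup>2 / (4 * t))) * exp (- (G r - c)\<^sup>2 / (4 * t))"
      by (simp add: B_def mult_ac)
    also have "\<dots> \<le> (r ^ k * sqrt (1 + (g r)\<^sup>2) * exp (- r\<^sup>2 / (4 * t))) * exp (- (G r - c)\<^sup>2 / (4 * t))"
    proof (intro mult_right_mono mult_mono)
      show "(R - \<rho>) ^ k \<le> r ^ k" using r R by (intro power_mono) auto
      show "g r \<le> sqrt (1 + (g r)\<^sup>2)" by (rule real_le_rsqrt) simp
      have "r\<^sup>2 \<le> (R + \<rho>)\<^sup>2" using r r0 by (intro power_mono) auto
      then show "exp (- (R + \<rho>)\<^sup>2 / (4 * t)) \<le> exp (- r\<^sup>2 / (4 * t))" using t by (simp add: divide_right_mono)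
    qed (use r0 g_nonneg[OF r0] in auto)
    also have "\<dots> = r ^ k * h r"
      unfolding h_def by (simp add: mult_exp_exp add_divide_distrib mult_ac)
    finally show ?thesis .
  qed
  have "ennreal (real CARD('n) * \<alpha> * (B * s)) * ennreal (1 - (sqrt (2 * t))\<^sup>2 / l\<^sup>2)
    \<le> ennreal (real CARD('n) * \<alpha> * (B * s)) * (\<integral>\<^sup>+y\<in>{c - l..c + l}. ennreal (N y) \<partial>lborel)"
    unfolding N_def using t l by (intro mult_left_mono normal_density_mean_square_bound) auto
  also have "\<dots> \<le> ennreal (real CARD('n) * \<alpha> * (B * s)) * (\<integral>\<^sup>+y\<in>{G (R - \<rho>)..G (R + \<rho>)}. ennreal (N y) \<partial>lborel)"
    using G1 G2 by (intro mult_left_mono nn_integral_mono) (auto split: split_indicator)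
  also have "(\<integral>\<^sup>+y\<in>{G (R - \<rho>)..G (R + \<rho>)}. ennreal (N y) \<partial>lborel) = (\<integral>\<^sup>+r\<in>{R - \<rho>..R + \<rho>}. ennreal (N (G r) * g r) \<partial>lborel)"
    unfolding N_def by (rule nn_integral_profile_interval[symmetric]) (use R \<rho> t in auto)
  also have "ennreal (real CARD('n) * \<alpha> * (B * s)) * \<dots> = ennreal (real CARD('n) * \<alpha>) * (ennreal (B * s) * \<dots>)"
    using \<alpha>_nonneg by (simp add: ennreal_mult' mult.assoc)
  also have "ennreal (B * s) * (\<integral>\<^sup>+r\<in>{R - \<rho>..R + \<rho>}. ennreal (N (G r) * g r) \<partial>lborel) =
     (\<integral>\<^sup>+r. ennreal (B * s) * (ennreal (N (G r) * g r) * indicator {R - \<rho>..R + \<rho>} r) \<partial>lborel)"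
    unfolding N_def by (rule nn_integral_cmult[symmetric]) measurable
  also have "\<dots> \<le> (\<integral>\<^sup>+r\<in>{0..}. ennreal (r ^ k * h r) \<partial>lborel)"
    using point B0 s R by (intro nn_integral_mono) (auto split: split_indicator simp: ennreal_mult'[symmetric] intro: ennreal_leI)
  also have "ennreal (real CARD('n) * \<alpha>) * \<dots> = (\<integral>\<^sup>+x. ennreal (h (norm x)) \<partial>(lborel :: (real^'n) measure))"
    unfolding \<alpha>_def k_def by (rule nn_integral_radial[OF hm h0, symmetric])
  also have "\<dots> = ennreal (\<integral>x. D x * K 0 c t x \<partial>lborel)"
    unfolding DKh[symmetric] by (rule nn_integral_DK[OF t])
  finally have le: "ennreal (real CARD('n) * \<alpha> * (B * s) * (1 - (sqrt (2 * t))\<^sup>2 / l\<^sup>2)) \<le> ennreal (\<integral>x. D x * K 0 c t x \<partial>lborel)"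
    using \<alpha>_nonneg B0 s by (simp add: ennreal_mult' mult_left_mono)
  \<comment> \<open>For \<rho> near 1 the Chebyshev factor is negative and \<open>ennreal\<close>
    reads it as 0; going back to the reals then needs a nonnegative right-hand side.\<close>
  have "0 \<le> (\<integral>x. D x * K 0 c t x \<partial>lborel)"
    using D_pos(2) K_le(1)[OF t order_refl] by (intro Bochner_Integration.integral_nonneg) (simp add: less_imp_le)
  then have "real CARD('n) * \<alpha> * (B * s) * (1 - (sqrt (2 * t))\<^sup>2 / l\<^sup>2) \<le> (\<integral>x. D x * K 0 c t x \<partial>lborel)"
    using le by (simp add: ennreal_le_iff)
  then have "(4 * pi * t) powr (- (real CARD('n) / 2)) * (real CARD('n) * \<alpha> * (B * s) * (1 - (sqrt (2 * t))\<^sup>2 / l\<^sup>2)) \<le> \<Phi> 0 c t"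
    unfolding \<Phi>_def by (intro mult_left_mono) auto
  also have "(4 * pi * t) powr (- (real CARD('n) / 2)) * (real CARD('n) * \<alpha> * (B * s) * (1 - (sqrt (2 * t))\<^sup>2 / l\<^sup>2))
    = real CARD('n) * \<alpha> * (((4 * pi * t) powr (- (real CARD('n) / 2)) * s) * B) * (1 - (sqrt (2 * t))\<^sup>2 / l\<^sup>2)"
    by (simp add: mult_ac)
  also have "((4 * pi * t) powr (- (real CARD('n) / 2)) * s) * B = (m / (2 * pi)) powr (m / 2) * (1 - 1 / \<rho>) ^ k * exp (- (m / 2) * (1 + 1 / \<rho>)\<^sup>2)"
  proof -
    have "(4 * pi * t) powr (- (real CARD('n) / 2)) * s = (4 * pi * t) powr (- (m / 2))"
      unfolding s_def powr_add[symmetric] by (simp add: m field_simps)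
    moreover have "4 * pi * t = (2 * pi / m) * R\<^sup>2" using m by (simp add: t_def)
    moreover have "((2 * pi / m) * R\<^sup>2) powr (- (m / 2)) = (m / (2 * pi)) powr (m / 2) * (1 / R) ^ k"
    proof -
      have "(R\<^sup>2) powr (- (m / 2)) = (1 / R) ^ k"
      proof -
        have "(R\<^sup>2) powr (- (m / 2)) = R powr (- m)"
        proof -
          have "R\<^sup>2 = R powr 2" using R by simp
          then show ?thesis by (simp only: powr_powr) simp
        qed
        also have "\<dots> = (1 / R) powr (real k)" unfolding k(1) using R(1) by (rule powr_uminus_eq_inverse_powr)
        also have "\<dots> = (1 / R) ^ k" using R by (intro powr_realpow) simp
        finally show ?thesis .
      qed
      moreover have "(2 * pi / m) powr (- (m / 2)) = (m / (2 * pi)) powr (m / 2)"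
        using powr_uminus_eq_inverse_powr[of "2 * pi / m" "m / 2"] m by simp
      moreover have "((2 * pi / m) * R\<^sup>2) powr (- (m / 2)) = (2 * pi / m) powr (- (m / 2)) * (R\<^sup>2) powr (- (m / 2))"
        by (rule powr_mult)
      ultimately show ?thesis by (simp only:)
    qed
    ultimately have 1: "(4 * pi * t) powr (- (real CARD('n) / 2)) * s = (m / (2 * pi)) powr (m / 2) * (1 / R) ^ k"
      by (simp only:)
    have 2: "(1 / R) ^ k * (R - \<rho>) ^ k = (1 - 1 / \<rho>) ^ k"
    proof -
      have "1 / R * (R - \<rho>) = 1 - 1 / \<rho>" using \<rho> by (simp add: R_def power2_eq_square field_simps)
      then show ?thesis by (simp add: power_mult_distrib[symmetric])
    qed
    have 3: "- (R + \<rho>)\<^sup>2 / (4 * t) = - (m / 2) * (1 + 1 / \<rho>)\<^sup>2"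
    proof -
      have "(R + \<rho>) / R = 1 + 1 / \<rho>" using \<rho> by (simp add: R_def power2_eq_square field_simps)
      then have e: "(1 + 1 / \<rho>)\<^sup>2 = (R + \<rho>)\<^sup>2 / R\<^sup>2" by (simp add: power_divide[symmetric])
      have "4 * t = 2 * R\<^sup>2 / m" by (simp add: t_def)
      moreover have "- Z / (2 * Q / m) = - (m / 2) * (Z / Q)" for Z Q :: real by simp
      ultimately show ?thesis unfolding e by (simp only:)
    qed
    show ?thesis unfolding 1 B_def 3 2[symmetric] by (simp add: mult_ac)
  qed
  also have "(sqrt (2 * t))\<^sup>2 / l\<^sup>2 = (real CARD('n))\<^sup>2 / (m * (\<rho> - 1)\<^sup>2)"
  proof -
    have "(sqrt (2 * t))\<^sup>2 = R\<^sup>2 / m" using t m by (simp add: t_def)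
    moreover have "l = R * (\<rho> - 1) / real CARD('n)" unfolding l_def R(3) by (simp add: R_def power2_eq_square)
    ultimately show ?thesis using R m \<rho> by (simp add: power_divide power_mult_distrib)
  qed
  finally show ?thesis by (simp add: c_def t_def R_def)
qed

lemma entropy_bowl: "entropy TYPE('n) (graph_of f) = ennreal \<Lambda>"
proof (rule antisym)
  show "entropy TYPE('n) (graph_of f) \<le> ennreal \<Lambda>"
    unfolding entropy_def
  proof (intro SUP_least)
    fix z :: "(real^'n) \<times> real" and t :: real assume "t \<in> {0<..}"
    then have t: "0 < t" by simp
    show "F_functional TYPE('n) z t (graph_of f) \<le> ennreal \<Lambda>"
      using F_functional_bowl[OF t, of "fst z" "snd z"] \<Phi>_le[OF t, of "fst z" "snd z"] by (simp add: ennreal_leI)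
  qed
  define L where "L \<rho> = real CARD('n) * \<alpha> * ((m / (2 * pi)) powr (m / 2) * (1 - 1 / \<rho>) ^ k * exp (- (m / 2) * (1 + 1 / \<rho>)\<^sup>2)) *
     (1 - (real CARD('n))\<^sup>2 / (m * (\<rho> - 1)\<^sup>2))" for \<rho> :: real
  have inv: "((\<lambda>\<rho>::real. 1 / \<rho>) \<longlongrightarrow> 0) at_top"
    unfolding divide_inverse mult_1 by (rule tendsto_inverse_0_at_top[OF filterlim_ident])
  have inv2: "((\<lambda>\<rho>::real. (real CARD('n))\<^sup>2 / (m * (\<rho> - 1)\<^sup>2)) \<longlongrightarrow> 0) at_top"
  proof -
    have "((\<lambda>\<rho>::real. inverse (\<rho> - 1)) \<longlongrightarrow> 0) at_top"
    proof (rule tendsto_inverse_0_at_top)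
      have "filterlim (\<lambda>\<rho>::real. - 1 + \<rho>) at_top at_top"
        by (rule filterlim_tendsto_add_at_top[OF tendsto_const filterlim_ident])
      then show "filterlim (\<lambda>\<rho>::real. \<rho> - 1) at_top at_top" by simp
    qed
    then have "((\<lambda>\<rho>::real. (real CARD('n))\<^sup>2 / m * (inverse (\<rho> - 1))\<^sup>2) \<longlongrightarrow> (real CARD('n))\<^sup>2 / m * 0\<^sup>2) at_top"
      by (intro tendsto_intros)
    then show ?thesis unfolding divide_inverse by (simp add: power_inverse mult.assoc)
  qed
  have "(L \<longlongrightarrow> real CARD('n) * \<alpha> * ((m / (2 * pi)) powr (m / 2) * (1 - 0) ^ k * exp (- (m / 2) * (1 + 0)\<^sup>2)) * (1 - 0)) at_top"
    unfolding L_def by (intro tendsto_intros inv inv2)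
  also have "real CARD('n) * \<alpha> * ((m / (2 * pi)) powr (m / 2) * (1 - 0) ^ k * exp (- (m / 2) * (1 + 0)\<^sup>2)) * (1 - 0) = \<Lambda>"
  proof -
    have "(m / (2 * pi * exp 1)) powr (m / 2) = (m / (2 * pi)) powr (m / 2) * exp (- (m / 2))"
      using m by (simp add: powr_def ln_div ln_mult exp_add[symmetric] algebra_simps)
    then show ?thesis by (simp add: \<Lambda>_def)
  qed
  finally have "((\<lambda>\<rho>. ennreal (L \<rho>)) \<longlongrightarrow> ennreal \<Lambda>) at_top" by (rule tendsto_ennrealI)
  moreover have "eventually (\<lambda>\<rho>. ennreal (L \<rho>) \<le> entropy TYPE('n) (graph_of f)) at_top"
    using eventually_gt_at_top[of 1]
  proof eventually_elim
    case (elim \<rho>)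
    define t where "t = (\<rho>\<^sup>2)\<^sup>2 / (2 * m)"
    have t: "0 < t" using elim m by (simp add: t_def)
    have "ennreal (L \<rho>) \<le> ennreal (\<Phi> 0 (G (\<rho>\<^sup>2)) t)"
      unfolding L_def t_def by (intro ennreal_leI \<Phi>_lower elim)
    also have "\<dots> = F_functional TYPE('n) (0, G (\<rho>\<^sup>2)) t (graph_of f)"
      by (rule F_functional_bowl[OF t, symmetric])
    also have "\<dots> \<le> entropy TYPE('n) (graph_of f)"
      unfolding entropy_def using t by (intro SUP_upper2[of "(0, G (\<rho>\<^sup>2))"] SUP_upper2[of t]) auto
    finally show ?case .
  qed
  ultimately show "ennreal \<Lambda> \<le> entropy TYPE('n) (graph_of f)"
    by (intro tendsto_upperbound) auto
qed

end

theorem theorem1p4: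
  fixes n :: nat and f :: "real ^ 'n \<Rightarrow> real"
  assumes "n \<ge> 2"
    and "CARD('n::finite) = n"
    and "CARD('k::finite) = n - 1"
    and "bowl_function f"
  shows "entropy TYPE('n) (graph_of f) = entropy TYPE('k) (sphere (0 :: real ^ 'n) 1) \<and>
         entropy TYPE('k) (sphere (0 :: real ^ 'n) 1) =
           ennreal (real n * measure lborel (ball (0 :: real ^ 'n) 1) *
             ((real n - 1) / (2 * pi * exp 1)) powr ((real n - 1) / 2))"
proof -
  interpret bowl f
    by unfold_locales (use assms in auto)
  \<comment> \<open>Any coordinate will do; the enumeration \<open>b\<close> of the others exists by
    counting.\<close>
  obtain i0 :: 'n where True by simp
  have "card (UNIV - {i0}) = CARD('k)" using assms by simp
  then obtain b :: "'k \<Rightarrow> 'n" where b: "bij_betw b UNIV (UNIV - {i0})"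
    using finite_same_card_bij[of "UNIV :: 'k set" "UNIV - {i0}"] by auto
  interpret split_coordinates i0 b
    by unfold_locales (use b in \<open>auto simp: bij_betw_def\<close>)
  have "real CARD('k) = real n - 1" using assms by simp
  then show ?thesis
    using entropy_bowl entropy_sphere assms by (simp add: \<Lambda>_def \<alpha>_def m_def)
qed

end
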